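(* Let $m\ge1$. Let $F$ be a proper rational boundary component of $\mathfrak h_n$ of rank $n-1$, let $\gamma\in\Gamma(4m)$, and suppose $F^\gamma\neq\emptyset$. Then $F^\gamma$ is contained in the closure, in the Satake partial compactification $\overline{\mathfrak h}_n$, of the set $\bigcup_{\gamma'\in\Gamma(4m)}\mathfrak h_n^{\gamma'}$.
   Context: $\mathbf{Sp}(2n,\mathbb R)$: real matrices $g=\begin{pmatrix}A&B\\C&D\end{pmatrix}$ with ${}^tgJg=J$, $J=\begin{pmatrix}0&I\\-I&0\end{pmatrix}$, acting on $\mathfrak h_n=\{Z\in M_n(\mathbb C):{}^tZ=Z,\mathrm{Im}Z>0\}$ by $gZ=(AZ+B)(CZ+D)^{-1}$. $\tau\begin{pmatrix}A&B\\C&D\end{pmatrix}=\begin{pmatrix}A&-B\\-C&D\end{pmatrix}$ and $\tau(Z)=-\overline Z$; $\mathfrak h_n^\gamma=\{Z:\gamma Z=\tau(Z)\}$. $\Gamma(4m)=\{\gamma\in\mathbf{Sp}(2n,\mathbb Z):\gamma\equiv I\bmod 4m\}$. $\overline{\mathfrak h}_n$ is the Satake partial compactification (all rational boundary components attached, Satake topology), on which $\mathbf{Sp}(2n,\mathbb Q)$ acts and to which $\tau$ extends with $\tau(gx)=\tau(g)\tau(x)$. For $1\le q<n$ the standard boundary component $F_q$ is the image of $\mathfrak h_q$ under $Z\mapsto\lim_Y\begin{pmatrix}Z&0\\0&iY\end{pmatrix}$, the limit taken as the positive definite $(n-q)\times(n-q)$ matrix $Y$ goes to infinity (all eigenvalues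 $\to\infty$); a rational boundary component of rank $q$ is a set $gF_q$ with $g\in\mathbf{Sp}(2n,\mathbb Q)$. For a boundary component $F$ and $\gamma$, $F^\gamma=\{x\in F:\tau(x)=\gamma x\}$. *)

theory Defs
  imports "HOL-Analysis.Analysis" "Jordan_Normal_Form.Matrix"
begin

definition minv :: "'a::field mat \<Rightarrow> 'a mat" where
  "minv M = (SOME N. N \<in> carrier_mat (dim_row M) (dim_row M)
                   \<and> M * N = 1\<^sub>m (dim_row M) \<and> N * M = 1\<^sub>m (dim_row M))"

definition Jmat :: "nat \<Rightarrow> real mat" where
  "Jmat n = four_block_mat (0\<^sub>m n n) (1\<^sub>m n) (- 1\<^sub>m n) (0\<^sub>m n n)"

definition is_Sp :: "nat \<Rightarrow> real mat \<Rightarrow> bool" where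
  "is_Sp n g \<longleftrightarrow> g \<in> carrier_mat (2*n) (2*n) \<and> transpose_mat g * Jmat n * g = Jmat n"

definition is_Sp_Q :: "nat \<Rightarrow> real mat \<Rightarrow> bool" where
  "is_Sp_Q n g \<longleftrightarrow> is_Sp n g \<and> (\<forall>i<2*n. \<forall>j<2*n. g $$ (i,j) \<in> \<rat>)"

definition is_Sp_Z :: "nat \<Rightarrow> real mat \<Rightarrow> bool" where
  "is_Sp_Z n g \<longleftrightarrow> is_Sp n g \<and> (\<forall>i<2*n. \<forall>j<2*n. g $$ (i,j) \<in> \<int>)"

definition Gamma_level :: "nat \<Rightarrow> nat \<Rightarrow> real mat \<Rightarrow> bool" where
  "Gamma_level n N g \<longleftrightarrow> is_Sp_Z n g \<and>
     (\<forall>i<2*n. \<forall>j<2*n. \<exists>k::int. g $$ (i,j) - (1\<^sub>m (2*n) :: real mat) $$ (i,j) = real N * of_int k)"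

definition blkA :: "nat \<Rightarrow> 'a mat \<Rightarrow> 'a mat" where
  "blkA n g = mat n n (\<lambda>(i,j). g $$ (i,j))"
definition blkB :: "nat \<Rightarrow> 'a mat \<Rightarrow> 'a mat" where
  "blkB n g = mat n n (\<lambda>(i,j). g $$ (i,j+n))"
definition blkC :: "nat \<Rightarrow> 'a mat \<Rightarrow> 'a mat" where
  "blkC n g = mat n n (\<lambda>(i,j). g $$ (i+n,j))"
definition blkD :: "nat \<Rightarrow> 'a mat \<Rightarrow> 'a mat" where
  "blkD n g = mat n n (\<lambda>(i,j). g $$ (i+n,j+n))"

definition pos_def :: "nat \<Rightarrow> real mat \<Rightarrow> bool" where
  "pos_def n Y \<longleftrightarrow> Y \<in> carrier_mat n n \<and> transpose_mat Y = Y \<and>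
     (\<forall>x \<in> carrier_vec n. x \<noteq> 0\<^sub>v n \<longrightarrow> x \<bullet> (Y *\<^sub>v x) > 0)"

definition siegel :: "nat \<Rightarrow> complex mat \<Rightarrow> bool" where
  "siegel n Z \<longleftrightarrow> Z \<in> carrier_mat n n \<and> transpose_mat Z = Z \<and> pos_def n (map_mat Im Z)"

definition sp_act :: "nat \<Rightarrow> real mat \<Rightarrow> complex mat \<Rightarrow> complex mat" where
  "sp_act n g Z = (let g' = map_mat complex_of_real g in
      (blkA n g' * Z + blkB n g') * minv (blkC n g' * Z + blkD n g'))"

definition tau_g :: "nat \<Rightarrow> real mat \<Rightarrow> real mat" where
  "tau_g n g = four_block_mat (blkA n g) (- blkB n g) (- blkC n g) (blkD n g)"

definition tau_pt :: "complex mat \<Rightarrow> complex mat" where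
  "tau_pt Z = map_mat (\<lambda>z. - cnj z) Z"

definition fixed_set :: "nat \<Rightarrow> real mat \<Rightarrow> complex mat set" where
  "fixed_set n \<gamma> = {Z. siegel n Z \<and> sp_act n \<gamma> Z = tau_pt Z}"

text \<open>The standard boundary component F_{n-1} is identified with h_{n-1}: the point iota(Z) is
  lim_{y\<rightarrow>\<infinity>} diag(Z, iy).  A rational boundary component of rank n-1 is g F_{n-1},
  g in Sp(2n,Q), and its points are g iota(Z), Z in h_{n-1}.  Such a point is represented by the
  pair (g, Z).

  The stabiliser P of F_{n-1} in Sp(2n,Q) consists of the h whose column with index n-1
  (0-based; i.e. the n-th column) is a multiple of the n-th standard basis vector, i.e. h stabilises
  the isotropic line Q e_n.  It acts on F_{n-1} = h_{n-1} through its Levi projection, the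
  2(n-1) x 2(n-1) symplectic matrix obtained by deleting the rows and columns with (0-based)
  indices n-1 and 2n-1.\<close>

definition stab_bc :: "nat \<Rightarrow> real mat \<Rightarrow> bool" where
  "stab_bc n h \<longleftrightarrow> (\<forall>i<2*n. i \<noteq> n - 1 \<longrightarrow> h $$ (i, n - 1) = 0)"

definition levi_proj :: "nat \<Rightarrow> real mat \<Rightarrow> real mat" where
  "levi_proj n h = (let idx = (\<lambda>i. if i < n - 1 then i else i + 1) in
      mat (2*(n-1)) (2*(n-1)) (\<lambda>(i,j). h $$ (idx i, idx j)))"

definition bpt_eq :: "nat \<Rightarrow> real mat \<times> complex mat \<Rightarrow> real mat \<times> complex mat \<Rightarrow> bool" where
  "bpt_eq n p p' = (case p of (g, Z) \<Rightarrow> case p' of (g', Z') \<Rightarrow>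
      (let h = minv g * g' in stab_bc n h \<and> Z = sp_act (n - 1) (levi_proj n h) Z'))"

text \<open>F^gamma for F = g F_{n-1}, as the set of Z in h_{n-1} such that x = g iota(Z) satisfies
  tau(x) = gamma x, where tau(g iota(Z)) = tau(g) iota(tau Z) and gamma (g iota(Z)) = (gamma g) iota(Z).\<close>
definition bc_fixed :: "nat \<Rightarrow> real mat \<Rightarrow> real mat \<Rightarrow> complex mat set" where
  "bc_fixed n g \<gamma> = {Z. siegel (n - 1) Z \<and> bpt_eq n (tau_g n g, tau_pt Z) (\<gamma> * g, Z)}"

text \<open>For W in h_n write W = [[W1, w],[w^t, w']] with W1 of size (n-1).  The height
  t(W) = Im w' - (Im w)^t (Im W1)^{-1} (Im w).  In the Satake topology, the sets
  {W in h_n : W1 in V, t(W) > T} (V a neighbourhood of Z0 in h_{n-1}, T real) together with the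
  corresponding points of F_{n-1} form a neighbourhood basis of iota(Z0); neighbourhoods of
  g iota(Z0) are their g-translates.\<close>

definition height :: "nat \<Rightarrow> complex mat \<Rightarrow> real" where
  "height n W = (let Y = map_mat Im W;
                     Y1 = mat (n-1) (n-1) (\<lambda>(i,j). Y $$ (i,j));
                     y = vec (n-1) (\<lambda>i. Y $$ (i, n-1))
                 in Y $$ (n-1, n-1) - y \<bullet> (minv Y1 *\<^sub>v y))"

definition in_satake_closure :: "nat \<Rightarrow> complex mat set \<Rightarrow> real mat \<Rightarrow> complex mat \<Rightarrow> bool" where
  "in_satake_closure n S g Z0 \<longleftrightarrow>
     (\<forall>\<epsilon>>0. \<forall>T::real. \<exists>W. siegel n W
        \<and> (\<forall>i<n-1. \<forall>j<n-1. cmod (W $$ (i,j) - Z0 $$ (i,j)) < \<epsilon>)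
        \<and> height n W > T \<and> sp_act n g W \<in> S)"

end

theory Submission
  imports Defs "Jordan_Normal_Form.Spectral_Radius"
begin

text \<open>
  Write \<open>T = diag(1,-1)\<close>, so that \<open>\<tau>(g) = TgT\<close>, put \<open>N = 4m\<close>, and let \<open>x = g\<iota>(Z)\<close> satisfy
  \<open>\<gamma>x = \<tau>(x)\<close>. The element \<open>u = \<tau>(\<gamma>)\<gamma>\<close> fixes \<open>x\<close> and lies in \<open>\<Gamma>(2N)\<close>. On the Levi quotient
  it preserves the positive definite form that corresponds to \<open>Z\<close>, and in the two remaining
  diagonal places it has units of \<open>\<int>\<close>; so its eigenvalues have modulus 1. Hence the integral
  matrix \<open>(u-1)/2N\<close> has spectral radius less than 1, its powers tend to 0, and \<open>u\<close> is unipotent.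
  A unipotent isometry is trivial; so \<open>u\<close> is trivial on the Levi quotient and \<open>(u-1)\<^sup>3 = 0\<close>.

  Therefore \<open>u\<close> has the inverse square root \<open>r = 1 - M/2 + 3M\<^sup>2/8\<close>, \<open>M = u-1\<close>, in \<open>\<Gamma>(N)\<close>, and
  \<open>\<gamma>' = \<gamma>r\<close> satisfies \<open>\<tau>(\<gamma>')\<gamma>' = 1\<close> and still \<open>\<gamma>'x = \<tau>(x)\<close>. The antiholomorphic involution
  \<open>W \<mapsto> \<tau>(\<gamma>'W)\<close> preserves the fibre over \<open>x\<close>, which consists of the \<open>gW\<close> with
  \<open>W = (Z, w; w\<^sup>T, c)\<close>. It is affine over the reals in the border \<open>w\<close>, and in the corner \<open>c\<close> once
  \<open>w\<close> is fixed; midpoints of its orbits are fixed points of arbitrarily large height.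
\<close>

unbundle no inner_syntax and no vec_syntax

abbreviation cplx :: "real mat \<Rightarrow> complex mat" where "cplx \<equiv> map_mat complex_of_real"
abbreviation conj_mat :: "complex mat \<Rightarrow> complex mat" where "conj_mat \<equiv> map_mat cnj"

interpretation cnj_hom: comm_ring_hom cnj
  by unfold_locales auto

subsection \<open>Matrix algebra\<close>

text \<open>Side conditions on dimensions instead of carriers contain no schematic sizes, so the
  simplifier can discharge them.\<close>

lemma assoc_mult_mat_dim:
  fixes A :: "'a::semiring_0 mat"
  shows "dim_col A = dim_row B \<Longrightarrow> dim_col B = dim_row C \<Longrightarrow> A * B * C = A * (B * C)"
  by (rule assoc_mult_mat) auto

lemma add_mult_distrib_mat_dim:
  fixes A :: "'a::semiring_0 mat"
  shows "dim_row A = dim_row B \<Longrightarrow> dim_col A = dim_row C \<Longrightarrow> dim_col B = dim_row C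
    \<Longrightarrow> (A + B) * C = A * C + B * C"
  by (rule add_mult_distrib_mat) auto

lemma mult_add_distrib_mat_dim:
  fixes A :: "'a::semiring_0 mat"
  shows "dim_col A = dim_row B \<Longrightarrow> dim_row B = dim_row C \<Longrightarrow> dim_col B = dim_col C
    \<Longrightarrow> A * (B + C) = A * B + A * C"
  by (rule mult_add_distrib_mat) auto

lemma minus_mult_distrib_mat_dim:
  fixes A :: "'a::ring mat"
  shows "dim_row A = dim_row B \<Longrightarrow> dim_col A = dim_row C \<Longrightarrow> dim_col B = dim_row C
    \<Longrightarrow> (A - B) * C = A * C - B * C"
  by (rule minus_mult_distrib_mat) auto

lemma mult_minus_distrib_mat_dim:
  fixes A :: "'a::ring mat"
  shows "dim_col A = dim_row B \<Longrightarrow> dim_row B = dim_row C \<Longrightarrow> dim_col B = dim_col C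
    \<Longrightarrow> A * (B - C) = A * B - A * C"
  by (rule mult_minus_distrib_mat) auto

lemma smult_mult_mat_dim:
  fixes A :: "'a::comm_semiring_0 mat"
  shows "dim_col A = dim_row B \<Longrightarrow> (c \<cdot>\<^sub>m A) * B = c \<cdot>\<^sub>m (A * B)"
  by (rule mult_smult_assoc_mat) auto

lemma mult_smult_mat_dim:
  fixes A :: "'a::comm_semiring_0 mat"
  shows "dim_col A = dim_row B \<Longrightarrow> A * (c \<cdot>\<^sub>m B) = c \<cdot>\<^sub>m (A * B)"
  by (rule mult_smult_distrib) auto

lemma one_mult_mat_dim:
  fixes A :: "'a::semiring_1 mat"
  shows "dim_row A = n \<Longrightarrow> 1\<^sub>m n * A = A" "dim_col A = n \<Longrightarrow> A * 1\<^sub>m n = A"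
  by auto

lemma zero_mult_mat_dim:
  fixes A :: "'a::semiring_0 mat"
  shows "dim_row A = n \<Longrightarrow> 0\<^sub>m k n * A = 0\<^sub>m k (dim_col A)"
    "dim_col A = n \<Longrightarrow> A * 0\<^sub>m n k = 0\<^sub>m (dim_row A) k"
  by auto

lemma zero_add_mat_dim:
  fixes A :: "'a::monoid_add mat"
  shows "dim_row A = n \<Longrightarrow> dim_col A = k \<Longrightarrow> 0\<^sub>m n k + A = A"
    "dim_row A = n \<Longrightarrow> dim_col A = k \<Longrightarrow> A + 0\<^sub>m n k = A"
  by auto

lemma transpose_mult_dim:
  fixes A :: "'a::comm_semiring_0 mat"
  shows "dim_col A = dim_row B \<Longrightarrow> (A * B)\<^sup>T = B\<^sup>T * A\<^sup>T"
  by (rule transpose_mult) auto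

lemma transpose_add_dim:
  "dim_row A = dim_row B \<Longrightarrow> dim_col A = dim_col B \<Longrightarrow> (A + B)\<^sup>T = A\<^sup>T + B\<^sup>T"
  by (rule transpose_add) auto

lemma transpose_smult: "(c \<cdot>\<^sub>m A)\<^sup>T = c \<cdot>\<^sub>m A\<^sup>T"
  by (intro eq_matI) auto

lemma uminus_zero_mat: "- 0\<^sub>m n k = (0\<^sub>m n k :: 'a::group_add mat)"
  by (intro eq_matI) auto

lemmas mat_dim_simps = assoc_mult_mat_dim add_mult_distrib_mat_dim mult_add_distrib_mat_dim
  minus_mult_distrib_mat_dim mult_minus_distrib_mat_dim smult_mult_mat_dim mult_smult_mat_dim
  one_mult_mat_dim zero_mult_mat_dim zero_add_mat_dim transpose_mult_dim transpose_add_dim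
  transpose_smult uminus_zero_mat

lemma index_mult_mat_sum:
  "i < dim_row A \<Longrightarrow> j < dim_col B \<Longrightarrow> dim_col A = dim_row B
    \<Longrightarrow> (A * B) $$ (i, j) = (\<Sum>k<dim_row B. A $$ (i, k) * B $$ (k, j))"
  by (simp add: scalar_prod_def atLeast0LessThan)

lemma symmetric_matD: "A\<^sup>T = A \<Longrightarrow> i < dim_row A \<Longrightarrow> j < dim_col A \<Longrightarrow> A $$ (j, i) = A $$ (i, j)"
  by (metis index_transpose_mat)

lemma left_inverse_cancel_mat:
  fixes A :: "'a::semiring_1 mat"
  assumes "A * B = 1\<^sub>m n" "dim_col A = dim_row B" "dim_col B = dim_row X" "dim_row X = n"
  shows "A * (B * X) = X"
  using assms by (simp add: one_mult_mat_dim flip: assoc_mult_mat_dim)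

lemma cplx_mult: "dim_col A = dim_row B \<Longrightarrow> cplx (A * B) = cplx A * cplx B"
  by (rule of_real_hom.mat_hom_mult[of _ "dim_row A" "dim_col A" _ "dim_col B"]) auto

lemma conj_mat_mult: "dim_col A = dim_row B \<Longrightarrow> conj_mat (A * B) = conj_mat A * conj_mat B"
  by (rule cnj_hom.mat_hom_mult[of _ "dim_row A" "dim_col A" _ "dim_col B"]) auto

lemma cplx_mult_eq_one:
  "A * B = 1\<^sub>m n \<Longrightarrow> dim_col A = dim_row B \<Longrightarrow> cplx A * cplx B = 1\<^sub>m n"
  by (simp add: of_real_hom.mat_hom_one flip: cplx_mult)

lemma cplx_transpose: "cplx (A\<^sup>T) = (cplx A)\<^sup>T"
  by (simp add: map_mat_transpose)

lemma conj_mat_cplx [simp]: "conj_mat (cplx A) = cplx A"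
  by (intro eq_matI) auto

lemma cplx_uminus: "cplx (- A) = - cplx A"
  by (intro eq_matI) auto

lemma cplx_eq_zero_iff: "cplx A = 0\<^sub>m n k \<longleftrightarrow> A = 0\<^sub>m n k"
  by (auto simp: mat_eq_iff)

lemma minv_eqI:
  assumes M: "M \<in> carrier_mat n n" and N: "N \<in> carrier_mat n n" and "M * N = 1\<^sub>m n"
  shows "minv M = N"
proof -
  have NM: "N * M = 1\<^sub>m n" using mat_mult_left_right_inverse[OF M N \<open>M * N = 1\<^sub>m n\<close>] .
  have "\<exists>N. N \<in> carrier_mat (dim_row M) (dim_row M)
      \<and> M * N = 1\<^sub>m (dim_row M) \<and> N * M = 1\<^sub>m (dim_row M)"
    using M N NM \<open>M * N = 1\<^sub>m n\<close> by auto
  from someI_ex[OF this, folded minv_def]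
  have minv: "dim_row (minv M) = n" "dim_col (minv M) = n" "M * minv M = 1\<^sub>m n" using M by auto
  have "minv M = N * (M * minv M)"
    by (rule left_inverse_cancel_mat[OF NM, symmetric]) (use M N minv in auto)
  then show ?thesis using minv(3) N by simp
qed

lemma minv_inverse:
  assumes M: "M \<in> carrier_mat n n" and N: "N \<in> carrier_mat n n" and "N * M = 1\<^sub>m n"
  shows "minv M \<in> carrier_mat n n" "M * minv M = 1\<^sub>m n" "minv M * M = 1\<^sub>m n"
proof -
  have "M * N = 1\<^sub>m n" using mat_mult_left_right_inverse[OF N M \<open>N * M = 1\<^sub>m n\<close>] .
  with minv_eqI[OF M N] assms
  show "minv M \<in> carrier_mat n n" "M * minv M = 1\<^sub>m n" "minv M * M = 1\<^sub>m n" by auto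
qed

lemma det_nonzero_minv:
  assumes "M \<in> carrier_mat n n" "det M \<noteq> 0"
  shows "minv M \<in> carrier_mat n n" "M * minv M = 1\<^sub>m n" "minv M * M = 1\<^sub>m n"
proof -
  obtain N where "N \<in> carrier_mat n n" "N * M = 1\<^sub>m n"
    using det_non_zero_imp_unit[OF assms, of "()"] unfolding Units_def ring_mat_def by auto
  from minv_inverse[OF assms(1) this]
  show "minv M \<in> carrier_mat n n" "M * minv M = 1\<^sub>m n" "minv M * M = 1\<^sub>m n" .
qed

lemma dim_append_rows [simp]:
  "dim_row (A @\<^sub>r B) = dim_row A + dim_row B" "dim_col (A @\<^sub>r B) = dim_col A"
  unfolding append_rows_def by auto

lemma index_append_rows:
  "i < dim_row A + dim_row B \<Longrightarrow> j < dim_col A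
    \<Longrightarrow> (A @\<^sub>r B) $$ (i, j) = (if i < dim_row A then A $$ (i, j) else B $$ (i - dim_row A, j))"
  unfolding append_rows_def by auto

lemma append_rows_inject:
  assumes "A @\<^sub>r B = A' @\<^sub>r B'" "A \<in> carrier_mat n c" "A' \<in> carrier_mat n c"
    "B \<in> carrier_mat p c" "B' \<in> carrier_mat p c"
  shows "A = A'" "B = B'"
proof -
  have entries: "(A @\<^sub>r B) $$ (i, j) = (A' @\<^sub>r B') $$ (i, j)" for i j using assms(1) by simp
  show "A = A'"
  proof (rule eq_matI)
    fix i j assume "i < dim_row A'" "j < dim_col A'"
    then show "A $$ (i, j) = A' $$ (i, j)"
      using entries[of i j] assms(2-5) by (simp add: index_append_rows)
  qed (use assms in auto)
  show "B = B'"
  proof (rule eq_matI)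
    fix i j assume "i < dim_row B'" "j < dim_col B'"
    then show "B $$ (i, j) = B' $$ (i, j)"
      using entries[of "n + i" j] assms(2-5) by (simp add: index_append_rows)
  qed (use assms in auto)
qed

lemma append_rows_mult:
  assumes "dim_col A = dim_row M" "dim_col B = dim_row M"
  shows "(A @\<^sub>r B) * M = (A * M) @\<^sub>r (B * M)"
  using assms
  by (intro eq_matI) (auto simp: index_mult_mat_sum index_append_rows simp del: index_mult_mat(1))

lemma sum_lessThan_add: "(\<Sum>k<m + n. f k) = (\<Sum>k<m. f k) + (\<Sum>k<n. f (m + k))" for m n :: nat
  by (induction n) (simp_all add: add.assoc)

lemma four_block_mult_append_rows:
  assumes "A \<in> carrier_mat n1 m1" "B \<in> carrier_mat n1 m2" "C \<in> carrier_mat n2 m1"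
    "D \<in> carrier_mat n2 m2" "U \<in> carrier_mat m1 c" "K \<in> carrier_mat m2 c"
  shows "four_block_mat A B C D * (U @\<^sub>r K) = (A * U + B * K) @\<^sub>r (C * U + D * K)"
  using assms
  by (intro eq_matI)
    (auto simp: index_mult_mat_sum index_append_rows sum_lessThan_add simp del: index_mult_mat(1))

lemma append_rows_transpose_mult:
  assumes "dim_row A = dim_row A'" "dim_row B = dim_row B'" "dim_col A = dim_col B"
    "dim_col A' = dim_col B'"
  shows "(A @\<^sub>r B)\<^sup>T * (A' @\<^sub>r B') = A\<^sup>T * A' + B\<^sup>T * B'"
  using assms
  by (intro eq_matI)
    (auto simp: index_mult_mat_sum index_append_rows sum_lessThan_add simp del: index_mult_mat(1))

subsection \<open>Positive definite forms\<close>

lemma pos_defD: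
  assumes "pos_def n P"
  shows "P \<in> carrier_mat n n" "P\<^sup>T = P"
    "x \<in> carrier_vec n \<Longrightarrow> x \<noteq> 0\<^sub>v n \<Longrightarrow> x \<bullet> (P *\<^sub>v x) > 0"
  using assms unfolding pos_def_def by auto

lemma pos_def_nonneg:
  assumes "pos_def n P" "x \<in> carrier_vec n"
  shows "x \<bullet> (P *\<^sub>v x) \<ge> 0"
  using pos_defD[OF assms(1)] assms(2) by (cases "x = 0\<^sub>v n") (auto intro: less_imp_le)

lemma pos_def_eq_zeroD:
  assumes "pos_def n P" "x \<in> carrier_vec n" "x \<bullet> (P *\<^sub>v x) = 0"
  shows "x = 0\<^sub>v n"
  using pos_defD(3)[OF assms(1,2)] assms(3) by fastforce

lemma pos_def_congruence:
  assumes P: "pos_def m P" and S: "S \<in> carrier_mat m n"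
    and L: "L \<in> carrier_mat n m" "L * S = 1\<^sub>m n"
  shows "pos_def n (S\<^sup>T * P * S)"
  unfolding pos_def_def
proof (intro conjI ballI impI)
  note Pc = pos_defD(1)[OF P]
  show "S\<^sup>T * P * S \<in> carrier_mat n n" using S Pc by auto
  show "(S\<^sup>T * P * S)\<^sup>T = S\<^sup>T * P * S"
    using S Pc pos_defD(2)[OF P] by (simp add: mat_dim_simps)
  fix x :: "real vec" assume x: "x \<in> carrier_vec n" "x \<noteq> 0\<^sub>v n"
  have Sx: "S *\<^sub>v x \<in> carrier_vec m" using S x by simp
  have "L *\<^sub>v (S *\<^sub>v x) = x" using assoc_mult_mat_vec[OF L(1) S x(1)] L(2) x(1) by simp
  moreover have "L *\<^sub>v 0\<^sub>v m = 0\<^sub>v n" using L(1) by (intro eq_vecI) auto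
  ultimately have "S *\<^sub>v x \<noteq> 0\<^sub>v m" using x(2) by metis
  then have "0 < (S *\<^sub>v x) \<bullet> (P *\<^sub>v (S *\<^sub>v x))" using pos_defD(3)[OF P Sx] by simp
  also have "\<dots> = (S\<^sup>T *\<^sub>v (P *\<^sub>v (S *\<^sub>v x))) \<bullet> x"
    using S Pc Sx x(1) by (simp add: transpose_vec_mult_scalar[of _ m n] comm_scalar_prod[of _ m])
  also have "\<dots> = x \<bullet> (S\<^sup>T * P * S *\<^sub>v x)"
    using S Pc x(1)
    by (simp add: assoc_mult_mat_vec[of _ n m _ n] assoc_mult_mat_vec[of _ n m _ m]
        assoc_mult_mat_vec[of _ m m _ n] comm_scalar_prod[of x n])
  finally show "0 < x \<bullet> (S\<^sup>T * P * S *\<^sub>v x)" .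
qed

lemma pos_def_minv:
  assumes P: "pos_def n P"
  shows "minv P \<in> carrier_mat n n" "P * minv P = 1\<^sub>m n" "minv P * P = 1\<^sub>m n" "pos_def n (minv P)"
proof -
  note Pc = pos_defD(1)[OF P]
  have "det P \<noteq> 0"
    using det_0_iff_vec_prod_zero[OF Pc] pos_def_eq_zeroD[OF P] by fastforce
  from det_nonzero_minv[OF Pc this]
  show inv: "minv P \<in> carrier_mat n n" "P * minv P = 1\<^sub>m n" "minv P * P = 1\<^sub>m n" .
  have sym: "(minv P)\<^sup>T = minv P"
  proof (rule minv_eqI[OF Pc, symmetric])
    have "(minv P * P)\<^sup>T = P * (minv P)\<^sup>T"
      using Pc inv(1) pos_defD(2)[OF P] by (simp add: mat_dim_simps)
    then show "P * (minv P)\<^sup>T = 1\<^sub>m n" unfolding inv(3) by simp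
  qed (use inv in auto)
  have "(minv P)\<^sup>T * P * minv P = minv P"
    unfolding sym inv(3) using inv(1) by simp
  with pos_def_congruence[OF P inv(1) Pc inv(2)] show "pos_def n (minv P)" by simp
qed

lemma pos_def_four_block_diag:
  assumes A: "pos_def n A" and D: "pos_def m D"
  shows "pos_def (n + m) (four_block_mat A (0\<^sub>m n m) (0\<^sub>m m n) D)" (is "pos_def _ ?F")
  unfolding pos_def_def
proof (intro conjI ballI impI)
  note Ac = pos_defD(1)[OF A] and Dc = pos_defD(1)[OF D]
  show "?F \<in> carrier_mat (n + m) (n + m)" using Ac Dc by auto
  show "?F\<^sup>T = ?F"
    using Ac Dc pos_defD(2)[OF A] pos_defD(2)[OF D]
    by (subst transpose_four_block_mat[of _ n n _ m _ m]) auto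
  fix x :: "real vec" assume x: "x \<in> carrier_vec (n + m)" "x \<noteq> 0\<^sub>v (n + m)"
  define a b where "a = vec_first x n" and "b = vec_last x m"
  have ab: "a \<in> carrier_vec n" "b \<in> carrier_vec m" and x_ab: "x = a @\<^sub>v b"
    unfolding a_def b_def using x(1) by (auto simp: vec_first_last_append)
  have "a \<noteq> 0\<^sub>v n \<or> b \<noteq> 0\<^sub>v m" using x(2) unfolding x_ab by auto
  moreover have "?F *\<^sub>v x = (A *\<^sub>v a) @\<^sub>v (D *\<^sub>v b)"
    unfolding x_ab using Ac Dc ab
    by (subst four_block_mat_mult_vec[OF Ac _ _ Dc ab]) (auto intro!: eq_vecI)
  then have "x \<bullet> (?F *\<^sub>v x) = a \<bullet> (A *\<^sub>v a) + b \<bullet> (D *\<^sub>v b)"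
    unfolding x_ab using Ac Dc ab by (simp add: scalar_prod_append[of _ n _ m])
  ultimately show "0 < x \<bullet> (?F *\<^sub>v x)"
    using pos_defD(3)[OF A ab(1)] pos_defD(3)[OF D ab(2)] pos_def_nonneg[OF A ab(1)]
      pos_def_nonneg[OF D ab(2)] by fastforce
qed

definition schur_complement :: "real mat \<Rightarrow> real mat \<Rightarrow> real mat \<Rightarrow> real mat" where
  "schur_complement A B D = D - B\<^sup>T * minv A * B"

lemma pos_def_four_blockD:
  assumes A: "A \<in> carrier_mat n n" and B: "B \<in> carrier_mat n m" and D: "D \<in> carrier_mat m m"
    and F: "pos_def (n + m) (four_block_mat A B B\<^sup>T D)" (is "pos_def _ ?F")
  shows "pos_def n A" "pos_def m (schur_complement A B D)"
proof -
  define E where "E = 1\<^sub>m n @\<^sub>r (0\<^sub>m m n :: real mat)"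
  have E: "E \<in> carrier_mat (n + m) n" "E\<^sup>T * E = 1\<^sub>m n"
    unfolding E_def by (auto simp: append_rows_transpose_mult mat_dim_simps)
  have "?F * E = A @\<^sub>r B\<^sup>T"
    using A B D unfolding E_def
    by (simp add: four_block_mult_append_rows[of _ n n _ m _ m _ _ n] mat_dim_simps)
  then have "E\<^sup>T * ?F * E = A"
    using A B D E(1) unfolding E_def
    by (simp add: assoc_mult_mat_dim append_rows_transpose_mult mat_dim_simps)
  then show A_pos: "pos_def n A" using pos_def_congruence[OF F E(1) _ E(2)] E(1) by simp
  note inv = pos_def_minv[OF A_pos]
  define G where "G = (- (minv A * B)) @\<^sub>r 1\<^sub>m m"
  have G: "G \<in> carrier_mat (n + m) m" unfolding G_def using inv(1) B by auto
  have "?F * G = 0\<^sub>m n m @\<^sub>r schur_complement A B D"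
  proof -
    have "A * (minv A * B) = B" by (rule left_inverse_cancel_mat[OF inv(2)]) (use A B inv in auto)
    then have "?F * G = (- B + B) @\<^sub>r (- (B\<^sup>T * (minv A * B)) + D)"
      unfolding G_def using A B D inv(1)
      by (subst four_block_mult_append_rows[of _ n n _ m _ m _ _ m]) auto
    also have "- (B\<^sup>T * (minv A * B)) + D = schur_complement A B D"
      unfolding schur_complement_def using A B D inv(1)
      by (intro eq_matI) (auto simp: mat_dim_simps simp del: index_mult_mat(1))
    finally show ?thesis using B by (simp add: uminus_l_inv_mat[of _ n m])
  qed
  then have "G\<^sup>T * ?F * G = schur_complement A B D"
    using A B D inv(1) G unfolding G_def
    by (simp add: assoc_mult_mat_dim append_rows_transpose_mult zero_mult_mat_dim zero_add_mat_dim
        schur_complement_def)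
  moreover have "(0\<^sub>m n m @\<^sub>r 1\<^sub>m m)\<^sup>T * G = 1\<^sub>m m"
    unfolding G_def using inv(1) B by (simp add: append_rows_transpose_mult mat_dim_simps)
  ultimately show "pos_def m (schur_complement A B D)"
    using pos_def_congruence[OF F G, of "(0\<^sub>m n m @\<^sub>r 1\<^sub>m m)\<^sup>T"] by simp
qed

lemma pos_def_four_blockI:
  assumes B: "B \<in> carrier_mat n m" and D: "D \<in> carrier_mat m m"
    and A: "pos_def n A" and S_pos: "pos_def m (schur_complement A B D)"
  shows "pos_def (n + m) (four_block_mat A B B\<^sup>T D)" (is "pos_def _ ?F")
proof -
  note Ac = pos_defD(1)[OF A] and inv = pos_def_minv[OF A]
  define X S where "X = minv A * B" and "S = schur_complement A B D"
  have X: "X \<in> carrier_mat n m" unfolding X_def using inv(1) B by simp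
  have S: "S \<in> carrier_mat m m" unfolding S_def by (rule pos_defD(1)[OF S_pos])
  have AX: "A * X = B" unfolding X_def
    by (rule left_inverse_cancel_mat[OF inv(2)]) (use Ac B inv in auto)
  have XA: "X\<^sup>T * A = B\<^sup>T"
    using arg_cong[OF AX, of transpose_mat] Ac X pos_defD(2)[OF A] by (simp add: mat_dim_simps)
  have XBS: "B\<^sup>T * X + S = D"
    unfolding S_def schur_complement_def X_def using B D inv(1)
    by (intro eq_matI) (auto simp: mat_dim_simps simp del: index_mult_mat(1))
  let ?M = "four_block_mat (1\<^sub>m n) X (0\<^sub>m m n) (1\<^sub>m m)"
  let ?L = "four_block_mat (1\<^sub>m n) (- X) (0\<^sub>m m n) (1\<^sub>m m)"
  let ?D = "four_block_mat A (0\<^sub>m n m) (0\<^sub>m m n) S"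
  have "?L * ?M = 1\<^sub>m (n + m)"
    using X by (subst mult_four_block_mat[of _ n n _ m _ m])
      (auto simp: mat_dim_simps intro!: eq_matI)
  then have "pos_def (n + m) (?M\<^sup>T * ?D * ?M)"
    using X pos_def_congruence[OF pos_def_four_block_diag[OF A S_pos[folded S_def]],
        of ?M "n + m" ?L]
    by simp
  also have "?M\<^sup>T = four_block_mat (1\<^sub>m n) (0\<^sub>m n m) X\<^sup>T (1\<^sub>m m)"
    using X by (subst transpose_four_block_mat[of _ n n _ m _ m]) auto
  also have "\<dots> * ?D = four_block_mat A (0\<^sub>m n m) B\<^sup>T S"
    using Ac X S B XA
    by (subst mult_four_block_mat[of _ n n _ m _ m _ _ n _ m]) (auto simp: mat_dim_simps)
  also have "\<dots> * ?M = ?F"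
    using Ac X S B AX XBS
    by (subst mult_four_block_mat[of _ n n _ m _ m _ _ n _ m])
      (auto simp: mat_dim_simps)
  finally show ?thesis .
qed

subsection \<open>Isometries of positive definite forms\<close>

definition unipotent_mat :: "'a::ring_1 mat \<Rightarrow> bool" where
  "unipotent_mat u \<longleftrightarrow> (\<exists>j. (u - 1\<^sub>m (dim_row u)) ^\<^sub>m j = 0\<^sub>m (dim_row u) (dim_row u))"

lemma pos_def_cscalar_prod:
  assumes P: "pos_def n P" and v: "v \<in> carrier_vec n" "v \<noteq> 0\<^sub>v n"
  shows "Re ((cplx P *\<^sub>v v) \<bullet>c v) > 0"
proof -
  note Pc = pos_defD(1)[OF P]
  define a b where "a = map_vec Re v" and "b = map_vec Im v"
  have ab: "a \<in> carrier_vec n" "b \<in> carrier_vec n" unfolding a_def b_def using v(1) by auto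
  have quad: "x \<bullet> (P *\<^sub>v x) = (\<Sum>i<n. (\<Sum>j<n. P $$ (i, j) * x $ j) * x $ i)"
    if "x \<in> carrier_vec n" for x
    using Pc that by (simp add: scalar_prod_def atLeast0LessThan mult.commute)
  have "(cplx P *\<^sub>v v) \<bullet>c v = (\<Sum>i<n. (\<Sum>j<n. of_real (P $$ (i, j)) * v $ j) * cnj (v $ i))"
    using Pc v(1) by (simp add: scalar_prod_def atLeast0LessThan)
  then have "Re ((cplx P *\<^sub>v v) \<bullet>c v) = a \<bullet> (P *\<^sub>v a) + b \<bullet> (P *\<^sub>v b)"
    unfolding quad[OF ab(1)] quad[OF ab(2)] unfolding a_def b_def
    using v(1) by (simp add: sum.distrib)
  moreover have "a \<noteq> 0\<^sub>v n \<or> b \<noteq> 0\<^sub>v n"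
    using v unfolding a_def b_def by (auto simp: vec_eq_iff complex_eq_iff)
  ultimately show ?thesis
    using pos_defD(3)[OF P ab(1)] pos_defD(3)[OF P ab(2)] pos_def_nonneg[OF P ab(1)]
      pos_def_nonneg[OF P ab(2)] by fastforce
qed

lemma isometry_eigenvalue_cmod:
  assumes P: "pos_def n P" and l: "l \<in> carrier_mat n n" "l\<^sup>T * P * l = P"
    and ev: "eigenvalue (cplx l) x"
  shows "cmod x = 1"
proof -
  note Pc = pos_defD(1)[OF P]
  obtain v where v: "v \<in> carrier_vec n" "v \<noteq> 0\<^sub>v n" "cplx l *\<^sub>v v = x \<cdot>\<^sub>v v"
    using ev l(1) unfolding eigenvalue_def eigenvector_def by auto
  have lc: "(cplx l)\<^sup>T \<in> carrier_mat n n" "cplx l \<in> carrier_mat n n" "cplx P \<in> carrier_mat n n"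
    using l(1) Pc by auto
  have "cplx l *\<^sub>v conjugate v = conjugate (cplx l *\<^sub>v v)"
    using l(1) v(1) by (intro eq_vecI) (auto simp: scalar_prod_def)
  then have conj: "cplx l *\<^sub>v conjugate v = cnj x \<cdot>\<^sub>v conjugate v"
    unfolding v(3) using v(1) by (intro eq_vecI) auto
  have "cplx P *\<^sub>v v = (cplx l)\<^sup>T *\<^sub>v (cplx P *\<^sub>v (cplx l *\<^sub>v v))"
  proof -
    have "cplx P = (cplx l)\<^sup>T * cplx P * cplx l"
      using arg_cong[OF l(2), of cplx] l(1) Pc by (simp add: cplx_mult cplx_transpose)
    then have "cplx P *\<^sub>v v = ((cplx l)\<^sup>T * cplx P * cplx l) *\<^sub>v v" by simp
    then show ?thesis using lc v(1) by (simp add: assoc_mult_mat_vec[of _ n n _ n])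
  qed
  then have "(cplx P *\<^sub>v v) \<bullet>c v = (cplx P *\<^sub>v (cplx l *\<^sub>v v)) \<bullet> (cplx l *\<^sub>v conjugate v)"
    using transpose_vec_mult_scalar[OF lc(2), of "conjugate v" "cplx P *\<^sub>v (cplx l *\<^sub>v v)"] lc v(1)
    by simp
  also have "\<dots> = (x * cnj x) * ((cplx P *\<^sub>v v) \<bullet>c v)"
    unfolding v(3) conj using lc(3) v(1) by (simp add: mult_mat_vec[of _ n n])
  also have "x * cnj x = of_real ((cmod x)\<^sup>2)" by (rule complex_norm_square[symmetric])
  finally have "(cplx P *\<^sub>v v) \<bullet>c v = of_real ((cmod x)\<^sup>2) * ((cplx P *\<^sub>v v) \<bullet>c v)" .
  from arg_cong[OF this, of Re]
  have "Re ((cplx P *\<^sub>v v) \<bullet>c v) = (cmod x)\<^sup>2 * Re ((cplx P *\<^sub>v v) \<bullet>c v)"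
    by (simp only: times_complex.sel Re_complex_of_real Im_complex_of_real mult_zero_left diff_zero)
  then show ?thesis using pos_def_cscalar_prod[OF P v(1,2)] norm_ge_zero[of x]
    by (simp add: power2_eq_1_iff)
qed

lemma isometry_preserves_form:
  fixes P :: "'a::comm_ring_1 mat"
  assumes P: "P \<in> carrier_mat n n" and l: "l \<in> carrier_mat n n" "l\<^sup>T * P * l = P"
    and xy: "x \<in> carrier_vec n" "y \<in> carrier_vec n"
  shows "(l *\<^sub>v x) \<bullet> (P *\<^sub>v (l *\<^sub>v y)) = x \<bullet> (P *\<^sub>v y)"
proof -
  have "x \<bullet> (P *\<^sub>v y) = x \<bullet> (l\<^sup>T *\<^sub>v (P *\<^sub>v (l *\<^sub>v y)))"
    using l(1) P xy by (subst l(2)[symmetric]) (simp add: assoc_mult_mat_vec[of _ n n _ n])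
  also have "\<dots> = (l *\<^sub>v x) \<bullet> (P *\<^sub>v (l *\<^sub>v y))"
    using transpose_vec_mult_scalar[OF l(1) xy(1), of "P *\<^sub>v (l *\<^sub>v y)"] l P xy
    by (simp add: comm_scalar_prod[of _ n])
  finally show ?thesis ..
qed

lemma nilpotent_mat_eq_zero:
  fixes N :: "'a::semiring_1 mat"
  assumes N: "N \<in> carrier_mat n n" and nilpotent: "N ^\<^sub>m k = 0\<^sub>m n n"
    and kernel: "\<And>x. x \<in> carrier_vec n \<Longrightarrow> N *\<^sub>v (N *\<^sub>v x) = 0\<^sub>v n \<Longrightarrow> N *\<^sub>v x = 0\<^sub>v n"
  shows "N = 0\<^sub>m n n"
proof -
  have "N *\<^sub>v x = 0\<^sub>v n" if "x \<in> carrier_vec n" "N ^\<^sub>m Suc k *\<^sub>v x = 0\<^sub>v n" for k x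
    using that
  proof (induction k arbitrary: x)
    case (Suc k)
    have "N ^\<^sub>m Suc k *\<^sub>v (N *\<^sub>v x) = 0\<^sub>v n"
      using Suc.prems assoc_mult_mat_vec[OF pow_carrier_mat[OF N, of "Suc k"] N] by simp
    then have "N *\<^sub>v (N *\<^sub>v x) = 0\<^sub>v n"
      by (rule Suc.IH[OF mult_mat_vec_carrier[OF N Suc.prems(1)]])
    then show ?case by (rule kernel[OF Suc.prems(1)])
  qed (use N in simp)
  moreover have "N ^\<^sub>m Suc k *\<^sub>v x = 0\<^sub>v n" if "x \<in> carrier_vec n" for x
    using N that nilpotent by (auto intro!: eq_vecI)
  ultimately have columns: "N *\<^sub>v unit_vec n j = 0\<^sub>v n" for j by (metis unit_vec_carrier)
  have "N $$ (i, j) = 0" if "i < n" "j < n" for i j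
    using arg_cong[OF columns[of j], of "\<lambda>v. v $ i"] that N by simp
  then show ?thesis using N by (intro eq_matI) auto
qed

lemma isometry_unipotent_eq_one:
  assumes P: "pos_def n P" and l: "l \<in> carrier_mat n n" "l\<^sup>T * P * l = P" and "unipotent_mat l"
  shows "l = 1\<^sub>m n"
proof -
  note Pc = pos_defD(1)[OF P]
  define N where "N = l - 1\<^sub>m n"
  have N: "N \<in> carrier_mat n n" unfolding N_def using l(1) by (simp add: minus_carrier_mat)
  have l_mult: "l *\<^sub>v x = x + N *\<^sub>v x" if "x \<in> carrier_vec n" for x
    unfolding N_def using l(1) that
    by (simp add: minus_mult_distrib_mat_vec[of _ n n]) (auto simp: vec_eq_iff)
  obtain j where nilpotent: "N ^\<^sub>m j = 0\<^sub>m n n"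
    using \<open>unipotent_mat l\<close> carrier_matD(1)[OF l(1)] unfolding unipotent_mat_def N_def by blast
  have "N = 0\<^sub>m n n"
  proof (rule nilpotent_mat_eq_zero[OF N nilpotent])
    fix x :: "real vec" assume x: "x \<in> carrier_vec n" and NN: "N *\<^sub>v (N *\<^sub>v x) = 0\<^sub>v n"
    let ?z = "N *\<^sub>v x"
    have z: "?z \<in> carrier_vec n" using N x by simp
    have "x \<bullet> (P *\<^sub>v ?z) = (x + ?z) \<bullet> (P *\<^sub>v ?z)"
      using isometry_preserves_form[OF Pc l x z] l_mult[OF x] l_mult[OF z] NN z by simp
    also have "\<dots> = x \<bullet> (P *\<^sub>v ?z) + ?z \<bullet> (P *\<^sub>v ?z)"
      using x z Pc by (simp add: add_scalar_prod_distrib[of _ n])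
    finally show "?z = 0\<^sub>v n" by (intro pos_def_eq_zeroD[OF P z]) simp
  qed
  then show ?thesis using l(1) unfolding N_def by (auto simp: mat_eq_iff)
qed

subsection \<open>The symplectic group\<close>

definition Tmat :: "nat \<Rightarrow> real mat" where
  "Tmat n = four_block_mat (1\<^sub>m n) (0\<^sub>m n n) (0\<^sub>m n n) (- 1\<^sub>m n)"

definition sp_adj :: "nat \<Rightarrow> real mat \<Rightarrow> real mat" where
  "sp_adj n X = - (Jmat n * X\<^sup>T * Jmat n)"

lemma dim_Jmat [simp]: "dim_row (Jmat n) = 2*n" "dim_col (Jmat n) = 2*n"
  unfolding Jmat_def by auto

lemma dim_Tmat [simp]: "dim_row (Tmat n) = 2*n" "dim_col (Tmat n) = 2*n"
  unfolding Tmat_def by auto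

lemma dim_sp_adj [simp]: "dim_row (sp_adj n X) = 2*n" "dim_col (sp_adj n X) = 2*n"
  unfolding sp_adj_def by auto

lemma Jmat_carrier [simp]: "Jmat n \<in> carrier_mat (2*n) (2*n)"
  by (rule carrier_matI) auto

lemma Tmat_carrier [simp]: "Tmat n \<in> carrier_mat (2*n) (2*n)"
  by (rule carrier_matI) auto

lemma sp_adj_carrier [simp]: "sp_adj n X \<in> carrier_mat (2*n) (2*n)"
  by (rule carrier_matI) auto

lemma index_Jmat:
  "i < 2*n \<Longrightarrow> j < 2*n
    \<Longrightarrow> Jmat n $$ (i, j) = (if j = i + n then 1 else if i = j + n then -1 else 0)"
  unfolding Jmat_def by auto

lemma index_Tmat:
  "i < 2*n \<Longrightarrow> j < 2*n \<Longrightarrow> Tmat n $$ (i, j) = (if i = j then (if i < n then 1 else -1) else 0)"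
  unfolding Tmat_def by auto

lemma Jmat_transpose [simp]: "(Jmat n)\<^sup>T = - Jmat n"
  by (intro eq_matI) (auto simp: index_Jmat)

lemma Tmat_transpose [simp]: "(Tmat n)\<^sup>T = Tmat n"
  by (intro eq_matI) (auto simp: index_Tmat)

lemma mult_four_block_mat_square:
  assumes "A \<in> carrier_mat n n" "B \<in> carrier_mat n n" "C \<in> carrier_mat n n" "D \<in> carrier_mat n n"
    "A' \<in> carrier_mat n n" "B' \<in> carrier_mat n n" "C' \<in> carrier_mat n n" "D' \<in> carrier_mat n n"
  shows "four_block_mat A B C D * four_block_mat A' B' C' D'
    = four_block_mat (A * A' + B * C') (A * B' + B * D') (C * A' + D * C') (C * B' + D * D')"
  using assms by (rule mult_four_block_mat)

lemma Jmat_Jmat: "Jmat n * Jmat n = - 1\<^sub>m (2*n)"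
  unfolding Jmat_def
  by (simp add: mult_four_block_mat_square[of _ n] mat_dim_simps) (intro eq_matI; auto)

lemma Tmat_Tmat: "Tmat n * Tmat n = 1\<^sub>m (2*n)"
  unfolding Tmat_def by (simp add: mult_four_block_mat_square[of _ n] mat_dim_simps mult_2)

lemma Tmat_Jmat: "Tmat n * Jmat n = - (Jmat n * Tmat n)"
  unfolding Tmat_def Jmat_def
  by (simp add: mult_four_block_mat_square[of _ n] mat_dim_simps) (intro eq_matI; auto)

lemma sp_adj_mult:
  assumes "dim_row X = 2*n" "dim_col X = 2*n" "dim_row Y = 2*n" "dim_col Y = 2*n"
  shows "sp_adj n (X * Y) = sp_adj n Y * sp_adj n X"
proof -
  have "Jmat n * (Jmat n * Z) = - Z" if "dim_row Z = 2*n" for Z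
  proof -
    have "Jmat n * (Jmat n * Z) = - 1\<^sub>m (2*n) * Z"
      using that by (simp flip: Jmat_Jmat assoc_mult_mat_dim)
    then show ?thesis using that by (simp add: one_mult_mat_dim)
  qed
  then show ?thesis unfolding sp_adj_def using assms by (simp add: mat_dim_simps)
qed

lemma sp_adj_add:
  "dim_row X = 2*n \<Longrightarrow> dim_col X = 2*n \<Longrightarrow> dim_row Y = 2*n \<Longrightarrow> dim_col Y = 2*n
    \<Longrightarrow> sp_adj n (X + Y) = sp_adj n X + sp_adj n Y"
  unfolding sp_adj_def
  by (simp add: mat_dim_simps) (intro eq_matI; simp del: index_mult_mat(1))

lemma sp_adj_smult:
  "dim_row X = 2*n \<Longrightarrow> dim_col X = 2*n \<Longrightarrow> sp_adj n (c \<cdot>\<^sub>m X) = c \<cdot>\<^sub>m sp_adj n X"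
  unfolding sp_adj_def
  by (simp add: mat_dim_simps) (intro eq_matI; simp del: index_mult_mat(1))

lemma sp_adj_one: "sp_adj n (1\<^sub>m (2*n)) = 1\<^sub>m (2*n)"
  unfolding sp_adj_def by (simp add: one_mult_mat_dim Jmat_Jmat)

lemma sp_adj_sp_adj: "dim_row X = 2*n \<Longrightarrow> dim_col X = 2*n \<Longrightarrow> sp_adj n (sp_adj n X) = X"
proof -
  assume X: "dim_row X = 2*n" "dim_col X = 2*n"
  have "sp_adj n (sp_adj n X) = (Jmat n * Jmat n) * (X * (Jmat n * Jmat n))"
    unfolding sp_adj_def using X by (simp add: mat_dim_simps transpose_uminus)
  then show ?thesis unfolding Jmat_Jmat using X by (simp add: one_mult_mat_dim)
qed

lemma sp_adj_Tmat: "sp_adj n (Tmat n) = - Tmat n"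
proof -
  have "sp_adj n (Tmat n) = (Tmat n * Jmat n) * Jmat n"
    unfolding sp_adj_def Tmat_Jmat by simp
  also have "\<dots> = Tmat n * (Jmat n * Jmat n)" by (rule assoc_mult_mat_dim) auto
  finally show ?thesis unfolding Jmat_Jmat by (simp add: one_mult_mat_dim)
qed

lemma is_SpD:
  assumes "is_Sp n g"
  shows "g \<in> carrier_mat (2*n) (2*n)" "dim_row g = 2*n" "dim_col g = 2*n"
    "g\<^sup>T * Jmat n * g = Jmat n"
  using assms unfolding is_Sp_def by auto

lemma is_Sp_iff_sp_adj:
  "is_Sp n g \<longleftrightarrow> g \<in> carrier_mat (2*n) (2*n) \<and> sp_adj n g * g = 1\<^sub>m (2*n)"
proof (cases "g \<in> carrier_mat (2*n) (2*n)")
  case True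
  then have g: "dim_row g = 2*n" "dim_col g = 2*n" by auto
  have adj: "sp_adj n g * g = - (Jmat n * (g\<^sup>T * Jmat n * g))"
    unfolding sp_adj_def using g by (simp add: mat_dim_simps)
  have "Jmat n * (sp_adj n g * g) = - (Jmat n * Jmat n) * (g\<^sup>T * Jmat n * g)"
    unfolding adj using g by (simp add: mat_dim_simps)
  then have "Jmat n * (sp_adj n g * g) = g\<^sup>T * Jmat n * g"
    unfolding Jmat_Jmat using g by (simp add: one_mult_mat_dim)
  moreover have "sp_adj n g * g = 1\<^sub>m (2*n)" if "g\<^sup>T * Jmat n * g = Jmat n"
    unfolding adj that by (simp add: Jmat_Jmat)
  ultimately show ?thesis unfolding is_Sp_def using True by (auto simp: one_mult_mat_dim)
qed (auto simp: is_Sp_def)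

lemma is_Sp_sp_adj_mult:
  assumes "is_Sp n g"
  shows "sp_adj n g * g = 1\<^sub>m (2*n)" "g * sp_adj n g = 1\<^sub>m (2*n)"
proof -
  show "sp_adj n g * g = 1\<^sub>m (2*n)" using assms unfolding is_Sp_iff_sp_adj by simp
  then show "g * sp_adj n g = 1\<^sub>m (2*n)"
    by (rule mat_mult_left_right_inverse[rotated 2]) (use is_SpD[OF assms] in auto)
qed

lemma is_Sp_sp_adj_cancel:
  assumes "is_Sp n g" "dim_row X = 2*n"
  shows "sp_adj n g * (g * X) = X" "g * (sp_adj n g * X) = X"
  using is_SpD[OF assms(1)] assms(2)
  by (auto intro!: left_inverse_cancel_mat is_Sp_sp_adj_mult[OF assms(1)])

lemma is_Sp_cplx_sp_adj_cancel:
  assumes "is_Sp n g" "dim_row F = 2*n"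
  shows "cplx (sp_adj n g) * (cplx g * F) = F"
  by (rule left_inverse_cancel_mat[OF cplx_mult_eq_one[OF is_Sp_sp_adj_mult(1)[OF assms(1)]]])
    (use is_SpD[OF assms(1)] assms(2) in auto)

lemma minv_eq_sp_adj: "is_Sp n g \<Longrightarrow> minv g = sp_adj n g"
  by (rule minv_eqI[of _ "2*n"]) (auto simp: is_SpD(1) is_Sp_sp_adj_mult)

lemma is_Sp_mult:
  assumes "is_Sp n g" "is_Sp n h"
  shows "is_Sp n (g * h)"
  using is_SpD[OF assms(1)] is_SpD[OF assms(2)] unfolding is_Sp_iff_sp_adj
  by (simp add: sp_adj_mult assoc_mult_mat_dim is_Sp_sp_adj_cancel[OF assms(1)]
      is_Sp_sp_adj_mult[OF assms(2)])

lemma is_Sp_sp_adj: "is_Sp n g \<Longrightarrow> is_Sp n (sp_adj n g)"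
  using is_SpD[of n g] is_Sp_sp_adj_mult(2)[of n g] unfolding is_Sp_iff_sp_adj
  by (auto simp: sp_adj_sp_adj)

lemma block_decomp:
  "g \<in> carrier_mat (2*n) (2*n) \<Longrightarrow> g = four_block_mat (blkA n g) (blkB n g) (blkC n g) (blkD n g)"
  unfolding blkA_def blkB_def blkC_def blkD_def by (intro eq_matI) auto

lemma blk_carrier [simp]: "blkA n g \<in> carrier_mat n n" "blkB n g \<in> carrier_mat n n"
  "blkC n g \<in> carrier_mat n n" "blkD n g \<in> carrier_mat n n"
  unfolding blkA_def blkB_def blkC_def blkD_def by auto

lemma dim_blk [simp]: "dim_row (blkA n g) = n" "dim_row (blkB n g) = n" "dim_row (blkC n g) = n"
  "dim_row (blkD n g) = n" "dim_col (blkA n g) = n" "dim_col (blkB n g) = n"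
  "dim_col (blkC n g) = n" "dim_col (blkD n g) = n"
  unfolding blkA_def blkB_def blkC_def blkD_def by auto

lemma dim_tau_g [simp]: "dim_row (tau_g n g) = 2*n" "dim_col (tau_g n g) = 2*n"
  unfolding tau_g_def by auto

lemma tau_g_carrier [simp]: "tau_g n g \<in> carrier_mat (2*n) (2*n)"
  by (rule carrier_matI) auto

lemma tau_g_eq_Tmat:
  assumes "g \<in> carrier_mat (2*n) (2*n)"
  shows "tau_g n g = Tmat n * g * Tmat n"
proof -
  have "Tmat n * g * Tmat n
    = Tmat n * four_block_mat (blkA n g) (blkB n g) (blkC n g) (blkD n g) * Tmat n"
    using block_decomp[OF assms] by simp
  then show ?thesis
    unfolding tau_g_def Tmat_def by (simp add: mult_four_block_mat_square[of _ n] mat_dim_simps)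
qed

lemma Tmat_cancel: "dim_row X = 2*n \<Longrightarrow> Tmat n * (Tmat n * X) = X"
  by (rule left_inverse_cancel_mat[OF Tmat_Tmat]) auto

lemma tau_g_mult:
  assumes "g \<in> carrier_mat (2*n) (2*n)" "h \<in> carrier_mat (2*n) (2*n)"
  shows "tau_g n (g * h) = tau_g n g * tau_g n h"
  using assms by (simp add: tau_g_eq_Tmat mat_dim_simps Tmat_cancel)

lemma tau_g_one: "tau_g n (1\<^sub>m (2*n)) = 1\<^sub>m (2*n)"
  by (simp add: tau_g_eq_Tmat one_mult_mat_dim Tmat_Tmat)

lemma tau_g_tau_g: "g \<in> carrier_mat (2*n) (2*n) \<Longrightarrow> tau_g n (tau_g n g) = g"
  by (subst tau_g_eq_Tmat[OF tau_g_carrier])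
    (simp add: tau_g_eq_Tmat mat_dim_simps Tmat_cancel Tmat_Tmat)

lemma sp_adj_tau_g:
  assumes "g \<in> carrier_mat (2*n) (2*n)"
  shows "sp_adj n (tau_g n g) = tau_g n (sp_adj n g)"
  using assms
  by (simp add: tau_g_eq_Tmat[OF assms] tau_g_eq_Tmat[of "sp_adj n g"] sp_adj_mult sp_adj_Tmat
      assoc_mult_mat_dim)

lemma is_Sp_tau_g:
  assumes "is_Sp n g"
  shows "is_Sp n (tau_g n g)"
proof -
  have "sp_adj n (tau_g n g) * tau_g n g = tau_g n (sp_adj n g * g)"
    using is_SpD(1)[OF assms] by (simp add: sp_adj_tau_g tau_g_mult)
  then show ?thesis
    unfolding is_Sp_iff_sp_adj is_Sp_sp_adj_mult(1)[OF assms] tau_g_one by simp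
qed

subsection \<open>The action on the Siegel upper half space\<close>

definition frame :: "complex mat \<Rightarrow> complex mat" where
  "frame Z = Z @\<^sub>r 1\<^sub>m (dim_col Z)"

definition automorphy :: "nat \<Rightarrow> real mat \<Rightarrow> complex mat \<Rightarrow> complex mat" where
  "automorphy n g Z = blkC n (cplx g) * Z + blkD n (cplx g)"

definition sp_numerator :: "nat \<Rightarrow> real mat \<Rightarrow> complex mat \<Rightarrow> complex mat" where
  "sp_numerator n g Z = blkA n (cplx g) * Z + blkB n (cplx g)"

text \<open>The complex structure \<open>J\<^sup>-\<^sup>1P\<close> has the frame of \<open>Z\<close> as its eigenspace for the eigenvalue \<open>\<i>\<close>.\<close>

definition siegel_metric :: "nat \<Rightarrow> real mat \<Rightarrow> complex mat \<Rightarrow> bool" where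
  "siegel_metric n P Z \<longleftrightarrow> pos_def (2*n) P \<and> Z \<in> carrier_mat n n
    \<and> cplx P * frame Z = \<i> \<cdot>\<^sub>m (cplx (Jmat n) * frame Z)"

lemma siegelD:
  assumes "siegel n Z"
  shows "Z \<in> carrier_mat n n" "dim_row Z = n" "dim_col Z = n" "Z\<^sup>T = Z" "pos_def n (map_mat Im Z)"
  using assms unfolding siegel_def by auto

lemma frame_carrier: "Z \<in> carrier_mat n n \<Longrightarrow> frame Z \<in> carrier_mat (2*n) n"
  unfolding frame_def by (auto simp: mult_2)

lemma dim_frame [simp]: "dim_row (frame Z) = dim_row Z + dim_col Z" "dim_col (frame Z) = dim_col Z"
  unfolding frame_def by auto

lemma dim_automorphy [simp]: "dim_row (automorphy n g Z) = n" "dim_col (automorphy n g Z) = n"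
  unfolding automorphy_def by auto

lemma automorphy_carrier [simp]: "automorphy n g Z \<in> carrier_mat n n"
  by (rule carrier_matI) auto

lemma dim_sp_numerator [simp]: "dim_row (sp_numerator n g Z) = n" "dim_col (sp_numerator n g Z) = n"
  unfolding sp_numerator_def by auto

lemma sp_numerator_carrier [simp]: "sp_numerator n g Z \<in> carrier_mat n n"
  by (rule carrier_matI) auto

lemma frame_mult: "dim_col Z = dim_row K \<Longrightarrow> frame Z * K = (Z * K) @\<^sub>r K"
  unfolding frame_def by (simp add: append_rows_mult one_mult_mat_dim)

lemma frame_left_inverse:
  assumes "Z \<in> carrier_mat n n"
  shows "(0\<^sub>m n n @\<^sub>r 1\<^sub>m n)\<^sup>T * frame Z = 1\<^sub>m n"
  using assms unfolding frame_def by (simp add: append_rows_transpose_mult mat_dim_simps)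

lemma frame_mult_inject:
  assumes "frame V * K = frame V' * K'" "V \<in> carrier_mat n n" "V' \<in> carrier_mat n n"
    "K \<in> carrier_mat n k" "K' \<in> carrier_mat n k"
  shows "V * K = V' * K'" "K = K'"
  using append_rows_inject[of "V * K" K "V' * K'" K' n k n] assms by (auto simp: frame_mult)

lemma cplx_mult_frame:
  assumes "g \<in> carrier_mat (2*n) (2*n)" "Z \<in> carrier_mat n n"
  shows "cplx g * frame Z = sp_numerator n g Z @\<^sub>r automorphy n g Z"
proof -
  have "cplx g * frame Z = four_block_mat (blkA n (cplx g)) (blkB n (cplx g))
      (blkC n (cplx g)) (blkD n (cplx g)) * (Z @\<^sub>r 1\<^sub>m n)"
    using block_decomp[of "cplx g" n] assms unfolding frame_def by simp
  then show ?thesis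
    using assms unfolding sp_numerator_def automorphy_def
    by (simp add: four_block_mult_append_rows[of _ n n _ n _ n _ _ n] one_mult_mat_dim)
qed

lemma cplx_Jmat_mult_append_rows:
  assumes "U \<in> carrier_mat n k" "K \<in> carrier_mat n k"
  shows "cplx (Jmat n) * (U @\<^sub>r K) = K @\<^sub>r - U"
proof -
  have "cplx (Jmat n) = four_block_mat (0\<^sub>m n n) (1\<^sub>m n) (- 1\<^sub>m n) (0\<^sub>m n n)"
    unfolding Jmat_def by (intro eq_matI) auto
  then show ?thesis
    using assms by (simp add: four_block_mult_append_rows[of _ n n _ n _ n _ _ k] mat_dim_simps)
qed

lemma complex_mat_decomp: "Z = cplx (map_mat Re Z) + \<i> \<cdot>\<^sub>m cplx (map_mat Im Z)"
  by (intro eq_matI) (auto simp: complex_eq_iff)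

definition metric_of :: "complex mat \<Rightarrow> real mat" where
  "metric_of Z = (let X = map_mat Re Z; Y = map_mat Im Z
    in four_block_mat (minv Y) (- (minv Y * X)) (- (X * minv Y)) (Y + X * (minv Y * X)))"

lemma pos_def_metric_of:
  assumes "siegel n Z"
  shows "pos_def (2*n) (metric_of Z)"
proof -
  note Z = siegelD[OF assms]
  define X Y where "X = map_mat Re Z" and "Y = map_mat Im Z"
  have X [simp]: "dim_row X = n" "dim_col X = n" "X\<^sup>T = X"
    unfolding X_def using Z by (simp_all add: map_mat_transpose)
  have Y: "pos_def n Y" unfolding Y_def by (rule Z(5))
  note Yc = pos_defD(1)[OF Y] and inv = pos_def_minv[OF Y]
  have [simp]: "dim_row Y = n" "dim_col Y = n" "dim_row (minv Y) = n" "dim_col (minv Y) = n"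
    "(minv Y)\<^sup>T = minv Y" using Yc inv(1) pos_defD(2)[OF inv(4)] by auto
  let ?B = "- (minv Y * X)" and ?D = "Y + X * (minv Y * X)"
  have BT: "?B\<^sup>T = - (X * minv Y)" by (simp add: transpose_uminus transpose_mult_dim)
  have "?B\<^sup>T * minv (minv Y) * ?B = X * (minv Y * X)"
    unfolding BT minv_eqI[OF inv(1) Yc inv(3)]
    by (simp add: assoc_mult_mat_dim left_inverse_cancel_mat[OF inv(3)]
        left_inverse_cancel_mat[OF inv(2)])
  then have "schur_complement (minv Y) ?B ?D = Y"
    unfolding schur_complement_def by (intro eq_matI) auto
  then have "pos_def (n + n) (four_block_mat (minv Y) ?B ?B\<^sup>T ?D)"
    using pos_def_four_blockI[of ?B n n ?D "minv Y"] Y inv(4) by (simp add: carrier_matI)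
  then show ?thesis unfolding metric_of_def Let_def X_def[symmetric] Y_def[symmetric] BT
    by (simp add: mult_2)
qed

lemma metric_of_mult_frame:
  assumes "siegel n Z"
  shows "cplx (metric_of Z) * frame Z = \<i> \<cdot>\<^sub>m (cplx (Jmat n) * frame Z)"
proof -
  note Z = siegelD[OF assms]
  define X Y where "X = map_mat Re Z" and "Y = map_mat Im Z"
  have Y: "pos_def n Y" unfolding Y_def by (rule Z(5))
  note inv = pos_def_minv[OF Y]
  have [simp]: "dim_row X = n" "dim_col X = n" "dim_row Y = n" "dim_col Y = n"
    "dim_row (minv Y) = n" "dim_col (minv Y) = n"
    using Z carrier_matD[OF inv(1)] unfolding X_def Y_def by auto
  have cplx_minv: "cplx (minv Y) * cplx Y = 1\<^sub>m n" by (rule cplx_mult_eq_one[OF inv(3)]) simp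
  have Z_eq: "Z = cplx X + \<i> \<cdot>\<^sub>m cplx Y" unfolding X_def Y_def by (rule complex_mat_decomp)
  let ?A = "cplx (minv Y)" and ?B = "cplx (- (minv Y * X))" and ?C = "cplx (- (X * minv Y))"
    and ?D = "cplx (Y + X * (minv Y * X))"
  have "?A * Z + ?B = \<i> \<cdot>\<^sub>m 1\<^sub>m n"
    by (subst Z_eq, simp add: mat_dim_simps cplx_minv cplx_mult cplx_uminus)
      (intro eq_matI; simp del: index_mult_mat(1))
  moreover have "?C * Z + ?D = \<i> \<cdot>\<^sub>m - Z"
  proof -
    have "?C * Z = - (cplx X * (?A * cplx X)) + \<i> \<cdot>\<^sub>m - cplx X"
      by (subst Z_eq) (simp add: mat_dim_simps cplx_minv cplx_mult cplx_uminus)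
    moreover have "?D = cplx Y + cplx X * (?A * cplx X)"
      by (simp flip: cplx_mult) (intro eq_matI; simp del: index_mult_mat(1))
    ultimately show ?thesis
      using Z_eq by (intro eq_matI) (auto simp: algebra_simps simp del: index_mult_mat(1))
  qed
  moreover have "cplx (metric_of Z) = four_block_mat ?A ?B ?C ?D"
    unfolding metric_of_def Let_def X_def[symmetric] Y_def[symmetric]
    by (rule map_four_block_mat) (auto intro: carrier_matI)
  moreover have
    "four_block_mat ?A ?B ?C ?D * (Z @\<^sub>r 1\<^sub>m n) = (?A * Z + ?B * 1\<^sub>m n) @\<^sub>r (?C * Z + ?D * 1\<^sub>m n)"
    by (rule four_block_mult_append_rows) (use Z in \<open>auto intro: carrier_matI\<close>)
  ultimately have "cplx (metric_of Z) * frame Z = (\<i> \<cdot>\<^sub>m 1\<^sub>m n) @\<^sub>r (\<i> \<cdot>\<^sub>m - Z)"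
    unfolding frame_def Z(3) by (simp add: one_mult_mat_dim)
  also have "\<dots> = \<i> \<cdot>\<^sub>m (cplx (Jmat n) * frame Z)"
    unfolding frame_def using Z
    by (simp add: cplx_Jmat_mult_append_rows[of _ n n])
      (auto simp: index_append_rows intro!: eq_matI)
  finally show ?thesis .
qed

lemma siegel_metric_metric_of: "siegel n Z \<Longrightarrow> siegel_metric n (metric_of Z) Z"
  unfolding siegel_metric_def using pos_def_metric_of metric_of_mult_frame siegelD(1) by blast

lemma pos_def_blkA:
  assumes "pos_def (2*n) P"
  shows "pos_def n (blkA n P)"
proof -
  note P = pos_defD[OF assms]
  have "blkC n P = (blkB n P)\<^sup>T"
    unfolding blkB_def blkC_def using P(1) symmetric_matD[OF P(2)] by (intro eq_matI) auto
  then have "pos_def (n + n) (four_block_mat (blkA n P) (blkB n P) (blkB n P)\<^sup>T (blkD n P))"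
    using assms block_decomp[OF P(1)] by (simp add: mult_2)
  then show ?thesis by (rule pos_def_four_blockD(1)[rotated 3]) auto
qed

lemma metric_mult_append_rows_top:
  assumes P: "P \<in> carrier_mat (2*n) (2*n)" and UK: "U \<in> carrier_mat n k" "K \<in> carrier_mat n k"
    and eq: "cplx P * (U @\<^sub>r K) = \<i> \<cdot>\<^sub>m (cplx (Jmat n) * (U @\<^sub>r K))"
  shows "cplx (blkA n P) * U + cplx (blkB n P) * K = \<i> \<cdot>\<^sub>m K"
proof -
  have "cplx P = cplx (four_block_mat (blkA n P) (blkB n P) (blkC n P) (blkD n P))"
    using block_decomp[OF P] by simp
  also have "\<dots>
    = four_block_mat (cplx (blkA n P)) (cplx (blkB n P)) (cplx (blkC n P)) (cplx (blkD n P))"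
    by (rule map_four_block_mat) auto
  finally have "cplx P * (U @\<^sub>r K) = (cplx (blkA n P) * U + cplx (blkB n P) * K)
      @\<^sub>r (cplx (blkC n P) * U + cplx (blkD n P) * K)"
    using UK by (simp add: four_block_mult_append_rows[of _ n n _ n _ n _ _ k])
  moreover have "\<i> \<cdot>\<^sub>m (cplx (Jmat n) * (U @\<^sub>r K)) = (\<i> \<cdot>\<^sub>m K) @\<^sub>r (\<i> \<cdot>\<^sub>m - U)"
    using UK by (simp add: cplx_Jmat_mult_append_rows[of _ n k])
      (auto simp: index_append_rows intro!: eq_matI)
  ultimately have "(cplx (blkA n P) * U + cplx (blkB n P) * K)
      @\<^sub>r (cplx (blkC n P) * U + cplx (blkD n P) * K) = (\<i> \<cdot>\<^sub>m K) @\<^sub>r (\<i> \<cdot>\<^sub>m - U)"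
    using eq by simp
  then show ?thesis by (rule append_rows_inject(1)[of _ _ _ _ n k n]) (use UK in auto)
qed

lemma siegel_if_metric:
  assumes "siegel_metric n P Z"
  shows "siegel n Z"
proof -
  have P: "pos_def (2*n) P" and Z: "Z \<in> carrier_mat n n"
    and PZ: "cplx P * frame Z = \<i> \<cdot>\<^sub>m (cplx (Jmat n) * frame Z)"
    using assms unfolding siegel_metric_def by auto
  have [simp]: "dim_row Z = n" "dim_col Z = n" "dim_row P = 2*n" "dim_col P = 2*n" "P\<^sup>T = P"
    using Z pos_defD[OF P] by auto
  define S where "S = (frame Z)\<^sup>T * (cplx (Jmat n) * frame Z)"
  have S_eq: "S = Z\<^sup>T - Z"
  proof -
    have "S = (Z @\<^sub>r 1\<^sub>m n)\<^sup>T * (1\<^sub>m n @\<^sub>r - Z)"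
      unfolding S_def frame_def by (simp add: cplx_Jmat_mult_append_rows[of _ n n] Z)
    then show ?thesis
      by (simp add: append_rows_transpose_mult one_mult_mat_dim) (intro eq_matI; simp)
  qed
  have "(frame Z)\<^sup>T * (cplx P * frame Z) = \<i> \<cdot>\<^sub>m S"
    unfolding PZ S_def by (simp add: mult_smult_mat_dim)
  moreover have "((frame Z)\<^sup>T * (cplx P * frame Z))\<^sup>T = (frame Z)\<^sup>T * (cplx P * frame Z)"
    by (simp add: mat_dim_simps flip: cplx_transpose)
  ultimately have "(\<i> \<cdot>\<^sub>m S)\<^sup>T = \<i> \<cdot>\<^sub>m S" by simp
  then have sym: "Z\<^sup>T = Z"
    unfolding S_eq by (auto simp: mat_eq_iff)
  note A = pos_def_blkA[OF P]
  have "cplx (blkA n P) * Z + cplx (blkB n P) * 1\<^sub>m n = \<i> \<cdot>\<^sub>m 1\<^sub>m n"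
    using PZ metric_mult_append_rows_top[of P n Z n "1\<^sub>m n"] pos_defD(1)[OF P] Z
    unfolding frame_def by simp
  then have "map_mat Im (cplx (blkA n P) * Z + cplx (blkB n P)) = 1\<^sub>m n"
    by (simp add: one_mult_mat_dim) (intro eq_matI; simp)
  moreover have "map_mat Im (cplx (blkA n P) * Z + cplx (blkB n P)) = blkA n P * map_mat Im Z"
    by (intro eq_matI) (auto simp: scalar_prod_def)
  ultimately have "minv (blkA n P) = map_mat Im Z"
    using Z by (intro minv_eqI[of _ n]) auto
  with pos_def_minv(4)[OF A] have "pos_def n (map_mat Im Z)" by simp
  then show ?thesis unfolding siegel_def using sym Z by simp
qed

lemma siegel_frame_factorization:
  assumes P: "pos_def (2*n) P" and F: "F \<in> carrier_mat (2*n) n"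
    and L: "L \<in> carrier_mat n (2*n)" "L * F = 1\<^sub>m n"
    and PF: "cplx P * F = \<i> \<cdot>\<^sub>m (cplx (Jmat n) * F)"
  obtains V K where "siegel_metric n P V" "K \<in> carrier_mat n n" "minv K \<in> carrier_mat n n"
    "K * minv K = 1\<^sub>m n" "F = frame V * K"
proof -
  note Pc = pos_defD(1)[OF P] and inv = pos_def_minv[OF pos_def_blkA[OF P]]
  define U K where "U = mat n n (\<lambda>(i,j). F $$ (i, j))" and "K = mat n n (\<lambda>(i,j). F $$ (i + n, j))"
  have UK: "U \<in> carrier_mat n n" "K \<in> carrier_mat n n" unfolding U_def K_def by auto
  have F_eq: "F = U @\<^sub>r K"
    using F unfolding U_def K_def by (intro eq_matI) (auto simp: index_append_rows)
  define V where "V = cplx (minv (blkA n P)) * (\<i> \<cdot>\<^sub>m 1\<^sub>m n - cplx (blkB n P))"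
  have V: "V \<in> carrier_mat n n" unfolding V_def using inv(1) by (auto intro: carrier_matI)
  have [simp]: "dim_row F = 2*n" "dim_col F = n" "dim_row U = n" "dim_col U = n"
    "dim_row K = n" "dim_col K = n" "dim_row V = n" "dim_col V = n" "dim_row L = n"
    "dim_col L = 2*n" "dim_row P = 2*n" "dim_col P = 2*n" "dim_row (minv (blkA n P)) = n"
    "dim_col (minv (blkA n P)) = n"
    using F UK V L Pc inv(1) by auto
  have AU: "cplx (blkA n P) * U + cplx (blkB n P) * K = \<i> \<cdot>\<^sub>m K"
    by (rule metric_mult_append_rows_top[OF Pc UK PF[unfolded F_eq]])
  have "U = cplx (minv (blkA n P)) * (cplx (blkA n P) * U)"
    by (rule left_inverse_cancel_mat[OF cplx_mult_eq_one[OF inv(3)], symmetric]) auto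
  also have "cplx (blkA n P) * U = (\<i> \<cdot>\<^sub>m 1\<^sub>m n - cplx (blkB n P)) * K"
  proof -
    have "cplx (blkA n P) * U = \<i> \<cdot>\<^sub>m K - cplx (blkB n P) * K"
      unfolding AU[symmetric] by (intro eq_matI) (auto simp del: index_mult_mat(1))
    then show ?thesis by (simp add: mat_dim_simps)
  qed
  finally have "U = V * K" unfolding V_def by (simp add: assoc_mult_mat_dim)
  then have F_VK: "F = frame V * K" unfolding F_eq by (simp add: frame_mult)
  have "(L * frame V) * K = 1\<^sub>m n" using L(2) unfolding F_VK by (simp add: assoc_mult_mat_dim)
  note K = minv_inverse(1,2)[OF UK(2) mult_carrier_mat[OF L(1) frame_carrier[OF V]] this]
  from arg_cong[OF PF[unfolded F_VK], of "\<lambda>X. X * minv K"]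
  have "cplx P * frame V = \<i> \<cdot>\<^sub>m (cplx (Jmat n) * frame V)"
    using carrier_matD[OF K(1)] by (simp add: K(2) mat_dim_simps)
  then have "siegel_metric n P V" unfolding siegel_metric_def using P V by simp
  then show ?thesis by (rule that[OF _ UK(2) K F_VK])
qed

definition push_metric :: "nat \<Rightarrow> real mat \<Rightarrow> real mat \<Rightarrow> real mat" where
  "push_metric n g P = (sp_adj n g)\<^sup>T * P * sp_adj n g"

lemma push_metric_mult_frame:
  assumes g: "is_Sp n g" and P: "siegel_metric n P W"
  shows "pos_def (2*n) (push_metric n g P)"
    "cplx (push_metric n g P) * (cplx g * frame W) = \<i> \<cdot>\<^sub>m (cplx (Jmat n) * (cplx g * frame W))"
proof -
  have P_pos: "pos_def (2*n) P" and W: "W \<in> carrier_mat n n"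
    and PW: "cplx P * frame W = \<i> \<cdot>\<^sub>m (cplx (Jmat n) * frame W)"
    using P unfolding siegel_metric_def by auto
  note [simp] = is_SpD(2,3)[OF g] carrier_matD[OF W] carrier_matD[OF pos_defD(1)[OF P_pos]]
  let ?h = "sp_adj n g"
  note gh = is_Sp_sp_adj_mult[OF g]
  show "pos_def (2*n) (push_metric n g P)"
    unfolding push_metric_def
    by (rule pos_def_congruence[OF P_pos sp_adj_carrier is_SpD(1)[OF g] gh(2)])
  have JW: "cplx (?h\<^sup>T) * (cplx (Jmat n) * frame W) = cplx (Jmat n) * (cplx g * frame W)"
  proof -
    have "?h\<^sup>T * Jmat n = ?h\<^sup>T * Jmat n * (?h * g)" unfolding gh by (simp add: one_mult_mat_dim)
    also have "\<dots> = Jmat n * g"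
      using is_SpD(4)[OF is_Sp_sp_adj[OF g]] by (simp flip: assoc_mult_mat_dim)
    finally have "cplx (?h\<^sup>T * Jmat n) * frame W = cplx (Jmat n * g) * frame W" by simp
    then show ?thesis by (simp add: cplx_mult assoc_mult_mat_dim)
  qed
  have hgW: "cplx ?h * (cplx g * frame W) = frame W"
    by (rule is_Sp_cplx_sp_adj_cancel[OF g]) simp
  have "cplx (push_metric n g P) * (cplx g * frame W)
    = cplx (?h\<^sup>T) * (cplx P * (cplx ?h * (cplx g * frame W)))"
    unfolding push_metric_def by (simp add: cplx_mult assoc_mult_mat_dim)
  also have "\<dots> = \<i> \<cdot>\<^sub>m (cplx (Jmat n) * (cplx g * frame W))"
    unfolding hgW PW using JW by (simp add: mult_smult_mat_dim)
  finally show "cplx (push_metric n g P) * (cplx g * frame W)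
    = \<i> \<cdot>\<^sub>m (cplx (Jmat n) * (cplx g * frame W))" .
qed

lemma sp_act_metric:
  assumes g: "is_Sp n g" and P: "siegel_metric n P W"
  shows "siegel_metric n (push_metric n g P) (sp_act n g W)"
    "cplx g * frame W = frame (sp_act n g W) * automorphy n g W"
    "minv (automorphy n g W) \<in> carrier_mat n n" "automorphy n g W * minv (automorphy n g W) = 1\<^sub>m n"
proof -
  have W: "W \<in> carrier_mat n n" using P unfolding siegel_metric_def by simp
  note gc = is_SpD(1)[OF g]
  have F: "cplx g * frame W \<in> carrier_mat (2*n) n" using gc frame_carrier[OF W] by simp
  let ?L = "(0\<^sub>m n n @\<^sub>r 1\<^sub>m n)\<^sup>T * cplx (sp_adj n g)"
  have Lc: "?L \<in> carrier_mat n (2*n)" by (rule carrier_matI) auto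
  have "cplx (sp_adj n g) * (cplx g * frame W) = frame W"
    by (rule is_Sp_cplx_sp_adj_cancel[OF g]) (use W in simp)
  then have L: "?L * (cplx g * frame W) = 1\<^sub>m n"
    using W gc by (simp add: assoc_mult_mat_dim frame_left_inverse)
  obtain V K where V: "siegel_metric n (push_metric n g P) V" and K: "K \<in> carrier_mat n n"
    "minv K \<in> carrier_mat n n" "K * minv K = 1\<^sub>m n" and VK: "cplx g * frame W = frame V * K"
    using siegel_frame_factorization[OF push_metric_mult_frame(1)[OF g P] F Lc L
        push_metric_mult_frame(2)[OF g P]] by metis
  have Vc: "V \<in> carrier_mat n n" using V unfolding siegel_metric_def by simp
  have "sp_numerator n g W @\<^sub>r automorphy n g W = (V * K) @\<^sub>r K"
    using VK cplx_mult_frame[OF gc W] Vc K(1) by (simp add: frame_mult)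
  from append_rows_inject[OF this, of n n n] Vc K(1)
  have num: "sp_numerator n g W = V * K" and aut: "automorphy n g W = K"
    by auto
  have "sp_act n g W = V * K * minv K"
    using num aut unfolding sp_act_def Let_def sp_numerator_def automorphy_def by simp
  also have "\<dots> = V" using Vc K by (simp add: assoc_mult_mat_dim)
  finally have act: "sp_act n g W = V" .
  show "siegel_metric n (push_metric n g P) (sp_act n g W)"
    "cplx g * frame W = frame (sp_act n g W) * automorphy n g W"
    "minv (automorphy n g W) \<in> carrier_mat n n" "automorphy n g W * minv (automorphy n g W) = 1\<^sub>m n"
    unfolding act aut using V VK K by auto
qed

lemma siegel_sp_act: "is_Sp n g \<Longrightarrow> siegel n W \<Longrightarrow> siegel n (sp_act n g W)"
  by (rule siegel_if_metric[OF sp_act_metric(1)[OF _ siegel_metric_metric_of]])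

lemma sp_act_frame:
  assumes "is_Sp n g" "siegel n W"
  shows "cplx g * frame W = frame (sp_act n g W) * automorphy n g W"
    "minv (automorphy n g W) \<in> carrier_mat n n" "automorphy n g W * minv (automorphy n g W) = 1\<^sub>m n"
  by (rule sp_act_metric(2-4)[OF assms(1) siegel_metric_metric_of[OF assms(2)]])+

lemma sp_act_eqI:
  assumes g: "is_Sp n g" and W: "siegel n W" and V: "V \<in> carrier_mat n n"
    and K: "K \<in> carrier_mat n n"
    and eq: "cplx g * frame W = frame V * K"
  shows "sp_act n g W = V"
proof -
  note act = siegelD(1)[OF siegel_sp_act[OF g W]] and frame = sp_act_frame[OF g W]
  have num: "sp_act n g W * automorphy n g W = V * K" and aut: "automorphy n g W = K"
    using frame_mult_inject[OF _ act V _ K] frame(1) eq by auto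
  have "V = V * K * minv K" using frame(2,3) V K unfolding aut by (simp add: assoc_mult_mat_dim)
  also have "\<dots> = sp_act n g W"
    using frame(2,3) act K unfolding num[symmetric] aut by (simp add: assoc_mult_mat_dim)
  finally show ?thesis ..
qed

lemma sp_act_mult:
  assumes g: "is_Sp n g" and h: "is_Sp n h" and W: "siegel n W"
  shows "sp_act n (g * h) W = sp_act n g (sp_act n h W)"
proof (rule sp_act_eqI[OF is_Sp_mult[OF g h] W])
  note hW = siegel_sp_act[OF h W]
  note [simp] = is_SpD(2,3)[OF g] is_SpD(2,3)[OF h] siegelD(2,3)[OF W] siegelD(2,3)[OF hW]
    siegelD(2,3)[OF siegel_sp_act[OF g hW]]
  show "sp_act n g (sp_act n h W) \<in> carrier_mat n n" by (rule carrier_matI) auto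
  show "automorphy n g (sp_act n h W) * automorphy n h W \<in> carrier_mat n n"
    by (rule carrier_matI) auto
  have "cplx (g * h) * frame W = cplx g * frame (sp_act n h W) * automorphy n h W"
    by (simp add: cplx_mult assoc_mult_mat_dim sp_act_frame(1)[OF h W])
  also have "\<dots>
    = frame (sp_act n g (sp_act n h W)) * (automorphy n g (sp_act n h W) * automorphy n h W)"
    unfolding sp_act_frame(1)[OF g hW] by (rule assoc_mult_mat_dim) auto
  finally show "cplx (g * h) * frame W
    = frame (sp_act n g (sp_act n h W)) * (automorphy n g (sp_act n h W) * automorphy n h W)" .
qed

lemma is_Sp_one: "is_Sp n (1\<^sub>m (2*n))"
  unfolding is_Sp_iff_sp_adj by (simp add: sp_adj_one one_mult_mat_dim)

lemma sp_act_one: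
  assumes "siegel n W"
  shows "sp_act n (1\<^sub>m (2*n)) W = W"
proof (rule sp_act_eqI[OF is_Sp_one assms])
  show "W \<in> carrier_mat n n" by (rule siegelD(1)[OF assms])
  show "cplx (1\<^sub>m (2*n)) * frame W = frame W * 1\<^sub>m n"
    using siegelD[OF assms] by (simp add: of_real_hom.mat_hom_one one_mult_mat_dim)
qed simp

lemma tau_pt_eq_conj_mat: "tau_pt Z = - conj_mat Z"
  unfolding tau_pt_def by (intro eq_matI) auto

lemma tau_pt_tau_pt [simp]: "tau_pt (tau_pt Z) = Z"
  unfolding tau_pt_def by (intro eq_matI) auto

lemma siegel_tau_pt: "siegel n Z \<Longrightarrow> siegel n (tau_pt Z)"
proof -
  assume "siegel n Z"
  note Z = siegelD[OF this]
  have "map_mat Im (tau_pt Z) = map_mat Im Z" unfolding tau_pt_def by (intro eq_matI) auto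
  moreover have "(tau_pt Z)\<^sup>T = tau_pt Z"
    unfolding tau_pt_def using Z(4) by (simp add: map_mat_transpose)
  ultimately show "siegel n (tau_pt Z)" unfolding siegel_def using Z by (simp add: tau_pt_def)
qed

lemma cplx_Tmat_mult_frame:
  assumes "Z \<in> carrier_mat n n"
  shows "cplx (Tmat n) * frame (tau_pt Z) = - conj_mat (frame Z)"
proof -
  have "cplx (Tmat n) = four_block_mat (1\<^sub>m n) (0\<^sub>m n n) (0\<^sub>m n n) (- 1\<^sub>m n)"
    unfolding Tmat_def by (intro eq_matI) auto
  moreover have "tau_pt Z \<in> carrier_mat n n" using assms unfolding tau_pt_def by simp
  ultimately have "cplx (Tmat n) * frame (tau_pt Z) = (- conj_mat Z) @\<^sub>r (- 1\<^sub>m n)"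
    using assms unfolding frame_def
    by (simp add: four_block_mult_append_rows[of _ n n _ n _ n _ _ n] mat_dim_simps
        tau_pt_eq_conj_mat)
  then show ?thesis
    using assms unfolding frame_def by (auto simp: index_append_rows intro!: eq_matI)
qed

lemma sp_act_tau:
  assumes g: "is_Sp n g" and W: "siegel n W"
  shows "sp_act n (tau_g n g) (tau_pt W) = tau_pt (sp_act n g W)"
proof (rule sp_act_eqI[OF is_Sp_tau_g[OF g] siegel_tau_pt[OF W]])
  note V = siegel_sp_act[OF g W]
  note [simp] = is_SpD(2,3)[OF g] siegelD(2,3)[OF W] siegelD(2,3)[OF V]
    siegelD(2,3)[OF siegel_tau_pt[OF W]] siegelD(2,3)[OF siegel_tau_pt[OF V]]
  let ?K = "conj_mat (automorphy n g W)"
  show "tau_pt (sp_act n g W) \<in> carrier_mat n n" "?K \<in> carrier_mat n n"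
    by (auto intro: carrier_matI)
  have "cplx (tau_g n g) * frame (tau_pt W)
    = cplx (Tmat n) * (cplx g * (cplx (Tmat n) * frame (tau_pt W)))"
    unfolding tau_g_eq_Tmat[OF is_SpD(1)[OF g]] by (simp add: cplx_mult assoc_mult_mat_dim)
  also have "\<dots> = - (cplx (Tmat n) * conj_mat (cplx g * frame W))"
    unfolding cplx_Tmat_mult_frame[OF siegelD(1)[OF W]] by (simp add: conj_mat_mult)
  also have "\<dots> = - (cplx (Tmat n) * conj_mat (frame (sp_act n g W))) * ?K"
    unfolding sp_act_frame(1)[OF g W] by (simp add: conj_mat_mult assoc_mult_mat_dim)
  also have "\<dots> = (cplx (Tmat n) * (cplx (Tmat n) * frame (tau_pt (sp_act n g W)))) * ?K"
    unfolding cplx_Tmat_mult_frame[OF siegelD(1)[OF V]] by simp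
  also have "cplx (Tmat n) * (cplx (Tmat n) * frame (tau_pt (sp_act n g W)))
      = frame (tau_pt (sp_act n g W))"
    by (rule left_inverse_cancel_mat[OF cplx_mult_eq_one[OF Tmat_Tmat]]) auto
  finally show "cplx (tau_g n g) * frame (tau_pt W) = frame (tau_pt (sp_act n g W)) * ?K" .
qed

subsection \<open>Isotropy of a point of the Siegel space\<close>

lemma cplx_mult_frame_eq_zeroD:
  assumes Z: "siegel n Z" and R: "R \<in> carrier_mat r (2*n)" and RZ: "cplx R * frame Z = 0\<^sub>m r n"
  shows "R = 0\<^sub>m r (2*n)"
proof -
  note Zd = siegelD[OF Z] and inv = pos_def_minv[OF siegelD(5)[OF Z]]
  define R1 R2 where "R1 = mat r n (\<lambda>(i,j). R $$ (i, j))"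
    and "R2 = mat r n (\<lambda>(i,j). R $$ (i, n + j))"
  have split: "R $$ (i, j) = (if j < n then R1 $$ (i, j) else R2 $$ (i, j - n))"
    if "i < r" "j < 2*n" for i j
    using that unfolding R1_def R2_def by auto
  have "cplx R * frame Z = cplx R1 * Z + cplx R2"
    using R Zd unfolding R1_def R2_def frame_def
    by (intro eq_matI) (auto simp: index_mult_mat_sum index_append_rows sum_lessThan_add
        if_distrib[of "(*) _"] simp del: index_mult_mat(1) cong: if_cong)
  then have zero: "cplx R1 * Z + cplx R2 = 0\<^sub>m r n" using RZ by simp
  have "R1 * map_mat Im Z = map_mat Im (cplx R1 * Z + cplx R2)"
    using Zd unfolding R1_def R2_def by (intro eq_matI) (auto simp: scalar_prod_def)
  also have "\<dots> = 0\<^sub>m r n" unfolding zero by (intro eq_matI) auto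
  finally have "R1 * map_mat Im Z * minv (map_mat Im Z) = 0\<^sub>m r n"
    using inv(1) by (simp add: zero_mult_mat_dim)
  then have R1: "R1 = 0\<^sub>m r n"
    using inv(1,2) Zd by (simp add: assoc_mult_mat_dim R1_def)
  then have "cplx R2 = 0\<^sub>m r n"
    using zero Zd by (auto simp: mat_eq_iff R2_def scalar_prod_def)
  then have "R2 = 0\<^sub>m r n" by (simp add: cplx_eq_zero_iff)
  with R1 split R show ?thesis by (intro eq_matI) auto
qed

lemma siegel_metric_unique:
  assumes "siegel_metric n P Z" "siegel_metric n Q Z"
  shows "P = Q"
proof -
  have PQ: "P \<in> carrier_mat (2*n) (2*n)" "Q \<in> carrier_mat (2*n) (2*n)" and Z: "Z \<in> carrier_mat n n"
    and eq: "cplx P * frame Z = cplx Q * frame Z"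
    using assms pos_defD(1) unfolding siegel_metric_def by auto
  have "cplx (P - Q) = cplx P - cplx Q" using PQ by (intro eq_matI) auto
  then have "cplx (P - Q) * frame Z = 0\<^sub>m (2*n) n"
    using PQ Z eq by (simp add: minus_mult_distrib_mat_dim) (auto intro!: eq_matI)
  from cplx_mult_frame_eq_zeroD[OF siegel_if_metric[OF assms(1)] minus_carrier_mat[OF PQ(2)] this]
  show ?thesis using PQ by (auto simp: mat_eq_iff)
qed

lemma isotropy_preserves_metric:
  assumes l: "is_Sp n l" and Z: "siegel n Z" and fixed: "sp_act n l Z = Z"
  obtains P where "pos_def (2*n) P" "l\<^sup>T * P * l = P"
proof -
  note metric = siegel_metric_metric_of[OF Z]
  let ?P = "metric_of Z"
  have P: "pos_def (2*n) ?P" using metric unfolding siegel_metric_def by simp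
  note [simp] = is_SpD(2,3)[OF l] carrier_matD[OF pos_defD(1)[OF P]]
  have "push_metric n l ?P = ?P"
    using siegel_metric_unique[OF sp_act_metric(1)[OF l metric, unfolded fixed] metric] .
  then have "l\<^sup>T * ?P * l = l\<^sup>T * ((sp_adj n l)\<^sup>T * ?P * sp_adj n l) * l"
    unfolding push_metric_def by simp
  also have "\<dots> = (sp_adj n l * l)\<^sup>T * ?P * (sp_adj n l * l)" by (simp add: mat_dim_simps)
  also have "\<dots> = ?P" unfolding is_Sp_sp_adj_mult[OF l] by (simp add: one_mult_mat_dim)
  finally show ?thesis using that[OF P] by simp
qed

lemma isotropy_eigenvalue_cmod:
  assumes "is_Sp n l" "siegel n Z" "sp_act n l Z = Z" "eigenvalue (cplx l) x"
  shows "cmod x = 1"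
  by (rule isotropy_preserves_metric[OF assms(1-3)])
    (use isometry_eigenvalue_cmod is_SpD(1)[OF assms(1)] assms(4) in blast)

lemma isotropy_unipotent_eq_one:
  assumes "is_Sp n l" "siegel n Z" "sp_act n l Z = Z" "unipotent_mat l"
  shows "l = 1\<^sub>m (2*n)"
  by (rule isotropy_preserves_metric[OF assms(1-3)])
    (use isometry_unipotent_eq_one is_SpD(1)[OF assms(1)] assms(4) in blast)

subsection \<open>The parabolic subgroup and its Levi projection\<close>

definition levi_index :: "nat \<Rightarrow> nat \<Rightarrow> nat" where
  "levi_index q i = (if i < q then i else Suc i)"

text \<open>The algebra spanned by the stabiliser of the boundary component: for symplectic matrices the
  condition on the last row follows from the one on column \<open>q\<close>.\<close>

definition parabolic :: "nat \<Rightarrow> real mat \<Rightarrow> bool" where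
  "parabolic q X \<longleftrightarrow> X \<in> carrier_mat (2 * Suc q) (2 * Suc q)
    \<and> (\<forall>i<2 * Suc q. i \<noteq> q \<longrightarrow> X $$ (i, q) = 0)
    \<and> (\<forall>j<2 * Suc q. j \<noteq> Suc (2*q) \<longrightarrow> X $$ (Suc (2*q), j) = 0)"

lemma parabolicD:
  assumes "parabolic q X"
  shows "X \<in> carrier_mat (2 * Suc q) (2 * Suc q)" "dim_row X = 2 * Suc q" "dim_col X = 2 * Suc q"
    "i < 2 * Suc q \<Longrightarrow> i \<noteq> q \<Longrightarrow> X $$ (i, q) = 0"
    "j < 2 * Suc q \<Longrightarrow> j \<noteq> Suc (2*q) \<Longrightarrow> X $$ (Suc (2*q), j) = 0"
  using assms unfolding parabolic_def by auto

lemma levi_proj_eq_mat: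
  "levi_proj (Suc q) X = mat (2*q) (2*q) (\<lambda>(i,j). X $$ (levi_index q i, levi_index q j))"
  unfolding levi_proj_def levi_index_def Let_def by (intro eq_matI) auto

lemma dim_levi_proj [simp]:
  "dim_row (levi_proj (Suc q) X) = 2*q" "dim_col (levi_proj (Suc q) X) = 2*q"
  unfolding levi_proj_eq_mat by auto

lemma levi_proj_carrier [simp]: "levi_proj (Suc q) X \<in> carrier_mat (2*q) (2*q)"
  by (rule carrier_matI) auto

lemma index_levi_proj [simp]:
  "i < 2*q \<Longrightarrow> j < 2*q \<Longrightarrow> levi_proj (Suc q) X $$ (i, j) = X $$ (levi_index q i, levi_index q j)"
  unfolding levi_proj_eq_mat by auto

lemma levi_index_bounds [simp]:
  "i < 2*q \<Longrightarrow> levi_index q i < 2 * Suc q" "levi_index q i \<noteq> q" "i < 2*q \<Longrightarrow> levi_index q i \<noteq> Suc (2*q)"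
  unfolding levi_index_def by auto

lemma levi_index_eq_iff [simp]: "levi_index q i = levi_index q j \<longleftrightarrow> i = j"
  unfolding levi_index_def by auto

lemma levi_index_cases:
  assumes "k < 2 * Suc q"
  obtains "k = q" | "k = Suc (2*q)" | i where "i < 2*q" "k = levi_index q i"
proof (cases "k < q")
  case True
  then show ?thesis using that(3)[of k] by (simp add: levi_index_def)
next
  case False
  then have "k = q \<or> k = Suc (2*q) \<or> k - 1 < 2*q \<and> k = levi_index q (k - 1)"
    using assms by (auto simp: levi_index_def)
  then show ?thesis using that by blast
qed

lemma sum_levi_index:
  fixes f :: "nat \<Rightarrow> 'a::comm_monoid_add"
  shows "(\<Sum>k<2 * Suc q. f k) = (\<Sum>k<2*q. f (levi_index q k)) + (f q + f (Suc (2*q)))"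
proof -
  have "(\<Sum>k<2*q. f (levi_index q k)) = (\<Sum>k<q. f k) + (\<Sum>k<q. f (Suc q + k))"
    using sum_lessThan_add[of "\<lambda>k. f (levi_index q k)" q q] by (simp add: levi_index_def mult_2)
  moreover have "(\<Sum>k<2 * Suc q. f k) = (\<Sum>k<Suc q. f k) + (\<Sum>k<q. f (Suc q + k)) + f (Suc (2*q))"
    using sum_lessThan_add[of f "Suc q" q] by (simp add: mult_2)
  ultimately show ?thesis by (simp add: ac_simps)
qed

lemma index_mult_levi:
  fixes X :: "'a::semiring_0 mat"
  assumes "dim_col X = 2 * Suc q" "dim_row Y = 2 * Suc q" "i < dim_row X" "j < dim_col Y"
  shows "(X * Y) $$ (i, j) = (\<Sum>k<2*q. X $$ (i, levi_index q k) * Y $$ (levi_index q k, j))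
    + (X $$ (i, q) * Y $$ (q, j) + X $$ (i, Suc (2*q)) * Y $$ (Suc (2*q), j))"
  using assms by (simp only: index_mult_mat_sum sum_levi_index)

lemma index_mult_mat_vec_levi:
  fixes X :: "'a::semiring_0 mat"
  assumes "dim_col X = 2 * Suc q" "dim_vec v = 2 * Suc q" "i < dim_row X"
  shows "(X *\<^sub>v v) $ i = (\<Sum>j<2*q. X $$ (i, levi_index q j) * v $ levi_index q j)
    + (X $$ (i, q) * v $ q + X $$ (i, Suc (2*q)) * v $ Suc (2*q))"
  using assms sum_levi_index[of "\<lambda>j. X $$ (i, j) * v $ j" q]
  by (simp add: scalar_prod_def atLeast0LessThan)

lemma levi_proj_mult:
  assumes X: "X \<in> carrier_mat (2 * Suc q) (2 * Suc q)"
    and Y: "Y \<in> carrier_mat (2 * Suc q) (2 * Suc q)"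
    and zero: "\<And>i j. i < 2*q \<Longrightarrow> j < 2*q
      \<Longrightarrow> X $$ (levi_index q i, q) = 0 \<or> Y $$ (q, levi_index q j) = 0"
      "\<And>i j. i < 2*q \<Longrightarrow> j < 2*q
        \<Longrightarrow> X $$ (levi_index q i, Suc (2*q)) = 0 \<or> Y $$ (Suc (2*q), levi_index q j) = 0"
  shows "levi_proj (Suc q) (X * Y) = levi_proj (Suc q) X * levi_proj (Suc q) Y"
proof (rule eq_matI)
  fix i j assume "i < dim_row (levi_proj (Suc q) X * levi_proj (Suc q) Y)"
    "j < dim_col (levi_proj (Suc q) X * levi_proj (Suc q) Y)"
  then have ij: "i < 2*q" "j < 2*q" by auto
  have "levi_proj (Suc q) (X * Y) $$ (i, j)
    = (\<Sum>k<2*q. X $$ (levi_index q i, levi_index q k) * Y $$ (levi_index q k, levi_index q j))"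
    using X Y ij zero[OF ij] index_mult_levi[of X q Y "levi_index q i" "levi_index q j"]
      levi_index_bounds(1)[OF ij(1)] levi_index_bounds(1)[OF ij(2)]
    by (auto simp del: index_mult_mat(1))
  also have "\<dots> = (levi_proj (Suc q) X * levi_proj (Suc q) Y) $$ (i, j)"
    using ij by (simp add: index_mult_mat_sum del: index_mult_mat(1))
  finally show "levi_proj (Suc q) (X * Y) $$ (i, j)
    = (levi_proj (Suc q) X * levi_proj (Suc q) Y) $$ (i, j)" .
qed auto

lemma parabolic_mult:
  assumes "parabolic q X" "parabolic q Y"
  shows "parabolic q (X * Y)"
    "levi_proj (Suc q) (X * Y) = levi_proj (Suc q) X * levi_proj (Suc q) Y"
    "(X * Y) $$ (q, q) = X $$ (q, q) * Y $$ (q, q)"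
    "(X * Y) $$ (Suc (2*q), Suc (2*q)) = X $$ (Suc (2*q), Suc (2*q)) * Y $$ (Suc (2*q), Suc (2*q))"
proof -
  note X = parabolicD[OF assms(1)] and Y = parabolicD[OF assms(2)]
  have entry: "(X * Y) $$ (i, j) = (\<Sum>k<2*q. X $$ (i, levi_index q k) * Y $$ (levi_index q k, j))
    + (X $$ (i, q) * Y $$ (q, j) + X $$ (i, Suc (2*q)) * Y $$ (Suc (2*q), j))"
    if "i < 2 * Suc q" "j < 2 * Suc q" for i j
    by (rule index_mult_levi) (use X Y that in auto)
  have column: "Y $$ (levi_index q k, q) = 0" if "k < 2*q" for k
    by (rule Y(4)) (use that levi_index_bounds in auto)
  have row: "X $$ (Suc (2*q), levi_index q k) = 0" if "k < 2*q" for k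
    by (rule X(5)) (use that levi_index_bounds in auto)
  have corner: "Y $$ (Suc (2*q), q) = 0" "X $$ (Suc (2*q), q) = 0" using X(4) Y(4) by auto
  show "(X * Y) $$ (q, q) = X $$ (q, q) * Y $$ (q, q)"
    using entry[of q q] column corner by simp
  show "(X * Y) $$ (Suc (2*q), Suc (2*q))
    = X $$ (Suc (2*q), Suc (2*q)) * Y $$ (Suc (2*q), Suc (2*q))"
    using entry[of "Suc (2*q)" "Suc (2*q)"] row corner by simp
  show "levi_proj (Suc q) (X * Y) = levi_proj (Suc q) X * levi_proj (Suc q) Y"
    by (rule levi_proj_mult[OF X(1) Y(1)]) (use X(4) Y(5) levi_index_bounds in auto)
  show "parabolic q (X * Y)"
    unfolding parabolic_def
  proof (intro conjI allI impI)
    show "X * Y \<in> carrier_mat (2 * Suc q) (2 * Suc q)" using X(1) Y(1) by (rule mult_carrier_mat)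
  next
    fix i assume "i < 2 * Suc q" "i \<noteq> q"
    then show "(X * Y) $$ (i, q) = 0" using entry[of i q] X(4)[of i] column corner by simp
  next
    fix j assume "j < 2 * Suc q" "j \<noteq> Suc (2*q)"
    then show "(X * Y) $$ (Suc (2*q), j) = 0"
      using entry[of "Suc (2*q)" j] Y(5)[of j] row corner by simp
  qed
qed

lemma parabolic_one: "parabolic q (1\<^sub>m (2 * Suc q))"
  unfolding parabolic_def by auto

lemma parabolic_Tmat: "parabolic q (Tmat (Suc q))"
  unfolding parabolic_def by (auto simp: index_Tmat)

lemma parabolic_add: "parabolic q X \<Longrightarrow> parabolic q Y \<Longrightarrow> parabolic q (X + Y)"
  unfolding parabolic_def by auto

lemma parabolic_minus: "parabolic q X \<Longrightarrow> parabolic q Y \<Longrightarrow> parabolic q (X - Y)"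
  unfolding parabolic_def by (auto intro: minus_carrier_mat)

lemma parabolic_smult: "parabolic q X \<Longrightarrow> parabolic q (c \<cdot>\<^sub>m X)"
  unfolding parabolic_def by auto

lemma levi_proj_one: "levi_proj (Suc q) (1\<^sub>m (2 * Suc q)) = 1\<^sub>m (2*q)"
  using levi_index_bounds(1) by (intro eq_matI) (auto simp del: mult_Suc_right)

lemma levi_proj_Tmat: "levi_proj (Suc q) (Tmat (Suc q)) = Tmat q"
  using levi_index_bounds(1)
  by (intro eq_matI) (auto simp: index_Tmat levi_index_def simp del: levi_index_bounds)

lemma levi_proj_Jmat: "levi_proj (Suc q) (Jmat (Suc q)) = Jmat q"
  by (intro eq_matI) (auto simp: index_Jmat levi_index_def)

lemma levi_proj_add:
  "parabolic q X \<Longrightarrow> parabolic q Y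
    \<Longrightarrow> levi_proj (Suc q) (X + Y) = levi_proj (Suc q) X + levi_proj (Suc q) Y"
  using levi_index_bounds(1)
  by (intro eq_matI) (auto simp: parabolicD(2,3) simp del: mult_Suc_right)

lemma levi_proj_minus:
  "parabolic q X \<Longrightarrow> parabolic q Y
    \<Longrightarrow> levi_proj (Suc q) (X - Y) = levi_proj (Suc q) X - levi_proj (Suc q) Y"
  using levi_index_bounds(1)
  by (intro eq_matI) (auto simp: parabolicD(2,3) simp del: mult_Suc_right)

lemma levi_proj_smult:
  "parabolic q X \<Longrightarrow> levi_proj (Suc q) (c \<cdot>\<^sub>m X) = c \<cdot>\<^sub>m levi_proj (Suc q) X"
  using levi_index_bounds(1)
  by (intro eq_matI) (auto simp: parabolicD(2,3) simp del: mult_Suc_right)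

lemma parabolic_tau_g:
  assumes "parabolic q X"
  shows "parabolic q (tau_g (Suc q) X)"
    "levi_proj (Suc q) (tau_g (Suc q) X) = tau_g q (levi_proj (Suc q) X)"
  using parabolic_mult[OF parabolic_Tmat assms] parabolic_mult[OF _ parabolic_Tmat]
  by (auto simp: tau_g_eq_Tmat[OF parabolicD(1)[OF assms]] tau_g_eq_Tmat[OF levi_proj_carrier]
      levi_proj_Tmat)

lemma index_mult_mat_single:
  fixes A :: "'a::semiring_0 mat"
  assumes "i < dim_row A" "j < dim_col B" "dim_col A = dim_row B" "m < dim_row B"
    and zero: "\<And>k. k < dim_row B \<Longrightarrow> k \<noteq> m \<Longrightarrow> A $$ (i, k) = 0 \<or> B $$ (k, j) = 0"
  shows "(A * B) $$ (i, j) = A $$ (i, m) * B $$ (m, j)"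
proof -
  have "(\<Sum>k\<in>{..<dim_row B} - {m}. A $$ (i, k) * B $$ (k, j)) = 0"
    by (rule sum.neutral) (use zero in fastforce)
  then show ?thesis
    using assms by (simp add: index_mult_mat_sum sum.remove[of _ m] del: index_mult_mat(1))
qed

lemma Jmat_mult_index:
  assumes "dim_row X = 2*n" "i < n" "j < dim_col X"
  shows "(Jmat n * X) $$ (i, j) = X $$ (i + n, j)"
  using assms index_mult_mat_single[of i "Jmat n" j X "i + n"]
  by (auto simp: index_Jmat simp del: index_mult_mat(1))

lemma Sp_stab_parabolic:
  assumes h: "is_Sp (Suc q) h" and stab: "stab_bc (Suc q) h"
  shows "parabolic q h" "h $$ (q, q) * h $$ (Suc (2*q), Suc (2*q)) = 1"
proof -
  note hd = is_SpD[OF h]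
  have column: "h $$ (i, q) = 0" if "i < 2 * Suc q" "i \<noteq> q" for i
    using stab that unfolding stab_bc_def by auto
  have row: "h $$ (q, q) * h $$ (Suc (2*q), j) = (if j = Suc (2*q) then 1 else 0)"
    if j: "j < 2 * Suc q" for j
  proof -
    have "(h\<^sup>T * (Jmat (Suc q) * h)) $$ (q, j) = Jmat (Suc q) $$ (q, j)"
      using hd by (simp flip: assoc_mult_mat_dim)
    moreover have
      "(h\<^sup>T * (Jmat (Suc q) * h)) $$ (q, j) = h $$ (q, q) * (Jmat (Suc q) * h) $$ (q, j)"
      using hd j column index_mult_mat_single[of q "h\<^sup>T" j "Jmat (Suc q) * h" q]
      by (simp del: index_mult_mat(1))
    moreover have "(Jmat (Suc q) * h) $$ (q, j) = h $$ (Suc (2*q), j)"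
      using hd j by (subst Jmat_mult_index) (auto simp: mult_2)
    ultimately show ?thesis using j by (auto simp: index_Jmat mult_2)
  qed
  show "h $$ (q, q) * h $$ (Suc (2*q), Suc (2*q)) = 1" using row[of "Suc (2*q)"] by simp
  then have "h $$ (q, q) \<noteq> 0" by auto
  then show "parabolic q h"
    unfolding parabolic_def using hd(1) column row by (metis mult_eq_0_iff)
qed

lemma stab_bc_if_parabolic: "parabolic q h \<Longrightarrow> stab_bc (Suc q) h"
  unfolding stab_bc_def using parabolicD(4) by simp

lemma levi_proj_Sp:
  assumes h: "is_Sp (Suc q) h" and p: "parabolic q h"
  shows "is_Sp q (levi_proj (Suc q) h)"
proof -
  note hd = is_SpD[OF h]
  let ?J = "Jmat (Suc q)"
  have last_row: "h $$ (Suc (2*q), levi_index q k) = 0" if "k < 2*q" for k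
    by (rule parabolicD(5)[OF p]) (use that levi_index_bounds in auto)
  have Jh_row: "(?J * h) $$ (q, levi_index q j) = 0" if "j < 2*q" for j
    using hd last_row[OF that] levi_index_bounds(1)[OF that]
    by (subst Jmat_mult_index) (auto simp: mult_2)
  have "levi_proj (Suc q) (h\<^sup>T * (?J * h)) = levi_proj (Suc q) (h\<^sup>T) * levi_proj (Suc q) (?J * h)"
  proof (rule levi_proj_mult)
    fix i j assume "i < 2*q" "j < 2*q"
    then show "h\<^sup>T $$ (levi_index q i, q) = 0 \<or> (?J * h) $$ (q, levi_index q j) = 0"
      "h\<^sup>T $$ (levi_index q i, Suc (2*q)) = 0 \<or> (?J * h) $$ (Suc (2*q), levi_index q j) = 0"
      using Jh_row last_row hd levi_index_bounds(1) by (simp_all del: index_mult_mat(1))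
  qed (use hd in auto)
  also have "levi_proj (Suc q) (?J * h) = levi_proj (Suc q) ?J * levi_proj (Suc q) h"
    by (rule levi_proj_mult[OF Jmat_carrier hd(1)]) (auto simp: index_Jmat levi_index_def)
  also have "levi_proj (Suc q) (h\<^sup>T) = (levi_proj (Suc q) h)\<^sup>T"
    using hd levi_index_bounds(1) by (intro eq_matI) (auto simp del: mult_Suc_right)
  also have "h\<^sup>T * (?J * h) = ?J" using hd by (simp flip: assoc_mult_mat_dim)
  finally show ?thesis
    unfolding is_Sp_def levi_proj_Jmat by (simp add: assoc_mult_mat_dim)
qed

lemma parabolic_eigenvalue:
  assumes k: "parabolic q k" and ev: "eigenvalue (cplx k) x"
  shows "x = of_real (k $$ (q, q)) \<or> x = of_real (k $$ (Suc (2*q), Suc (2*q)))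
    \<or> eigenvalue (cplx (levi_proj (Suc q) k)) x"
proof (rule ccontr)
  assume "\<not> ?thesis"
  then have x: "x \<noteq> of_real (k $$ (q, q))" "x \<noteq> of_real (k $$ (Suc (2*q), Suc (2*q)))"
    and no_ev: "\<not> eigenvalue (cplx (levi_proj (Suc q) k)) x" by auto
  note p = parabolicD[OF k]
  obtain v where v: "v \<in> carrier_vec (2 * Suc q)" "v \<noteq> 0\<^sub>v (2 * Suc q)" "cplx k *\<^sub>v v = x \<cdot>\<^sub>v v"
    using ev p unfolding eigenvalue_def eigenvector_def by auto
  have row: "x * v $ i = (\<Sum>j<2*q. of_real (k $$ (i, levi_index q j)) * v $ levi_index q j)
      + (of_real (k $$ (i, q)) * v $ q + of_real (k $$ (i, Suc (2*q))) * v $ Suc (2*q))"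
    if i: "i < 2 * Suc q" for i
    using index_mult_mat_vec_levi[of "cplx k" q v i] i v p(2,3) levi_index_bounds(1)
    by simp
  have "k $$ (Suc (2*q), levi_index q j) = 0" if "j < 2*q" for j
    by (rule p(5)) (use that levi_index_bounds in auto)
  then have v_last: "v $ Suc (2*q) = 0" using row[of "Suc (2*q)"] p(4)[of "Suc (2*q)"] x(2) by simp
  define w where "w = vec (2*q) (\<lambda>i. v $ levi_index q i)"
  have "cplx (levi_proj (Suc q) k) *\<^sub>v w = x \<cdot>\<^sub>v w"
  proof (rule eq_vecI)
    fix i assume "i < dim_vec (x \<cdot>\<^sub>v w)"
    then have i: "i < 2*q" unfolding w_def by simp
    have "k $$ (levi_index q i, q) = 0" by (rule p(4)) (use i levi_index_bounds in auto)
    then show "(cplx (levi_proj (Suc q) k) *\<^sub>v w) $ i = (x \<cdot>\<^sub>v w) $ i"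
      using row[OF levi_index_bounds(1)[OF i]] i v_last unfolding w_def
      by (simp add: scalar_prod_def atLeast0LessThan)
  qed (simp add: w_def)
  moreover have "w \<in> carrier_vec (2*q)" unfolding w_def by simp
  ultimately have "w = 0\<^sub>v (2*q)"
    using no_ev unfolding eigenvalue_def eigenvector_def by auto
  then have v_levi: "v $ levi_index q i = 0" if "i < 2*q" for i
    using that unfolding w_def by (metis index_vec index_zero_vec(1))
  then have v_q: "v $ q = 0" using row[of q] v_last x(1) by simp
  have "v $ i = 0" if "i < 2 * Suc q" for i
    by (rule levi_index_cases[OF that]) (use v_q v_last v_levi in auto)
  then show False using v(1,2) by (auto simp: vec_eq_iff)
qed

lemma parabolic_pow:
  assumes "parabolic q X"
  shows "parabolic q (X ^\<^sub>m j) \<and> levi_proj (Suc q) (X ^\<^sub>m j) = levi_proj (Suc q) X ^\<^sub>m j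
    \<and> (X ^\<^sub>m j) $$ (q, q) = (X $$ (q, q)) ^ j
    \<and> (X ^\<^sub>m j) $$ (Suc (2*q), Suc (2*q)) = (X $$ (Suc (2*q), Suc (2*q))) ^ j"
proof (induction j)
  case 0
  then show ?case using parabolicD(2)[OF assms] parabolic_one[of q] levi_proj_one[of q] by simp
next
  case (Suc j)
  then show ?case using parabolic_mult[of q "X ^\<^sub>m j" X] assms by simp
qed

lemma parabolic_unipotent:
  assumes k: "parabolic q k" and "unipotent_mat k"
  shows "unipotent_mat (levi_proj (Suc q) k)" "k $$ (q, q) = 1" "k $$ (Suc (2*q), Suc (2*q)) = 1"
proof -
  note kd = parabolicD(2,3)[OF k]
  define N where "N = k - 1\<^sub>m (2 * Suc q)"
  have N: "parabolic q N" unfolding N_def by (rule parabolic_minus[OF k parabolic_one])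
  obtain j where j: "N ^\<^sub>m j = 0\<^sub>m (2 * Suc q) (2 * Suc q)"
    using \<open>unipotent_mat k\<close> unfolding unipotent_mat_def N_def kd by blast
  have "levi_proj (Suc q) k - 1\<^sub>m (2*q) = levi_proj (Suc q) N"
    unfolding N_def by (simp add: levi_proj_minus k parabolic_one levi_proj_one del: mult_Suc_right)
  moreover have "levi_proj (Suc q) (0\<^sub>m (2 * Suc q) (2 * Suc q)) = 0\<^sub>m (2*q) (2*q)"
    using levi_index_bounds(1) by (intro eq_matI) (auto simp del: mult_Suc_right)
  ultimately show "unipotent_mat (levi_proj (Suc q) k)"
    using parabolic_pow[OF N, of j] unfolding unipotent_mat_def j by auto
  have "N $$ (q, q) = 0" "N $$ (Suc (2*q), Suc (2*q)) = 0"
    using parabolic_pow[OF N, of j] unfolding j by auto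
  then show "k $$ (q, q) = 1" "k $$ (Suc (2*q), Suc (2*q)) = 1"
    unfolding N_def using kd by auto
qed

lemma parabolic_nilpotent_cube:
  assumes M: "parabolic q M" "M $$ (q, q) = 0" "M $$ (Suc (2*q), Suc (2*q)) = 0"
    and levi: "levi_proj (Suc q) M = 0\<^sub>m (2*q) (2*q)"
  shows "M * (M * M) = 0\<^sub>m (2 * Suc q) (2 * Suc q)"
proof -
  note p = parabolicD[OF M(1)]
  have column: "M $$ (i, q) = 0" if "i < 2 * Suc q" for i
    using p(4)[OF that] M(2) by (cases "i = q") auto
  have row: "M $$ (Suc (2*q), j) = 0" if "j < 2 * Suc q" for j
    using p(5)[OF that] M(3) by (cases "j = Suc (2*q)") auto
  have middle: "M $$ (levi_index q i, levi_index q j) = 0" if "i < 2*q" "j < 2*q" for i j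
    using arg_cong[OF levi, of "\<lambda>X. X $$ (i, j)"] that by simp
  have MM: "M * M \<in> carrier_mat (2 * Suc q) (2 * Suc q)"
    using p(1) by (rule mult_carrier_mat) (rule p(1))
  have MM_entry: "(M * M) $$ (i, j) = (\<Sum>k<2*q. M $$ (i, levi_index q k) * M $$ (levi_index q k, j))"
    if "i < 2 * Suc q" "j < 2 * Suc q" for i j
    using index_mult_levi[of M q M i j] p column row that by simp
  have MM_levi: "(M * M) $$ (levi_index q i, j) = 0" if "i < 2*q" "j < 2 * Suc q" for i j
    using MM_entry[OF levi_index_bounds(1)[OF that(1)] that(2)] middle[OF that(1)] by simp
  have MM_last: "(M * M) $$ (Suc (2*q), j) = 0" if "j < 2 * Suc q" for j
    using MM_entry[of "Suc (2*q)" j] row that levi_index_bounds(1) by simp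
  have "(M * (M * M)) $$ (i, j) = 0" if "i < 2 * Suc q" "j < 2 * Suc q" for i j
    using index_mult_levi[of M q "M * M" i j] p MM column MM_levi MM_last that
    by (simp del: index_mult_mat(1))
  then show ?thesis using p MM by (intro eq_matI) auto
qed

subsection \<open>The fibres over the boundary component\<close>

definition bordered :: "'a mat \<Rightarrow> 'a vec \<Rightarrow> 'a \<Rightarrow> 'a mat" where
  "bordered Z w c = mat (Suc (dim_vec w)) (Suc (dim_vec w)) (\<lambda>(i,j).
    if i < dim_vec w then if j < dim_vec w then Z $$ (i, j) else w $ i
    else if j < dim_vec w then w $ j else c)"

lemma dim_bordered [simp]:
  "dim_row (bordered Z w c) = Suc (dim_vec w)" "dim_col (bordered Z w c) = Suc (dim_vec w)"
  unfolding bordered_def by auto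

lemma index_bordered [simp]:
  assumes "dim_vec w = q"
  shows "i < q \<Longrightarrow> j < q \<Longrightarrow> bordered Z w c $$ (i, j) = Z $$ (i, j)"
    "i < q \<Longrightarrow> bordered Z w c $$ (i, q) = w $ i"
    "j < q \<Longrightarrow> bordered Z w c $$ (q, j) = w $ j"
    "bordered Z w c $$ (q, q) = c"
  using assms unfolding bordered_def by auto

lemma map_mat_bordered:
  "dim_row Z = dim_vec w \<Longrightarrow> dim_col Z = dim_vec w
    \<Longrightarrow> map_mat f (bordered Z w c) = bordered (map_mat f Z) (map_vec f w) (f c)"
  unfolding bordered_def by (intro eq_matI) auto

lemma bordered_transpose:
  "dim_row Z = dim_vec w \<Longrightarrow> dim_col Z = dim_vec w \<Longrightarrow> (bordered Z w c)\<^sup>T = bordered Z\<^sup>T w c"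
  unfolding bordered_def by (intro eq_matI) auto

lemma bordered_inject:
  assumes "bordered Z w c = bordered Z' w' c'" "Z \<in> carrier_mat q q" "Z' \<in> carrier_mat q q"
    "w \<in> carrier_vec q" "w' \<in> carrier_vec q"
  shows "Z = Z'" "w = w'" "c = c'"
proof -
  have entry: "bordered Z w c $$ (i, j) = bordered Z' w' c' $$ (i, j)" for i j
    using assms(1) by simp
  have [simp]: "dim_vec w = q" "dim_vec w' = q" "dim_row Z = q" "dim_col Z = q" "dim_row Z' = q"
    "dim_col Z' = q"
    using assms by auto
  show "Z = Z'"
  proof (rule eq_matI)
    fix i j assume "i < dim_row Z'" "j < dim_col Z'"
    then show "Z $$ (i, j) = Z' $$ (i, j)" using entry[of i j] by simp
  qed auto
  show "w = w'"
  proof (rule eq_vecI)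
    fix i assume "i < dim_vec w'"
    then show "w $ i = w' $ i" using entry[of i q] by simp
  qed auto
  show "c = c'" using entry[of q q] by simp
qed

lemma siegel_eq_bordered:
  assumes "siegel (Suc q) W"
  obtains Z w c where "Z \<in> carrier_mat q q" "w \<in> carrier_vec q" "W = bordered Z w c"
proof -
  note W = siegelD[OF assms]
  let ?Z = "mat q q (\<lambda>(i,j). W $$ (i, j))" and ?w = "vec q (\<lambda>i. W $$ (i, q))"
  have "W = bordered ?Z ?w (W $$ (q, q))"
    using W(2,3) symmetric_matD[OF W(4)] unfolding bordered_def
    by (intro eq_matI) (auto simp: less_Suc_eq)
  then show ?thesis using that[of ?Z ?w] by simp
qed

lemma pos_def_1_iff: "D \<in> carrier_mat 1 1 \<Longrightarrow> pos_def 1 D \<longleftrightarrow> D $$ (0, 0) > 0"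
proof
  assume D: "D \<in> carrier_mat 1 1"
  have quad: "x \<bullet> (D *\<^sub>v x) = D $$ (0, 0) * (x $ 0)\<^sup>2" if "x \<in> carrier_vec 1" for x
    using D that by (simp add: scalar_prod_def power2_eq_square)
  show "D $$ (0, 0) > 0" if "pos_def 1 D"
    using pos_defD(3)[OF that, of "unit_vec 1 0"] quad[of "unit_vec 1 0"]
    by (auto simp: vec_eq_iff)
  show "pos_def 1 D" if "D $$ (0, 0) > 0"
    unfolding pos_def_def
  proof (intro conjI ballI impI)
    fix x :: "real vec" assume "x \<in> carrier_vec 1" "x \<noteq> 0\<^sub>v 1"
    then show "x \<bullet> (D *\<^sub>v x) > 0" using quad[of x] that by (auto simp: vec_eq_iff)
  qed (use D in \<open>auto simp: mat_eq_iff\<close>)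
qed

lemma pos_def_bordered_iff:
  assumes Y: "Y \<in> carrier_mat q q" and y: "y \<in> carrier_vec q"
  shows "pos_def (Suc q) (bordered Y y e) \<longleftrightarrow> pos_def q Y \<and> e - y \<bullet> (minv Y *\<^sub>v y) > 0"
proof -
  define B where "B = mat q 1 (\<lambda>(i,j). y $ i)"
  define D where "D = mat 1 1 (\<lambda>_. e)"
  have BD: "B \<in> carrier_mat q 1" "D \<in> carrier_mat 1 1" unfolding B_def D_def by auto
  have four_block: "bordered Y y e = four_block_mat Y B B\<^sup>T D"
    using Y y unfolding bordered_def B_def D_def by (intro eq_matI) auto
  have schur: "schur_complement Y B D \<in> carrier_mat 1 1"
    "schur_complement Y B D $$ (0, 0) = e - y \<bullet> (minv Y *\<^sub>v y)" if "pos_def q Y"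
  proof -
    note inv = pos_def_minv(1)[OF that]
    show "schur_complement Y B D \<in> carrier_mat 1 1"
      unfolding schur_complement_def using BD inv by (auto intro: carrier_matI)
    have "col B 0 = y" "row B\<^sup>T 0 = y" unfolding B_def using y by auto
    then have "(B\<^sup>T * (minv Y * B)) $$ (0, 0) = y \<bullet> (minv Y *\<^sub>v y)"
      using BD inv by (simp add: mult_mat_vec_def[symmetric])
    then show "schur_complement Y B D $$ (0, 0) = e - y \<bullet> (minv Y *\<^sub>v y)"
      unfolding schur_complement_def using BD inv by (simp add: assoc_mult_mat_dim D_def)
  qed
  show ?thesis
    using pos_def_four_blockD[OF Y BD] pos_def_four_blockI[OF BD, of Y] schur pos_def_1_iff
    unfolding four_block by auto
qed

lemma height_bordered:
  assumes "Z \<in> carrier_mat q q" "w \<in> carrier_vec q"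
  shows "height (Suc q) (bordered Z w c)
    = Im c - map_vec Im w \<bullet> (minv (map_mat Im Z) *\<^sub>v map_vec Im w)"
proof -
  have w: "dim_vec w = q" using assms(2) by simp
  have "mat q q (\<lambda>(i,j). map_mat Im (bordered Z w c) $$ (i, j)) = map_mat Im Z"
    "vec q (\<lambda>i. map_mat Im (bordered Z w c) $$ (i, q)) = map_vec Im w"
    using assms(1) w by (auto intro!: eq_matI eq_vecI)
  then show ?thesis unfolding height_def Let_def using w by simp
qed

lemma siegel_bordered_iff:
  assumes "Z \<in> carrier_mat q q" "w \<in> carrier_vec q"
  shows "siegel (Suc q) (bordered Z w c) \<longleftrightarrow> siegel q Z \<and> height (Suc q) (bordered Z w c) > 0"
proof -
  have "(bordered Z w c)\<^sup>T = bordered Z w c \<longleftrightarrow> Z\<^sup>T = Z"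
    using bordered_inject(1)[of "Z\<^sup>T" w c Z w c q] assms by (auto simp: bordered_transpose)
  moreover have "bordered Z w c \<in> carrier_mat (Suc q) (Suc q)"
    using assms(2) by (auto intro: carrier_matI)
  ultimately show ?thesis
    unfolding siegel_def height_bordered[OF assms]
    using assms by (auto simp: map_mat_bordered pos_def_bordered_iff)
qed

lemma siegel_bordered_exists:
  assumes "siegel q Z" "w \<in> carrier_vec q"
  obtains c where "siegel (Suc q) (bordered Z w c)" "height (Suc q) (bordered Z w c) > t"
proof
  note Z = siegelD(1)[OF assms(1)]
  let ?c = "Complex 0 (\<bar>t\<bar> + 1 + map_vec Im w \<bullet> (minv (map_mat Im Z) *\<^sub>v map_vec Im w))"
  have height: "height (Suc q) (bordered Z w ?c) = \<bar>t\<bar> + 1"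
    by (simp add: height_bordered[OF Z assms(2)])
  show "height (Suc q) (bordered Z w ?c) > t" unfolding height by simp
  show "siegel (Suc q) (bordered Z w ?c)"
    unfolding siegel_bordered_iff[OF Z assms(2)] height using assms(1) by simp
qed

text \<open>The last column of \<open>h\<close> times the frame of \<open>bordered Z w c\<close>, up to the contribution of \<open>c\<close>.\<close>

definition border_image :: "nat \<Rightarrow> real mat \<Rightarrow> complex vec \<Rightarrow> nat \<Rightarrow> complex" where
  "border_image q h w i = (\<Sum>k<q. of_real (h $$ (i, k)) * w $ k) + of_real (h $$ (i, Suc (2*q)))"

lemma index_cplx_mult_frame_bordered:
  assumes h: "dim_col h = 2 * Suc q" and w: "dim_vec w = q" and i: "i < dim_row h"
  shows "j < q \<Longrightarrow> (cplx h * frame (bordered Z w c)) $$ (i, j)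
      = (\<Sum>k<q. of_real (h $$ (i, k)) * Z $$ (k, j)) + of_real (h $$ (i, q)) * w $ j
        + of_real (h $$ (i, Suc q + j))"
    "(cplx h * frame (bordered Z w c)) $$ (i, q) = border_image q h w i + of_real (h $$ (i, q)) * c"
proof -
  have entry: "(cplx h * frame (bordered Z w c)) $$ (i, j)
      = (\<Sum>k<Suc q. of_real (h $$ (i, k)) * bordered Z w c $$ (k, j))
        + of_real (h $$ (i, Suc q + j))"
    if j: "j < Suc q" for j
  proof -
    have "(cplx h * frame (bordered Z w c)) $$ (i, j)
      = (\<Sum>k<Suc q + Suc q. of_real (h $$ (i, k)) * frame (bordered Z w c) $$ (k, j))"
      using h w i j by (subst index_mult_mat_sum) auto
    also have "\<dots> = (\<Sum>k<Suc q. of_real (h $$ (i, k)) * bordered Z w c $$ (k, j))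
        + (\<Sum>k<Suc q. if k = j then of_real (h $$ (i, Suc q + k)) else 0)"
      unfolding sum_lessThan_add frame_def using w j
      by (intro arg_cong2[of _ _ _ _ "(+)"] sum.cong) (auto simp: index_append_rows)
    finally show ?thesis using j by simp
  qed
  show "j < q \<Longrightarrow> (cplx h * frame (bordered Z w c)) $$ (i, j)
      = (\<Sum>k<q. of_real (h $$ (i, k)) * Z $$ (k, j)) + of_real (h $$ (i, q)) * w $ j
        + of_real (h $$ (i, Suc q + j))"
    using entry[of j] w by simp
  show "(cplx h * frame (bordered Z w c)) $$ (i, q)
    = border_image q h w i + of_real (h $$ (i, q)) * c"
    using entry[of q] w unfolding border_image_def by (simp add: mult_2)
qed

lemma sp_act_index:
  assumes g: "is_Sp n g" and W: "siegel n W" and ij: "i < n" "j < n"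
  shows "(cplx g * frame W) $$ (i, j)
      = (\<Sum>k<n. sp_act n g W $$ (i, k) * (cplx g * frame W) $$ (n + k, j))"
proof -
  note V = siegelD[OF siegel_sp_act[OF g W]]
  have F: "cplx g * frame W = (sp_act n g W * automorphy n g W) @\<^sub>r automorphy n g W"
    unfolding sp_act_frame(1)[OF g W] using V by (simp add: frame_mult)
  show ?thesis unfolding F using ij V
    by (simp add: index_append_rows index_mult_mat_sum del: index_mult_mat(1))
qed

lemma sp_act_eqI_index:
  assumes g: "is_Sp n g" and W: "siegel n W" and V: "V \<in> carrier_mat n n"
    and eq: "\<And>i j. i < n \<Longrightarrow> j < n
      \<Longrightarrow> (cplx g * frame W) $$ (i, j) = (\<Sum>k<n. V $$ (i, k) * (cplx g * frame W) $$ (n + k, j))"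
  shows "sp_act n g W = V"
proof (rule sp_act_eqI[OF g W V])
  let ?K = "mat n n (\<lambda>(i,j). (cplx g * frame W) $$ (n + i, j))"
  show "?K \<in> carrier_mat n n" by simp
  show "cplx g * frame W = frame V * ?K"
  proof (rule eq_matI)
    fix i j assume "i < dim_row (frame V * ?K)" "j < dim_col (frame V * ?K)"
    then have ij: "i < n + n" "j < n" using V by auto
    show "(cplx g * frame W) $$ (i, j) = (frame V * ?K) $$ (i, j)"
      using ij V eq[of i j]
      by (simp add: frame_mult index_append_rows index_mult_mat_sum del: index_mult_mat(1))
  qed (use siegelD[OF W] is_SpD[OF g] V in auto)
qed

lemma index_levi_proj_mult_frame:
  assumes h: "parabolic q h" and Z: "Z \<in> carrier_mat q q" and w: "dim_vec w = q"
    and r: "r < 2*q" and j: "j < q"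
  shows "(cplx h * frame (bordered Z w c)) $$ (levi_index q r, j)
    = (cplx (levi_proj (Suc q) h) * frame Z) $$ (r, j)"
proof -
  note p = parabolicD[OF h] and bound = levi_index_bounds(1)[OF r]
  let ?l = "levi_proj (Suc q) h"
  have "(cplx ?l * frame Z) $$ (r, j) = (\<Sum>k<q + q. of_real (?l $$ (r, k)) * frame Z $$ (k, j))"
    using Z r j by (subst index_mult_mat_sum) auto
  also have "\<dots> = (\<Sum>k<q. of_real (h $$ (levi_index q r, k)) * Z $$ (k, j))
      + (\<Sum>k<q. if k = j then of_real (h $$ (levi_index q r, Suc q + k)) else 0)"
    unfolding sum_lessThan_add frame_def using Z r j
    by (intro arg_cong2[of _ _ _ _ "(+)"] sum.cong)
      (auto simp: index_append_rows, auto simp: levi_index_def)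
  finally show ?thesis
    using index_cplx_mult_frame_bordered(1)[OF p(3) w _ j, of "levi_index q r"] p(2)
      p(4)[OF bound] bound j
    by simp
qed

lemma parabolic_last_diag_nonzero:
  "is_Sp (Suc q) h \<Longrightarrow> parabolic q h \<Longrightarrow> h $$ (Suc (2*q), Suc (2*q)) \<noteq> 0"
  using Sp_stab_parabolic(2)[OF _ stab_bc_if_parabolic] by fastforce

definition fibre_border :: "nat \<Rightarrow> real mat \<Rightarrow> complex mat \<Rightarrow> complex vec \<Rightarrow> complex vec" where
  "fibre_border q h Z w
    = vec q (\<lambda>i. (border_image q h w i - (\<Sum>k<q. Z $$ (i, k) * border_image q h w (Suc q + k)))
    / of_real (h $$ (Suc (2*q), Suc (2*q))))"

definition fibre_corner :: "nat \<Rightarrow> real mat \<Rightarrow> complex vec \<Rightarrow> complex vec \<Rightarrow> complex \<Rightarrow> complex" where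
  "fibre_corner q h w w' c = (border_image q h w q + of_real (h $$ (q, q)) * c
    - (\<Sum>k<q. w' $ k * border_image q h w (Suc q + k))) / of_real (h $$ (Suc (2*q), Suc (2*q)))"

lemma index_cplx_mult_frame_parabolic:
  assumes h: "parabolic q h" and w: "dim_vec w = q"
  shows "j < q \<Longrightarrow> (cplx h * frame (bordered Z w c)) $$ (Suc (2*q), j) = 0"
    "(cplx h * frame (bordered Z w c)) $$ (Suc (2*q), q) = of_real (h $$ (Suc (2*q), Suc (2*q)))"
    "i < 2 * Suc q \<Longrightarrow> i \<noteq> q \<Longrightarrow> (cplx h * frame (bordered Z w c)) $$ (i, q) = border_image q h w i"
proof -
  note hd = parabolicD[OF h]
  note entry = index_cplx_mult_frame_bordered[OF hd(3), where w = w and Z = Z and c = c]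
  have last_row: "h $$ (Suc (2*q), j) = 0" if "j < Suc (2*q)" for j using hd(5)[of j] that by simp
  show "j < q \<Longrightarrow> (cplx h * frame (bordered Z w c)) $$ (Suc (2*q), j) = 0"
    using entry(1)[of "Suc (2*q)" j] hd(2) w last_row by simp
  show "(cplx h * frame (bordered Z w c)) $$ (Suc (2*q), q) = of_real (h $$ (Suc (2*q), Suc (2*q)))"
    using entry(2)[of "Suc (2*q)"] hd(2) w last_row unfolding border_image_def by simp
  show "i < 2 * Suc q \<Longrightarrow> i \<noteq> q
      \<Longrightarrow> (cplx h * frame (bordered Z w c)) $$ (i, q) = border_image q h w i"
    using entry(2)[of i] hd(2) hd(4)[of i] w by simp
qed

lemma sp_act_bordered_index:
  assumes h: "is_Sp (Suc q) h" and W: "siegel (Suc q) (bordered Z w c)"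
    and image: "sp_act (Suc q) h (bordered Z w c) = bordered V v e" and ij: "i < Suc q" "j < Suc q"
  defines "F \<equiv> cplx h * frame (bordered Z w c)"
  shows "F $$ (i, j) = (\<Sum>k<q. bordered V v e $$ (i, k) * F $$ (Suc q + k, j))
    + bordered V v e $$ (i, q) * F $$ (Suc (2*q), j)"
  using sp_act_index[OF h W ij] unfolding image F_def by (simp add: mult_2)

lemma sp_act_bordered_leading:
  assumes h: "is_Sp (Suc q) h" and p: "parabolic q h" and W: "siegel (Suc q) (bordered Z w c)"
    and Z: "Z \<in> carrier_mat q q" and w: "w \<in> carrier_vec q"
    and V: "V \<in> carrier_mat q q" and v: "v \<in> carrier_vec q"
    and image: "sp_act (Suc q) h (bordered Z w c) = bordered V v e"
  shows "sp_act q (levi_proj (Suc q) h) Z = V"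
proof (rule sp_act_eqI_index[OF levi_proj_Sp[OF h p] _ V])
  show "siegel q Z" using W unfolding siegel_bordered_iff[OF Z w] by simp
  fix i j assume ij: "i < q" "j < q"
  have [simp]: "dim_vec w = q" "dim_vec v = q" using w v by auto
  let ?F = "cplx h * frame (bordered Z w c)" and ?G = "cplx (levi_proj (Suc q) h) * frame Z"
  have levi: "?F $$ (levi_index q r, j) = ?G $$ (r, j)" if "r < 2*q" for r
    by (rule index_levi_proj_mult_frame[OF p Z _ that ij(2)]) simp
  have "?F $$ (i, j) = (\<Sum>k<q. V $$ (i, k) * ?F $$ (Suc q + k, j))"
    using sp_act_bordered_index[OF h W image, of i j] ij
      index_cplx_mult_frame_parabolic(1)[OF p _ ij(2)]
    by (simp del: index_mult_mat(1))
  moreover have "?F $$ (Suc q + k, j) = ?G $$ (q + k, j)" if "k < q" for k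
    using levi[of "q + k"] that by (simp add: levi_index_def del: index_mult_mat(1))
  moreover have "?F $$ (i, j) = ?G $$ (i, j)"
    using levi[of i] ij by (simp add: levi_index_def del: index_mult_mat(1))
  ultimately show "?G $$ (i, j) = (\<Sum>k<q. V $$ (i, k) * ?G $$ (q + k, j))"
    by (simp del: index_mult_mat(1))
qed

lemma dim_fibre_border [simp]: "dim_vec (fibre_border q h Z w) = q"
  unfolding fibre_border_def by simp

lemma sp_act_bordered_last_column:
  assumes h: "is_Sp (Suc q) h" and p: "parabolic q h" and W: "siegel (Suc q) (bordered Z w c)"
    and w: "w \<in> carrier_vec q" and v: "v \<in> carrier_vec q"
    and image: "sp_act (Suc q) h (bordered Z w c) = bordered V v e"
  shows "i < q \<Longrightarrow> border_image q h w i = (\<Sum>k<q. V $$ (i, k) * border_image q h w (Suc q + k))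
      + v $ i * of_real (h $$ (Suc (2*q), Suc (2*q)))"
    "border_image q h w q + of_real (h $$ (q, q)) * c
      = (\<Sum>k<q. v $ k * border_image q h w (Suc q + k)) + e * of_real (h $$ (Suc (2*q), Suc (2*q)))"
proof -
  note hd = parabolicD(2,3)[OF p]
  have [simp]: "dim_vec w = q" "dim_vec v = q" using w v by auto
  let ?F = "cplx h * frame (bordered Z w c)"
  note equation = sp_act_bordered_index[OF h W image]
  have corner: "?F $$ (Suc (2*q), q) = of_real (h $$ (Suc (2*q), Suc (2*q)))"
    by (rule index_cplx_mult_frame_parabolic(2)[OF p]) simp
  have border: "?F $$ (i, q) = border_image q h w i" if "i < 2 * Suc q" "i \<noteq> q" for i
    by (rule index_cplx_mult_frame_parabolic(3)[OF p _ that]) simp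
  have sum: "(\<Sum>k<q. a k * ?F $$ (Suc q + k, q)) = (\<Sum>k<q. a k * border_image q h w (Suc q + k))"
    for a
    by (intro sum.cong refl arg_cong2[of _ _ _ _ "(*)"] border) auto
  show "border_image q h w i = (\<Sum>k<q. V $$ (i, k) * border_image q h w (Suc q + k))
      + v $ i * of_real (h $$ (Suc (2*q), Suc (2*q)))" if "i < q"
    using equation[of i q] corner border[of i] sum[of "\<lambda>k. V $$ (i, k)"] that
    by (simp del: index_mult_mat(1))
  have "?F $$ (q, q) = border_image q h w q + of_real (h $$ (q, q)) * c"
    by (rule index_cplx_mult_frame_bordered(2)) (use hd in auto)
  then show "border_image q h w q + of_real (h $$ (q, q)) * c
      = (\<Sum>k<q. v $ k * border_image q h w (Suc q + k)) + e * of_real (h $$ (Suc (2*q), Suc (2*q)))"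
    using equation[of q q] corner sum[of "\<lambda>k. v $ k"] by (simp del: index_mult_mat(1))
qed

lemma sp_act_bordered:
  assumes h: "is_Sp (Suc q) h" and p: "parabolic q h" and W: "siegel (Suc q) (bordered Z w c)"
    and Z: "Z \<in> carrier_mat q q" and w: "w \<in> carrier_vec q"
    and Z': "Z' = sp_act q (levi_proj (Suc q) h) Z"
  shows "sp_act (Suc q) h (bordered Z w c)
    = bordered Z' (fibre_border q h Z' w) (fibre_corner q h w (fibre_border q h Z' w) c)"
proof -
  obtain V v e where V: "V \<in> carrier_mat q q" and v: "v \<in> carrier_vec q"
    and image: "sp_act (Suc q) h (bordered Z w c) = bordered V v e"
    using siegel_eq_bordered[OF siegel_sp_act[OF h W]] by metis
  note column = sp_act_bordered_last_column[OF h p W w v image]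
  have d: "h $$ (Suc (2*q), Suc (2*q)) \<noteq> 0" by (rule parabolic_last_diag_nonzero[OF h p])
  have V_eq: "V = Z'" using sp_act_bordered_leading[OF h p W Z w V v image] Z' by simp
  have "v = fibre_border q h Z' w"
    unfolding fibre_border_def using column(1) d v unfolding V_eq
    by (intro eq_vecI) (auto simp: field_simps)
  moreover have "e = fibre_corner q h w v c"
    unfolding fibre_corner_def using column(2) d by (simp add: field_simps)
  ultimately show ?thesis unfolding image V_eq by simp
qed

lemma border_image_midpoint:
  assumes "w1 \<in> carrier_vec q" "w2 \<in> carrier_vec q"
  shows "border_image q h ((1/2) \<cdot>\<^sub>v (w1 + w2)) i
      = (border_image q h w1 i + border_image q h w2 i) / 2"
proof -
  have "(\<Sum>k<q. of_real (h $$ (i, k)) * ((1/2) \<cdot>\<^sub>v (w1 + w2)) $ k)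
    = ((\<Sum>k<q. of_real (h $$ (i, k)) * w1 $ k) + (\<Sum>k<q. of_real (h $$ (i, k)) * w2 $ k)) / 2"
    unfolding sum.distrib[symmetric] sum_divide_distrib
    by (intro sum.cong) (use assms in \<open>auto simp: algebra_simps\<close>)
  then show ?thesis unfolding border_image_def by (simp add: add_divide_distrib)
qed

lemma fibre_border_midpoint:
  assumes "w1 \<in> carrier_vec q" "w2 \<in> carrier_vec q"
  shows "fibre_border q h Z ((1/2) \<cdot>\<^sub>v (w1 + w2))
    = (1/2) \<cdot>\<^sub>v (fibre_border q h Z w1 + fibre_border q h Z w2)"
proof (rule eq_vecI)
  fix i assume "i < dim_vec ((1/2) \<cdot>\<^sub>v (fibre_border q h Z w1 + fibre_border q h Z w2))"
  then have i: "i < q" by simp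
  have "(\<Sum>k<q. Z $$ (i, k)
      * ((border_image q h w1 (Suc q + k) + border_image q h w2 (Suc q + k)) / 2))
    = ((\<Sum>k<q. Z $$ (i, k) * border_image q h w1 (Suc q + k))
      + (\<Sum>k<q. Z $$ (i, k) * border_image q h w2 (Suc q + k))) / 2"
    unfolding sum.distrib[symmetric] sum_divide_distrib
    by (intro sum.cong) (auto simp: algebra_simps)
  then show "fibre_border q h Z ((1/2) \<cdot>\<^sub>v (w1 + w2)) $ i
    = ((1/2) \<cdot>\<^sub>v (fibre_border q h Z w1 + fibre_border q h Z w2)) $ i"
    unfolding fibre_border_def using i
    by (simp add: border_image_midpoint[OF assms] add_divide_distrib diff_divide_distrib
        mult.commute)
qed simp

lemma fibre_corner_midpoint:
  "fibre_corner q h w w' ((c + e) / 2) = (fibre_corner q h w w' c + fibre_corner q h w w' e) / 2"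
  unfolding fibre_corner_def
  by (simp add: add_divide_distrib diff_divide_distrib distrib_left mult.commute)

lemma tau_sp_act_involution:
  assumes h: "is_Sp n h" and inv: "tau_g n h * h = 1\<^sub>m (2*n)" and W: "siegel n W"
  shows "tau_pt (sp_act n h (tau_pt (sp_act n h W))) = W"
proof -
  note hW = siegel_sp_act[OF h W]
  have "tau_pt (sp_act n h (tau_pt (sp_act n h W))) = sp_act n (tau_g n h) (sp_act n h W)"
    using sp_act_tau[OF h siegel_tau_pt[OF hW]] by simp
  also have "\<dots> = sp_act n (tau_g n h * h) W"
    by (rule sp_act_mult[OF is_Sp_tau_g[OF h] h W, symmetric])
  finally show ?thesis unfolding inv sp_act_one[OF W] .
qed

definition reflected_border :: "nat \<Rightarrow> real mat \<Rightarrow> complex mat \<Rightarrow> complex vec \<Rightarrow> complex vec" where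
  "reflected_border q h Z w = map_vec (\<lambda>z. - cnj z) (fibre_border q h (tau_pt Z) w)"

definition reflected_corner ::
  "nat \<Rightarrow> real mat \<Rightarrow> complex mat \<Rightarrow> complex vec \<Rightarrow> complex \<Rightarrow> complex" where
  "reflected_corner q h Z w c = - cnj (fibre_corner q h w (fibre_border q h (tau_pt Z) w) c)"

lemma reflected_border_carrier [simp]: "reflected_border q h Z w \<in> carrier_vec q"
  unfolding reflected_border_def by (auto intro: carrier_vecI)

lemma reflected_border_midpoint:
  assumes "w1 \<in> carrier_vec q" "w2 \<in> carrier_vec q"
  shows "reflected_border q h Z ((1/2) \<cdot>\<^sub>v (w1 + w2))
    = (1/2) \<cdot>\<^sub>v (reflected_border q h Z w1 + reflected_border q h Z w2)"
  unfolding reflected_border_def fibre_border_midpoint[OF assms]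
  by (intro eq_vecI) (auto simp: field_simps)

lemma reflected_corner_midpoint:
  "reflected_corner q h Z w ((c + e) / 2)
    = (reflected_corner q h Z w c + reflected_corner q h Z w e) / 2"
  unfolding reflected_corner_def fibre_corner_midpoint by (simp add: field_simps)

lemma tau_sp_act_bordered:
  assumes h: "is_Sp (Suc q) h" and p: "parabolic q h" and W: "siegel (Suc q) (bordered Z w c)"
    and Z: "Z \<in> carrier_mat q q" and w: "w \<in> carrier_vec q"
    and fixed: "sp_act q (levi_proj (Suc q) h) Z = tau_pt Z"
  shows "tau_pt (sp_act (Suc q) h (bordered Z w c))
    = bordered Z (reflected_border q h Z w) (reflected_corner q h Z w c)"
proof -
  have "tau_pt (bordered (tau_pt Z) v e) = bordered Z (map_vec (\<lambda>z. - cnj z) v) (- cnj e)"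
    if "dim_vec v = q" for v e
    using that Z tau_pt_tau_pt[of Z] unfolding tau_pt_def by (simp add: map_mat_bordered)
  then show ?thesis
    unfolding sp_act_bordered[OF h p W Z w refl] fixed reflected_border_def reflected_corner_def
    by simp
qed

lemma reflected_involution:
  assumes h: "is_Sp (Suc q) h" and p: "parabolic q h"
    and inv: "tau_g (Suc q) h * h = 1\<^sub>m (2 * Suc q)"
    and W: "siegel (Suc q) (bordered Z w c)" and Z: "Z \<in> carrier_mat q q" and w: "w \<in> carrier_vec q"
    and fixed: "sp_act q (levi_proj (Suc q) h) Z = tau_pt Z"
  shows "siegel (Suc q) (bordered Z (reflected_border q h Z w) (reflected_corner q h Z w c))"
    "reflected_border q h Z (reflected_border q h Z w) = w"
    "reflected_corner q h Z (reflected_border q h Z w) (reflected_corner q h Z w c) = c"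
proof -
  note act = tau_sp_act_bordered[OF h p _ Z _ fixed]
  show image: "siegel (Suc q) (bordered Z (reflected_border q h Z w) (reflected_corner q h Z w c))"
    using siegel_tau_pt[OF siegel_sp_act[OF h W]] unfolding act[OF W w] .
  have "bordered Z (reflected_border q h Z (reflected_border q h Z w))
      (reflected_corner q h Z (reflected_border q h Z w) (reflected_corner q h Z w c))
    = bordered Z w c"
    using tau_sp_act_involution[OF h inv W]
    unfolding act[OF W w] act[OF image reflected_border_carrier] .
  from bordered_inject(2,3)[OF this Z Z reflected_border_carrier w]
  show "reflected_border q h Z (reflected_border q h Z w) = w"
    "reflected_corner q h Z (reflected_border q h Z w) (reflected_corner q h Z w c) = c" .
qed

lemma parabolic_involution_fixed_point:
  assumes h: "is_Sp (Suc q) h" and p: "parabolic q h"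
    and inv: "tau_g (Suc q) h * h = 1\<^sub>m (2 * Suc q)"
    and Z: "siegel q Z" and fixed: "sp_act q (levi_proj (Suc q) h) Z = tau_pt Z"
  obtains w c where "w \<in> carrier_vec q" "siegel (Suc q) (bordered Z w c)"
    "height (Suc q) (bordered Z w c) > t"
    "sp_act (Suc q) h (bordered Z w c) = tau_pt (bordered Z w c)"
proof -
  note Zc = siegelD(1)[OF Z]
  let ?b = "reflected_border q h Z" and ?c = "reflected_corner q h Z"
  note involution = reflected_involution[OF h p inv _ Zc _ fixed]
  define w where "w = (1/2) \<cdot>\<^sub>v (0\<^sub>v q + ?b (0\<^sub>v q))"
  have w: "w \<in> carrier_vec q" unfolding w_def by simp
  obtain c0 where "siegel (Suc q) (bordered Z (0\<^sub>v q) c0)"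
    using siegel_bordered_exists[OF Z zero_carrier_vec] by metis
  then have "?b (?b (0\<^sub>v q)) = 0\<^sub>v q" by (rule involution(2)) simp
  then have "?b w = (1/2) \<cdot>\<^sub>v (?b (0\<^sub>v q) + 0\<^sub>v q)"
    unfolding w_def by (subst reflected_border_midpoint) auto
  then have fixed_border: "?b w = w"
    unfolding w_def by (simp add: comm_add_vec[OF reflected_border_carrier zero_carrier_vec])
  obtain c where c: "siegel (Suc q) (bordered Z w c)" "height (Suc q) (bordered Z w c) > 2 * \<bar>t\<bar>"
    using siegel_bordered_exists[OF Z w] by metis
  define e where "e = (c + ?c w c) / 2"
  have "?c w (?c w c) = c" using involution(3)[OF c(1) w] unfolding fixed_border .
  then have fixed_corner: "?c w e = e"
    unfolding e_def by (simp add: reflected_corner_midpoint add.commute)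
  have "height (Suc q) (bordered Z w (?c w c)) > 0"
    using involution(1)[OF c(1) w] unfolding fixed_border siegel_bordered_iff[OF Zc w] by simp
  then have height: "height (Suc q) (bordered Z w e) > \<bar>t\<bar>"
    using c(2) unfolding height_bordered[OF Zc w] e_def by (simp add: field_simps)
  then have siegel: "siegel (Suc q) (bordered Z w e)"
    unfolding siegel_bordered_iff[OF Zc w] using Z by linarith
  have "tau_pt (tau_pt (sp_act (Suc q) h (bordered Z w e))) = tau_pt (bordered Z w e)"
    unfolding tau_sp_act_bordered[OF h p siegel Zc w fixed] fixed_border fixed_corner ..
  then show ?thesis using that[OF w siegel] height by simp
qed

subsection \<open>Inverse square roots of unipotent matrices\<close>

definition quadratic_mat :: "nat \<Rightarrow> real \<Rightarrow> real \<Rightarrow> real mat \<Rightarrow> real mat" where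
  "quadratic_mat n a b N = 1\<^sub>m n + a \<cdot>\<^sub>m N + b \<cdot>\<^sub>m (N * N)"

text \<open>The truncated binomial series of \<open>(1 + N)\<^sup>-\<^sup>1\<^sup>/\<^sup>2\<close>, exact when \<open>N\<^sup>3 = 0\<close>.\<close>

definition inv_sqrt_unipotent :: "real mat \<Rightarrow> real mat" where
  "inv_sqrt_unipotent u = quadratic_mat (dim_row u) (-1/2) (3/8) (u - 1\<^sub>m (dim_row u))"

definition cube_unipotent :: "nat \<Rightarrow> real mat \<Rightarrow> bool" where
  "cube_unipotent n u \<longleftrightarrow> u \<in> carrier_mat n n
    \<and> (u - 1\<^sub>m n) * ((u - 1\<^sub>m n) * (u - 1\<^sub>m n)) = 0\<^sub>m n n"

lemma dim_inv_sqrt_unipotent [simp]: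
  "dim_row (inv_sqrt_unipotent u) = dim_row u"
  "dim_col u = dim_row u \<Longrightarrow> dim_col (inv_sqrt_unipotent u) = dim_row u"
  unfolding inv_sqrt_unipotent_def quadratic_mat_def by auto

lemma quadratic_mat_mult:
  assumes N: "N \<in> carrier_mat n n" "N * (N * N) = 0\<^sub>m n n"
  shows "quadratic_mat n a b N * quadratic_mat n c d N = quadratic_mat n (a + c) (b + d + a * c) N"
proof -
  have [simp]: "dim_row N = n" "dim_col N = n" using N by auto
  have N4: "N * (N * (N * N)) = 0\<^sub>m n n" unfolding N(2) by (simp add: zero_mult_mat_dim)
  have "quadratic_mat n a b N * quadratic_mat n c d N
    = (1\<^sub>m n + a \<cdot>\<^sub>m N + b \<cdot>\<^sub>m (N * N)) + c \<cdot>\<^sub>m (N + a \<cdot>\<^sub>m (N * N) + b \<cdot>\<^sub>m (N * (N * N)))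
      + d \<cdot>\<^sub>m (N * N + a \<cdot>\<^sub>m (N * (N * N)) + b \<cdot>\<^sub>m (N * (N * (N * N))))"
    unfolding quadratic_mat_def by (simp add: mat_dim_simps)
  also have "\<dots> = quadratic_mat n (a + c) (b + d + a * c) N"
    unfolding N(2) N4 quadratic_mat_def
    by (intro eq_matI) (auto simp: algebra_simps simp del: index_mult_mat(1))
  finally show ?thesis .
qed

lemma quadratic_mat_zero: "N \<in> carrier_mat n n \<Longrightarrow> quadratic_mat n 0 0 N = 1\<^sub>m n"
  unfolding quadratic_mat_def by (intro eq_matI) (auto simp del: index_mult_mat(1))

lemma cube_unipotentD:
  assumes "cube_unipotent n u"
  shows "u - 1\<^sub>m n \<in> carrier_mat n n" "(u - 1\<^sub>m n) * ((u - 1\<^sub>m n) * (u - 1\<^sub>m n)) = 0\<^sub>m n n"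
    "u = quadratic_mat n 1 0 (u - 1\<^sub>m n)"
    "inv_sqrt_unipotent u = quadratic_mat n (-1/2) (3/8) (u - 1\<^sub>m n)"
  using assms unfolding cube_unipotent_def quadratic_mat_def inv_sqrt_unipotent_def
  by (auto intro!: eq_matI minus_carrier_mat simp del: index_mult_mat(1))

lemma inv_sqrt_unipotent_square:
  assumes "cube_unipotent n u"
  shows "u * (inv_sqrt_unipotent u * inv_sqrt_unipotent u) = 1\<^sub>m n"
proof -
  note N = cube_unipotentD[OF assms]
  have "inv_sqrt_unipotent u * inv_sqrt_unipotent u = quadratic_mat n (-1) 1 (u - 1\<^sub>m n)"
    unfolding N(4) quadratic_mat_mult[OF N(1,2)] by simp
  then have "u * (inv_sqrt_unipotent u * inv_sqrt_unipotent u)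
    = quadratic_mat n 1 0 (u - 1\<^sub>m n) * quadratic_mat n (-1) 1 (u - 1\<^sub>m n)"
    unfolding N(3)[symmetric] by simp
  then show ?thesis
    unfolding quadratic_mat_mult[OF N(1,2)] using quadratic_mat_zero[OF N(1)] by simp
qed

lemma inv_sqrt_unipotent_intertwine:
  assumes u: "u \<in> carrier_mat n n" and v: "v \<in> carrier_mat n n" and g: "g \<in> carrier_mat n n"
    and eq: "v * g = g * u"
  shows "inv_sqrt_unipotent v * g = g * inv_sqrt_unipotent u"
proof -
  have [simp]: "dim_row u = n" "dim_col u = n" "dim_row v = n" "dim_col v = n" "dim_row g = n"
    "dim_col g = n"
    using u v g by auto
  define N M where "N = u - 1\<^sub>m n" and "M = v - 1\<^sub>m n"
  have [simp]: "dim_row N = n" "dim_col N = n" "dim_row M = n" "dim_col M = n"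
    unfolding N_def M_def by auto
  have Mg: "M * g = g * N" unfolding M_def N_def using eq by (simp add: mat_dim_simps)
  have "M * (M * g) = (M * g) * N" unfolding Mg by (simp add: assoc_mult_mat_dim Mg[symmetric])
  then have "M * (M * g) = g * (N * N)" unfolding Mg by (simp add: assoc_mult_mat_dim)
  then show ?thesis
    unfolding inv_sqrt_unipotent_def quadratic_mat_def
    using Mg by (simp add: mat_dim_simps N_def M_def)
qed

lemma is_Sp_inv_sqrt_unipotent:
  assumes u: "is_Sp n u" and cube: "cube_unipotent (2*n) u"
  shows "is_Sp n (inv_sqrt_unipotent u)"
proof -
  define N where "N = u - 1\<^sub>m (2*n)"
  note N = cube_unipotentD[OF cube, folded N_def]
  note mult = quadratic_mat_mult[OF N(1,2)]
  have [simp]: "dim_row N = 2*n" "dim_col N = 2*n" using N(1) by auto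
  have "sp_adj n u = sp_adj n u * (u * quadratic_mat (2*n) (-1) 1 N)"
    by (subst (2) N(3)) (simp add: mult quadratic_mat_zero N(1) one_mult_mat_dim)
  also have "\<dots> = quadratic_mat (2*n) (-1) 1 N"
    by (rule is_Sp_sp_adj_cancel(1)[OF u]) (simp add: quadratic_mat_def)
  finally have adj_u: "sp_adj n u = quadratic_mat (2*n) (-1) 1 N" .
  have adj_N: "sp_adj n N = (-1) \<cdot>\<^sub>m N + N * N"
  proof -
    have "sp_adj n u = 1\<^sub>m (2*n) + sp_adj n N"
      by (subst N(3))
        (simp add: quadratic_mat_def sp_adj_add sp_adj_smult sp_adj_one, intro eq_matI; simp)
    then show ?thesis unfolding adj_u quadratic_mat_def
      by (auto simp: mat_eq_iff simp del: index_mult_mat(1))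
  qed
  have N4: "N * (N * (N * N)) = 0\<^sub>m (2*n) (2*n)" unfolding N(2) by (simp add: zero_mult_mat_dim)
  have adj_NN: "sp_adj n (N * N) = N * N"
    unfolding sp_adj_mult[of N n N, simplified] adj_N
    by (simp add: mat_dim_simps N(2) N4) (intro eq_matI; simp del: index_mult_mat(1))
  have "sp_adj n (inv_sqrt_unipotent u) = quadratic_mat (2*n) (1/2) (-1/8) N"
    unfolding N(4) quadratic_mat_def
    by (simp add: sp_adj_add sp_adj_smult sp_adj_one adj_NN adj_N)
      (intro eq_matI; simp add: algebra_simps del: index_mult_mat(1))
  then have "sp_adj n (inv_sqrt_unipotent u) * inv_sqrt_unipotent u = 1\<^sub>m (2*n)"
    unfolding N(4) using mult quadratic_mat_zero[OF N(1)] by simp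
  then show ?thesis unfolding is_Sp_iff_sp_adj using is_SpD[OF u] by (auto intro: carrier_matI)
qed

text \<open>The cocycle \<open>u = \<tau>(\<gamma>)\<gamma>\<close> is killed by its own inverse square root, because \<open>\<tau>(u)\<gamma> = \<gamma>u\<close>.\<close>

lemma tau_inv_sqrt_unipotent_cocycle:
  assumes \<gamma>: "\<gamma> \<in> carrier_mat (2*n) (2*n)" and u: "u = tau_g n \<gamma> * \<gamma>"
    and cube: "cube_unipotent (2*n) u"
  shows "tau_g n (\<gamma> * inv_sqrt_unipotent u) * (\<gamma> * inv_sqrt_unipotent u) = 1\<^sub>m (2*n)"
proof -
  let ?r = "inv_sqrt_unipotent u" and ?T = "Tmat n"
  have [simp]: "dim_row \<gamma> = 2*n" "dim_col \<gamma> = 2*n" using \<gamma> by auto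
  have uc [simp]: "u \<in> carrier_mat (2*n) (2*n)" "dim_row u = 2*n" "dim_col u = 2*n"
    unfolding u by (auto intro: carrier_matI)
  have rc: "?r \<in> carrier_mat (2*n) (2*n)" by (rule carrier_matI) auto
  have tau_u: "tau_g n u * ?T = ?T * u"
    by (simp add: tau_g_eq_Tmat assoc_mult_mat_dim Tmat_Tmat one_mult_mat_dim)
  have "tau_g n ?r = ?T * ?r * ?T" by (rule tau_g_eq_Tmat[OF rc])
  also have "\<dots> = inv_sqrt_unipotent (tau_g n u)"
    unfolding inv_sqrt_unipotent_intertwine[OF uc(1) tau_g_carrier Tmat_carrier tau_u, symmetric]
    by (simp add: assoc_mult_mat_dim Tmat_Tmat one_mult_mat_dim)
  finally have tau_r: "tau_g n ?r = inv_sqrt_unipotent (tau_g n u)" .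
  have "tau_g n u * \<gamma> = \<gamma> * u"
    unfolding u by (simp add: tau_g_mult[OF tau_g_carrier \<gamma>] tau_g_tau_g[OF \<gamma>] assoc_mult_mat_dim)
  from inv_sqrt_unipotent_intertwine[OF uc(1) tau_g_carrier \<gamma> this]
  have "tau_g n ?r * \<gamma> = \<gamma> * ?r" unfolding tau_r .
  then have "tau_g n (\<gamma> * ?r) * (\<gamma> * ?r) = tau_g n \<gamma> * ((\<gamma> * ?r) * ?r)"
    by (simp add: tau_g_mult[OF \<gamma> rc] assoc_mult_mat_dim
        flip: assoc_mult_mat_dim[of "tau_g n ?r" \<gamma>])
  also have "\<dots> = u * (?r * ?r)" unfolding u by (simp add: assoc_mult_mat_dim)
  finally show ?thesis unfolding inv_sqrt_unipotent_square[OF cube] .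
qed

subsection \<open>Integral matrices\<close>

definition integral_mat :: "real mat \<Rightarrow> bool" where
  "integral_mat X \<longleftrightarrow> (\<forall>i<dim_row X. \<forall>j<dim_col X. X $$ (i, j) \<in> \<int>)"

lemma integral_mat_mult:
  "integral_mat X \<Longrightarrow> integral_mat Y \<Longrightarrow> dim_col X = dim_row Y \<Longrightarrow> integral_mat (X * Y)"
  unfolding integral_mat_def by (auto simp: scalar_prod_def intro!: Ints_sum Ints_mult)

lemma integral_mat_add:
  "integral_mat X \<Longrightarrow> integral_mat Y \<Longrightarrow> dim_row X = dim_row Y \<Longrightarrow> dim_col X = dim_col Y
    \<Longrightarrow> integral_mat (X + Y)"
  unfolding integral_mat_def by auto

lemma integral_mat_smult: "c \<in> \<int> \<Longrightarrow> integral_mat X \<Longrightarrow> integral_mat (c \<cdot>\<^sub>m X)"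
  unfolding integral_mat_def by auto

lemma integral_mat_one: "integral_mat (1\<^sub>m n)"
  unfolding integral_mat_def by auto

lemma integral_mat_Tmat: "integral_mat (Tmat n)"
  unfolding integral_mat_def by (auto simp: index_Tmat)

lemma integral_mat_pow: "integral_mat X \<Longrightarrow> X \<in> carrier_mat n n \<Longrightarrow> integral_mat (X ^\<^sub>m j)"
proof (induction j)
  case (Suc j)
  then show ?case using integral_mat_mult[of "X ^\<^sub>m j" X] pow_carrier_mat[of X n j] by auto
qed (simp add: integral_mat_one)

lemma integral_mat_eq_of_int:
  assumes "integral_mat X"
  obtains A :: "int mat" where "X = map_mat of_int A"
proof
  show "X = map_mat of_int (map_mat floor X)"
    using assms unfolding integral_mat_def by (intro eq_matI) auto
qed

lemma eigenvalue_integral_mat_algebraic_int: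
  assumes X: "X \<in> carrier_mat n n" "integral_mat X" and ev: "eigenvalue X a"
  shows "algebraic_int a"
proof -
  obtain A :: "int mat" where A: "X = map_mat of_int A" using integral_mat_eq_of_int[OF X(2)] .
  then have Ac: "A \<in> carrier_mat n n" using X(1) by simp
  have "poly (map_poly of_int (char_poly A)) a = 0"
    using ev eigenvalue_root_char_poly[OF X(1)] unfolding A of_int_hom.char_poly_hom[OF Ac] by simp
  then show ?thesis
    using degree_monic_char_poly[OF Ac] unfolding algebraic_int_altdef_ipoly by metis
qed

lemma eigenvalue_affine:
  fixes A :: "'a::field mat"
  assumes "A \<in> carrier_mat n n" "eigenvalue A x"
  shows "eigenvalue (a \<cdot>\<^sub>m 1\<^sub>m n + b \<cdot>\<^sub>m A) (a + b * x)"
proof -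
  obtain v where v: "v \<in> carrier_vec n" "v \<noteq> 0\<^sub>v n" "A *\<^sub>v v = x \<cdot>\<^sub>v v"
    using assms unfolding eigenvalue_def eigenvector_def by auto
  have smult: "(c \<cdot>\<^sub>m B) *\<^sub>v v = c \<cdot>\<^sub>v (B *\<^sub>v v)" if "B \<in> carrier_mat n n" for B :: "'a mat" and c
    using that v(1) by (intro eq_vecI) auto
  have "(a \<cdot>\<^sub>m 1\<^sub>m n + b \<cdot>\<^sub>m A) *\<^sub>v v = (a \<cdot>\<^sub>m 1\<^sub>m n) *\<^sub>v v + (b \<cdot>\<^sub>m A) *\<^sub>v v"
    by (rule add_mult_distrib_mat_vec) (use assms(1) v(1) in auto)
  also have "\<dots> = (a + b * x) \<cdot>\<^sub>v v"
    using v(1) assms(1) by (simp add: smult v(3)) (auto simp: algebra_simps)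
  finally show ?thesis using v(1,2) assms(1) unfolding eigenvalue_def eigenvector_def by auto
qed

lemma smult_pow_mat:
  fixes A :: "'a::comm_ring_1 mat"
  assumes "A \<in> carrier_mat n n"
  shows "(c \<cdot>\<^sub>m A) ^\<^sub>m k = c ^ k \<cdot>\<^sub>m A ^\<^sub>m k"
proof (induction k)
  case (Suc k)
  then show ?case
    using assms by (simp add: mat_dim_simps) (auto intro!: eq_matI simp del: index_mult_mat(1))
qed (use assms in \<open>auto intro!: eq_matI\<close>)

lemma spectral_radius_less_1_pow_tendsto_zero:
  fixes A :: "complex mat"
  assumes A: "A \<in> carrier_mat n n" and less_1: "spectral_radius A < 1" and ij: "i < n" "j < n"
  shows "(\<lambda>k. (A ^\<^sub>m k) $$ (i, j)) \<longlonglongrightarrow> 0"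
proof -
  have n: "n > 0" using ij by simp
  define \<rho> s where "\<rho> = spectral_radius A" and "s = 2 / (1 + \<rho>)"
  have "0 \<le> \<rho>" using spectral_radius_mem_max(1)[OF A n] unfolding \<rho>_def by auto
  then have s: "s > 1" "s * \<rho> < 1" unfolding s_def using less_1 \<rho>_def by (auto simp: field_simps)
  let ?B = "complex_of_real s \<cdot>\<^sub>m A"
  have B: "?B \<in> carrier_mat n n" using A by simp
  have "spectral_radius ?B < 1"
  proof -
    obtain x where x: "eigenvalue ?B x" "spectral_radius ?B = cmod x"
      using spectral_radius_mem_max(1)[OF B n] unfolding spectrum_def by auto
    have "0 \<cdot>\<^sub>m 1\<^sub>m n + (1 / complex_of_real s) \<cdot>\<^sub>m ?B = A" using A s(1) by (intro eq_matI) auto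
    then have "eigenvalue A (x / s)"
      using eigenvalue_affine[OF B x(1), of 0 "1 / complex_of_real s"] by simp
    then have "cmod (x / s) \<le> \<rho>"
      using spectral_radius_mem_max(2)[OF A n] unfolding \<rho>_def spectrum_def by simp
    then show ?thesis using s x(2) by (simp add: norm_divide field_simps)
  qed
  then obtain c where c: "\<And>k. norm_bound (?B ^\<^sub>m k) c"
    using spectral_radius_jnf_norm_bound_less_1_upper_triangular[OF B] by auto
  have bound: "cmod ((A ^\<^sub>m k) $$ (i, j)) \<le> c * (1 / s) ^ k" for k
  proof -
    have "cmod ((?B ^\<^sub>m k) $$ (i, j)) \<le> c"
      using c[of k] ij carrier_matD[OF A] unfolding norm_bound_def by auto
    then have "s ^ k * cmod ((A ^\<^sub>m k) $$ (i, j)) \<le> c"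
      using ij A s(1) unfolding smult_pow_mat[OF A] by (simp add: norm_mult norm_power)
    then show ?thesis using s(1) by (simp add: field_simps)
  qed
  have "(\<lambda>k. (1 / s) ^ k) \<longlonglongrightarrow> 0" using s(1) by (intro LIMSEQ_power_zero) simp
  then have "(\<lambda>k. c * (1 / s) ^ k) \<longlonglongrightarrow> 0" by (rule tendsto_mult_right_zero)
  then show ?thesis by (rule Lim_null_comparison[rotated]) (simp add: bound)
qed

lemma integral_mat_nilpotent:
  assumes X: "X \<in> carrier_mat n n" "integral_mat X"
    and ev: "\<And>x. eigenvalue (cplx X) x \<Longrightarrow> cmod x < 1"
  obtains j where "X ^\<^sub>m j = 0\<^sub>m n n"
proof -
  have Xc: "cplx X \<in> carrier_mat n n" using X(1) by simp
  have "\<forall>\<^sub>F k in sequentially. cmod ((cplx X ^\<^sub>m k) $$ (i, j)) < 1" if ij: "i < n" "j < n" for i j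
  proof -
    have "spectral_radius (cplx X) < 1"
      using spectral_radius_mem_max(1)[OF Xc] ij ev unfolding spectrum_def by auto
    from tendsto_norm_zero[OF spectral_radius_less_1_pow_tendsto_zero[OF Xc this ij]]
    show ?thesis by (rule order_tendstoD(2)) simp
  qed
  then have "\<forall>\<^sub>F k in sequentially. \<forall>i\<in>{..<n}. \<forall>j\<in>{..<n}. cmod ((cplx X ^\<^sub>m k) $$ (i, j)) < 1"
    by (intro eventually_ball_finite ballI) auto
  then obtain k where k: "cmod ((cplx X ^\<^sub>m k) $$ (i, j)) < 1" if "i < n" "j < n" for i j
    by (auto simp: eventually_sequentially)
  have Xk: "X ^\<^sub>m k \<in> carrier_mat n n" using X(1) by simp
  have "(X ^\<^sub>m k) $$ (i, j) = 0" if ij: "i < n" "j < n" for i j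
  proof -
    have "\<bar>(X ^\<^sub>m k) $$ (i, j)\<bar> < 1"
      using k[OF ij] carrier_matD[OF X(1)] ij
      unfolding of_real_hom.mat_hom_pow[OF X(1), symmetric] by (auto split: if_splits)
    moreover have "(X ^\<^sub>m k) $$ (i, j) \<in> \<int>"
      using integral_mat_pow[OF X(2,1), of k] carrier_matD[OF X(1)] ij
      unfolding integral_mat_def by auto
    ultimately show ?thesis by (auto elim: Ints_cases)
  qed
  then have "X ^\<^sub>m k = 0\<^sub>m n n" using Xk by (auto simp: mat_eq_iff)
  then show ?thesis by (rule that)
qed

subsection \<open>Congruence subgroups\<close>

lemma Gamma_level_iff:
  "Gamma_level n N g \<longleftrightarrow> is_Sp n g
    \<and> (\<exists>X\<in>carrier_mat (2*n) (2*n). integral_mat X \<and> g = 1\<^sub>m (2*n) + real N \<cdot>\<^sub>m X)"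
  (is "_ \<longleftrightarrow> _ \<and> (\<exists>X\<in>_. ?congruent X)")
proof (intro iffI conjI)
  assume g: "Gamma_level n N g"
  then show Sp: "is_Sp n g" unfolding Gamma_level_def is_Sp_Z_def by simp
  from g have
    "\<forall>i j. \<exists>k::int. i < 2*n \<longrightarrow> j < 2*n \<longrightarrow> g $$ (i,j) - 1\<^sub>m (2*n) $$ (i,j) = real N * of_int k"
    unfolding Gamma_level_def by blast
  then obtain k :: "nat \<Rightarrow> nat \<Rightarrow> int"
    where k: "g $$ (i,j) - 1\<^sub>m (2*n) $$ (i,j) = real N * of_int (k i j)"
      if "i < 2*n" "j < 2*n" for i j
    by metis
  let ?X = "mat (2*n) (2*n) (\<lambda>(i,j). real_of_int (k i j))"
  have "g = 1\<^sub>m (2*n) + real N \<cdot>\<^sub>m ?X"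
  proof (rule eq_matI)
    fix i j assume "i < dim_row (1\<^sub>m (2*n) + real N \<cdot>\<^sub>m ?X)"
      "j < dim_col (1\<^sub>m (2*n) + real N \<cdot>\<^sub>m ?X)"
    then show "g $$ (i, j) = (1\<^sub>m (2*n) + real N \<cdot>\<^sub>m ?X) $$ (i, j)" using k[of i j] by simp
  qed (use is_SpD[OF Sp] in auto)
  then show "\<exists>X\<in>carrier_mat (2*n) (2*n). ?congruent X"
    by (intro bexI[of _ ?X]) (auto simp: integral_mat_def)
next
  assume "is_Sp n g \<and> (\<exists>X\<in>carrier_mat (2*n) (2*n). ?congruent X)"
  then obtain X where Sp: "is_Sp n g" and X: "X \<in> carrier_mat (2*n) (2*n)" "integral_mat X"
    and g: "g = 1\<^sub>m (2*n) + real N \<cdot>\<^sub>m X" by blast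
  have "integral_mat g" unfolding g using X
    by (intro integral_mat_add integral_mat_one integral_mat_smult) auto
  moreover have "\<exists>k::int. g $$ (i,j) - 1\<^sub>m (2*n) $$ (i,j) = real N * of_int k"
    if "i < 2*n" "j < 2*n" for i j
  proof -
    have "X $$ (i, j) \<in> \<int>" using X that unfolding integral_mat_def by auto
    then show ?thesis unfolding g using X(1) that by (elim Ints_cases) auto
  qed
  ultimately show "Gamma_level n N g"
    unfolding Gamma_level_def is_Sp_Z_def integral_mat_def using Sp is_SpD[OF Sp] by auto
qed

lemma Gamma_levelE:
  assumes "Gamma_level n N g"
  obtains X where "is_Sp n g" "X \<in> carrier_mat (2*n) (2*n)" "integral_mat X"
    "g = 1\<^sub>m (2*n) + real N \<cdot>\<^sub>m X"
  using assms unfolding Gamma_level_iff by blast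

lemma Gamma_levelI:
  "is_Sp n g \<Longrightarrow> X \<in> carrier_mat (2*n) (2*n) \<Longrightarrow> integral_mat X \<Longrightarrow> g = 1\<^sub>m (2*n) + real N \<cdot>\<^sub>m X
    \<Longrightarrow> Gamma_level n N g"
  unfolding Gamma_level_iff by blast

lemma Gamma_level_mult:
  assumes "Gamma_level n N g" "Gamma_level n N h"
  shows "Gamma_level n N (g * h)"
proof -
  obtain X where g: "is_Sp n g" and X: "X \<in> carrier_mat (2*n) (2*n)" "integral_mat X"
    "g = 1\<^sub>m (2*n) + real N \<cdot>\<^sub>m X" using assms(1) by (rule Gamma_levelE)
  obtain Y where h: "is_Sp n h" and Y: "Y \<in> carrier_mat (2*n) (2*n)" "integral_mat Y"
    "h = 1\<^sub>m (2*n) + real N \<cdot>\<^sub>m Y" using assms(2) by (rule Gamma_levelE)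
  have [simp]: "dim_row X = 2*n" "dim_col X = 2*n" "dim_row Y = 2*n" "dim_col Y = 2*n"
    using X Y by auto
  let ?Z = "X + Y + real N \<cdot>\<^sub>m (X * Y)"
  show ?thesis
  proof (rule Gamma_levelI[OF is_Sp_mult[OF g h]])
    show "integral_mat ?Z"
      by (intro integral_mat_add integral_mat_smult integral_mat_mult X Y) auto
    show "g * h = 1\<^sub>m (2*n) + real N \<cdot>\<^sub>m ?Z"
      unfolding X(3) Y(3)
      by (simp add: mat_dim_simps) (intro eq_matI; simp add: algebra_simps del: index_mult_mat(1))
  qed (auto intro: carrier_matI)
qed

text \<open>The mixed blocks of \<open>X\<close> cancel in \<open>X + \<tau>(X)\<close> and the diagonal blocks double; this is the
  gain of a factor 2 in the level.\<close>

lemma tau_cocycle_level: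
  assumes N: "even N" and \<gamma>: "Gamma_level n N \<gamma>"
  shows "Gamma_level n (2 * N) (tau_g n \<gamma> * \<gamma>)"
proof -
  obtain X where Sp: "is_Sp n \<gamma>" and X: "X \<in> carrier_mat (2*n) (2*n)" "integral_mat X"
    and \<gamma>_eq: "\<gamma> = 1\<^sub>m (2*n) + real N \<cdot>\<^sub>m X" using \<gamma> by (rule Gamma_levelE)
  obtain k where k: "N = 2 * k" using N by blast
  have [simp]: "dim_row X = 2*n" "dim_col X = 2*n" using X by auto
  let ?S = "tau_g n X" and ?T = "Tmat n"
  define E where "E = mat (2*n) (2*n) (\<lambda>(i,j). if (i < n) = (j < n) then X $$ (i, j) else 0)"
  have [simp]: "dim_row E = 2*n" "dim_col E = 2*n" unfolding E_def by auto
  have SX: "?S + X = 2 \<cdot>\<^sub>m E"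
    unfolding tau_g_def blkA_def blkB_def blkC_def blkD_def E_def by (intro eq_matI) auto
  have tau: "tau_g n \<gamma> = 1\<^sub>m (2*n) + real N \<cdot>\<^sub>m ?S"
    unfolding \<gamma>_eq using X(1) by (simp add: tau_g_eq_Tmat mat_dim_simps Tmat_Tmat)
  let ?Y = "E + real k \<cdot>\<^sub>m (?S * X)"
  show ?thesis
  proof (rule Gamma_levelI[OF is_Sp_mult[OF is_Sp_tau_g[OF Sp] Sp]])
    have "integral_mat ?S" unfolding tau_g_eq_Tmat[OF X(1)]
      by (intro integral_mat_mult integral_mat_Tmat X) auto
    moreover have "integral_mat E" using X(2) unfolding E_def integral_mat_def by auto
    ultimately show "integral_mat ?Y"
      by (intro integral_mat_add integral_mat_smult integral_mat_mult X) auto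
    have "tau_g n \<gamma> * \<gamma> = 1\<^sub>m (2*n) + real N \<cdot>\<^sub>m (?S + X) + real N * real N \<cdot>\<^sub>m (?S * X)"
      unfolding tau
      by (subst \<gamma>_eq, simp add: mat_dim_simps)
        (intro eq_matI; simp add: algebra_simps del: index_mult_mat(1))
    then show "tau_g n \<gamma> * \<gamma> = 1\<^sub>m (2*n) + real (2 * N) \<cdot>\<^sub>m ?Y"
      unfolding SX k by (auto intro!: eq_matI simp: algebra_simps simp del: index_mult_mat(1))
  qed (auto intro: carrier_matI)
qed

lemma inv_sqrt_unipotent_level:
  assumes N: "even N" and u: "Gamma_level n (2 * N) u" and cube: "cube_unipotent (2*n) u"
  shows "Gamma_level n N (inv_sqrt_unipotent u)"
proof -
  obtain X where Sp: "is_Sp n u" and X: "X \<in> carrier_mat (2*n) (2*n)" "integral_mat X"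
    and u_eq: "u = 1\<^sub>m (2*n) + real (2 * N) \<cdot>\<^sub>m X" using u by (rule Gamma_levelE)
  obtain k where k: "N = 2 * k" using N by blast
  have [simp]: "dim_row X = 2*n" "dim_col X = 2*n" using X by auto
  have "u - 1\<^sub>m (2*n) = real (2 * N) \<cdot>\<^sub>m X" unfolding u_eq by (intro eq_matI) auto
  note r = cube_unipotentD(4)[OF cube, unfolded this]
  let ?Y = "(-1) \<cdot>\<^sub>m X + real (3 * k) \<cdot>\<^sub>m (X * X)"
  show ?thesis
  proof (rule Gamma_levelI[OF is_Sp_inv_sqrt_unipotent[OF Sp cube]])
    show "integral_mat ?Y"
      by (intro integral_mat_add integral_mat_smult integral_mat_mult X) auto
    show "inv_sqrt_unipotent u = 1\<^sub>m (2*n) + real N \<cdot>\<^sub>m ?Y"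
      unfolding r quadratic_mat_def k
      by (simp add: mat_dim_simps) (intro eq_matI; simp add: algebra_simps del: index_mult_mat(1))
  qed (auto intro: carrier_matI)
qed

lemma Gamma_level_unipotent:
  assumes N: "N \<ge> 3" and u: "Gamma_level n N u" and ev: "\<And>x. eigenvalue (cplx u) x \<Longrightarrow> cmod x = 1"
  shows "unipotent_mat u"
proof -
  obtain X where Sp: "is_Sp n u" and X: "X \<in> carrier_mat (2*n) (2*n)" "integral_mat X"
    and u_eq: "u = 1\<^sub>m (2*n) + real N \<cdot>\<^sub>m X" using u by (rule Gamma_levelE)
  have "cmod x < 1" if x: "eigenvalue (cplx X) x" for x
  proof -
    have "cplx u = 1 \<cdot>\<^sub>m 1\<^sub>m (2*n) + of_nat N \<cdot>\<^sub>m cplx X"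
      unfolding u_eq using X(1) by (intro eq_matI) auto
    then have "cmod (1 + of_nat N * x) = 1"
      using ev eigenvalue_affine[OF _ x, of "2*n" 1 "of_nat N"] X(1) by simp
    then have "real N * cmod x \<le> 2"
      using norm_triangle_ineq4[of "1 + of_nat N * x" 1] by (simp add: norm_mult)
    moreover have "3 * cmod x \<le> real N * cmod x" using N by (intro mult_right_mono) auto
    ultimately show ?thesis by linarith
  qed
  from integral_mat_nilpotent[OF X this] obtain j where j: "X ^\<^sub>m j = 0\<^sub>m (2*n) (2*n)" by auto
  have "u - 1\<^sub>m (2*n) = real N \<cdot>\<^sub>m X" unfolding u_eq using X(1) by (intro eq_matI) auto
  then have "(u - 1\<^sub>m (2*n)) ^\<^sub>m j = 0\<^sub>m (2*n) (2*n)" using smult_pow_mat[OF X(1)] j by simp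
  then show ?thesis unfolding unipotent_mat_def using is_SpD[OF Sp] by auto
qed

subsection \<open>Neatness at the boundary\<close>

lemma rational_eigenvector_eigenvalue_Ints:
  assumes X: "X \<in> carrier_mat n n" "integral_mat X"
    and v: "v \<in> carrier_vec n" "\<And>i. i < n \<Longrightarrow> v $ i \<in> \<rat>" "v \<noteq> 0\<^sub>v n" and ev: "X *\<^sub>v v = a \<cdot>\<^sub>v v"
  shows "a \<in> \<int>"
proof -
  obtain i where i: "i < n" "v $ i \<noteq> 0" using v(1,3) by (auto simp: vec_eq_iff)
  have "a * v $ i = (X *\<^sub>v v) $ i" unfolding ev using i v(1) by simp
  also have "\<dots> = (\<Sum>j<n. X $$ (i, j) * v $ j)"
    using i v(1) X(1) by (simp add: scalar_prod_def atLeast0LessThan)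
  also have "\<dots> \<in> \<rat>"
    using X i(1) v(2) unfolding integral_mat_def
    by (intro Rats_sum Rats_mult) (auto intro: subsetD[OF Ints_subset_Rats])
  finally have "a * v $ i / v $ i \<in> \<rat>" by (intro Rats_divide v(2)[OF i(1)])
  then have "a \<in> \<rat>" using i(2) by simp
  moreover have "eigenvalue X a"
    using X(1) v(1,3) ev unfolding eigenvalue_def eigenvector_def by auto
  ultimately show ?thesis
    using eigenvalue_integral_mat_algebraic_int[OF X] rational_algebraic_int_is_int by blast
qed

lemma mult_mat_unit_vec: "A \<in> carrier_mat m n \<Longrightarrow> j < n \<Longrightarrow> A *\<^sub>v unit_vec n j = col A j"
  for A :: "'a::semiring_1 mat"
  by (intro eq_vecI) auto

lemma parabolic_corner_eigenvectors:
  assumes k: "parabolic q k"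
  shows "k *\<^sub>v unit_vec (2 * Suc q) q = k $$ (q, q) \<cdot>\<^sub>v unit_vec (2 * Suc q) q"
    "k\<^sup>T *\<^sub>v unit_vec (2 * Suc q) (Suc (2*q))
      = k $$ (Suc (2*q), Suc (2*q)) \<cdot>\<^sub>v unit_vec (2 * Suc q) (Suc (2*q))"
proof -
  note kd = parabolicD[OF k]
  have "k *\<^sub>v unit_vec (2 * Suc q) q = col k q"
    "k\<^sup>T *\<^sub>v unit_vec (2 * Suc q) (Suc (2*q)) = row k (Suc (2*q))"
    using kd(1) by (subst mult_mat_unit_vec; simp)+
  then show "k *\<^sub>v unit_vec (2 * Suc q) q = k $$ (q, q) \<cdot>\<^sub>v unit_vec (2 * Suc q) q"
    "k\<^sup>T *\<^sub>v unit_vec (2 * Suc q) (Suc (2*q))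
      = k $$ (Suc (2*q), Suc (2*q)) \<cdot>\<^sub>v unit_vec (2 * Suc q) (Suc (2*q))"
    using kd by (auto simp: vec_eq_iff)
qed

lemma similar_mat_eigenvalue:
  fixes A :: "'a::field mat"
  assumes "similar_mat A B" "eigenvalue B x"
  shows "eigenvalue A x"
proof -
  obtain n where "A \<in> carrier_mat n n" "B \<in> carrier_mat n n"
    using assms(1) unfolding similar_mat_def similar_mat_wit_def Let_def by blast
  then show ?thesis
    using assms char_poly_similar[OF assms(1)] by (simp add: eigenvalue_root_char_poly)
qed

lemma is_Sp_conjugate_intertwine:
  assumes "is_Sp n g" "u \<in> carrier_mat (2*n) (2*n)"
  shows "u * g = g * (sp_adj n g * u * g)"
  using assms(2) is_SpD[OF assms(1)]
  by (simp add: assoc_mult_mat_dim is_Sp_sp_adj_cancel[OF assms(1)])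

lemma is_Sp_conjugate_similar:
  assumes g: "is_Sp n g" and u: "u \<in> carrier_mat (2*n) (2*n)"
  shows "similar_mat_wit u (sp_adj n g * u * g) g (sp_adj n g)"
proof (rule similar_mat_witI[of _ _ "2*n"])
  show "u = g * (sp_adj n g * u * g) * sp_adj n g"
    using u is_SpD[OF g]
    by (simp add: assoc_mult_mat_dim is_Sp_sp_adj_cancel[OF g] is_Sp_sp_adj_mult[OF g]
        one_mult_mat_dim)
qed (use g u is_SpD[OF g] is_Sp_sp_adj_mult[OF g] in auto)

lemma similar_mat_cplx:
  assumes "similar_mat_wit A B P Q"
  shows "similar_mat (cplx A) (cplx B)"
proof -
  define n where "n = dim_row A"
  note wit = similar_mat_witD[OF n_def assms]
  show ?thesis
  proof (rule similar_matI[of _ _ "cplx P" "cplx Q" n])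
    show "cplx P * cplx Q = 1\<^sub>m n" "cplx Q * cplx P = 1\<^sub>m n"
      using carrier_matD[OF wit(6)] carrier_matD[OF wit(7)] wit(1,2)
      by (simp_all add: cplx_mult_eq_one)
    show "cplx A = cplx P * cplx B * cplx Q"
      using carrier_matD[OF wit(5)] carrier_matD[OF wit(6)] carrier_matD[OF wit(7)]
      by (subst wit(3)) (simp add: cplx_mult)
  qed (use wit(4-7) in simp)
qed

lemma similar_mat_wit_minus_one:
  fixes u :: "'a::ring_1 mat"
  assumes "similar_mat_wit u k P Q" "dim_row u = n"
  shows "similar_mat_wit (u - 1\<^sub>m n) (k - 1\<^sub>m n) P Q"
proof -
  note wit = similar_mat_witD[OF assms(2)[symmetric] assms(1)]
  note [simp] = carrier_matD[OF wit(4)] carrier_matD[OF wit(5)] carrier_matD[OF wit(6)]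
    carrier_matD[OF wit(7)]
  have "P * (k - 1\<^sub>m n) * Q = P * k * Q - 1\<^sub>m n" by (simp add: mat_dim_simps wit(1))
  also have "P * k * Q = u" by (rule wit(3)[symmetric])
  finally show ?thesis
    by (intro similar_mat_witI[OF wit(1,2)]) (use wit(4-7) in \<open>auto intro: minus_carrier_mat\<close>)
qed

lemma unipotent_mat_similar:
  assumes "similar_mat_wit k u P Q" "unipotent_mat u"
  shows "unipotent_mat k"
proof -
  define n where "n = dim_row k"
  note wit = similar_mat_witD[OF n_def assms(1)]
  obtain j where "(u - 1\<^sub>m n) ^\<^sub>m j = 0\<^sub>m n n"
    using assms(2) carrier_matD(1)[OF wit(5)] unfolding unipotent_mat_def by blast
  then have "(k - 1\<^sub>m n) ^\<^sub>m j = 0\<^sub>m n n"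
    using similar_mat_wit_pow_id[OF similar_mat_wit_minus_one[OF assms(1) n_def[symmetric]], of j]
      wit(6,7)
    by (simp add: zero_mult_mat_dim)
  then show ?thesis unfolding unipotent_mat_def n_def by blast
qed

lemma cube_unipotent_similar:
  assumes "similar_mat_wit u k P Q" "cube_unipotent n k"
  shows "cube_unipotent n u"
proof -
  have k: "k \<in> carrier_mat n n" using assms(2) unfolding cube_unipotent_def by simp
  have n: "dim_row u = n"
    using similar_mat_witD(5)[OF refl assms(1)] k by (metis carrier_matD(1))
  define N M where "N = u - 1\<^sub>m n" and "M = k - 1\<^sub>m n"
  have "n = dim_row N" unfolding N_def by simp
  note wit = similar_mat_witD[OF this similar_mat_wit_minus_one[OF assms(1) n, folded N_def M_def]]
  note [simp] = carrier_matD[OF wit(5)] carrier_matD[OF wit(6)] carrier_matD[OF wit(7)]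
  have "N * (N * N) = P * (M * (M * M)) * Q"
    unfolding wit(3) by (simp add: assoc_mult_mat_dim left_inverse_cancel_mat[OF wit(2)])
  also have "\<dots> = 0\<^sub>m n n"
    using cube_unipotentD(2)[OF assms(2)] unfolding M_def[symmetric]
    by (simp add: zero_mult_mat_dim)
  finally show ?thesis
    using similar_mat_witD(4)[OF n[symmetric] assms(1)] unfolding cube_unipotent_def N_def by simp
qed

lemma integral_conjugate_first_corner_Ints:
  assumes u: "u \<in> carrier_mat (2 * Suc q) (2 * Suc q)" "integral_mat u" and g: "is_Sp_Q (Suc q) g"
    and k_def: "k = sp_adj (Suc q) g * u * g" and k: "parabolic q k"
  shows "k $$ (q, q) \<in> \<int>"
proof (rule rational_eigenvector_eigenvalue_Ints[OF u])
  let ?e = "unit_vec (2 * Suc q) q :: real vec"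
  have gSp: "is_Sp (Suc q) g" using g unfolding is_Sp_Q_def by simp
  note gd = is_SpD[OF gSp]
  have "u *\<^sub>v (g *\<^sub>v ?e) = g *\<^sub>v (k *\<^sub>v ?e)"
    using arg_cong[OF is_Sp_conjugate_intertwine[OF gSp u(1), folded k_def], of "\<lambda>X. X *\<^sub>v ?e"]
      u(1) gd(1) parabolicD(1)[OF k] by simp
  then show "u *\<^sub>v (g *\<^sub>v ?e) = k $$ (q, q) \<cdot>\<^sub>v (g *\<^sub>v ?e)"
    unfolding parabolic_corner_eigenvectors(1)[OF k] using gd(1) by (simp add: mult_mat_vec)
  show "(g *\<^sub>v ?e) $ i \<in> \<rat>" if "i < 2 * Suc q" for i
    using g that gd unfolding is_Sp_Q_def by (simp add: mult_mat_unit_vec)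
  have "sp_adj (Suc q) g *\<^sub>v (g *\<^sub>v ?e) = (sp_adj (Suc q) g * g) *\<^sub>v ?e"
    by (rule assoc_mult_mat_vec[OF sp_adj_carrier gd(1), symmetric]) simp
  then have inv: "sp_adj (Suc q) g *\<^sub>v (g *\<^sub>v ?e) = ?e"
    unfolding is_Sp_sp_adj_mult(1)[OF gSp] by simp
  show "g *\<^sub>v ?e \<noteq> 0\<^sub>v (2 * Suc q)"
    using arg_cong[OF inv, of "\<lambda>v. v $ q"]
      scalar_prod_right_zero[OF row_carrier, of "sp_adj (Suc q) g" q] by auto
  show "g *\<^sub>v ?e \<in> carrier_vec (2 * Suc q)" using gd(1) by simp
qed

lemma integral_similar_last_corner_algebraic_int:
  assumes u: "u \<in> carrier_mat (2 * Suc q) (2 * Suc q)" "integral_mat u"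
    and sim: "similar_mat u k" and k: "parabolic q k"
  shows "algebraic_int (k $$ (Suc (2*q), Suc (2*q)))"
proof -
  note kd = parabolicD[OF k]
  have "eigenvalue k\<^sup>T (k $$ (Suc (2*q), Suc (2*q)))"
    unfolding eigenvalue_def eigenvector_def using parabolic_corner_eigenvectors(2)[OF k] kd
    by (intro exI[of _ "unit_vec (2 * Suc q) (Suc (2*q))"]) auto
  then have "eigenvalue k (k $$ (Suc (2*q), Suc (2*q)))"
    using kd(1) by (simp add: eigenvalue_root_char_poly[of _ "2 * Suc q"])
  then show ?thesis
    using similar_mat_eigenvalue[OF sim] eigenvalue_integral_mat_algebraic_int[OF u] by blast
qed

lemma Sp_Z_conjugate_corners:
  assumes u: "is_Sp (Suc q) u" "integral_mat u" and g: "is_Sp_Q (Suc q) g"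
    and k_def: "k = sp_adj (Suc q) g * u * g" and k: "parabolic q k"
  shows "\<bar>k $$ (q, q)\<bar> = 1" "\<bar>k $$ (Suc (2*q), Suc (2*q))\<bar> = 1"
proof -
  have gSp: "is_Sp (Suc q) g" using g unfolding is_Sp_Q_def by simp
  have kSp: "is_Sp (Suc q) k" unfolding k_def by (intro is_Sp_mult is_Sp_sp_adj gSp u(1))
  let ?a = "k $$ (q, q)" and ?d = "k $$ (Suc (2*q), Suc (2*q))"
  have ad: "?a * ?d = 1" by (rule Sp_stab_parabolic(2)[OF kSp stab_bc_if_parabolic[OF k]])
  have a: "?a \<in> \<int>"
    by (rule integral_conjugate_first_corner_Ints[OF is_SpD(1)[OF u(1)] u(2) g k_def k])
  have "similar_mat u k"
    using is_Sp_conjugate_similar[OF gSp is_SpD(1)[OF u(1)]]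
    unfolding similar_mat_def k_def by blast
  then have "algebraic_int ?d"
    using integral_similar_last_corner_algebraic_int[OF is_SpD(1)[OF u(1)] u(2) _ k] by simp
  moreover have "?d = 1 / ?a" using ad by (auto simp: eq_divide_eq mult.commute)
  then have "?d \<in> \<rat>" using a by (auto elim!: Ints_cases)
  ultimately have d: "?d \<in> \<int>" by (rule rational_algebraic_int_is_int)
  obtain m n :: int where mn: "?a = of_int m" "?d = of_int n"
    using a d by (auto elim!: Ints_cases)
  then have "m * n = 1" using ad by (metis of_int_eq_1_iff of_int_mult)
  then show "\<bar>?a\<bar> = 1" "\<bar>?d\<bar> = 1" unfolding mn by (auto simp: zmult_eq_1_iff)
qed

lemma boundary_isotropy_unipotent:
  assumes N: "N \<ge> 3" and u: "Gamma_level (Suc q) N u" and g: "is_Sp_Q (Suc q) g"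
    and k_def: "k = sp_adj (Suc q) g * u * g" and k: "parabolic q k"
    and Z: "siegel q Z" and fixed: "sp_act q (levi_proj (Suc q) k) Z = Z"
  shows "levi_proj (Suc q) k = 1\<^sub>m (2*q)" "cube_unipotent (2 * Suc q) u"
proof -
  let ?n = "2 * Suc q"
  have gSp: "is_Sp (Suc q) g" using g unfolding is_Sp_Q_def by simp
  have uSp: "is_Sp (Suc q) u" and u_int: "integral_mat u"
    using u is_SpD(2,3)[of "Suc q" u] unfolding Gamma_level_def is_Sp_Z_def integral_mat_def by auto
  note ud = is_SpD[OF uSp] and kd = parabolicD[OF k]
  have kSp: "is_Sp (Suc q) k" unfolding k_def by (intro is_Sp_mult is_Sp_sp_adj gSp uSp)
  have lSp: "is_Sp q (levi_proj (Suc q) k)" by (rule levi_proj_Sp[OF kSp k])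
  have sim: "similar_mat_wit u k g (sp_adj (Suc q) g)"
    unfolding k_def by (rule is_Sp_conjugate_similar[OF gSp ud(1)])
  have "cmod x = 1" if "eigenvalue (cplx u) x" for x
  proof -
    have "eigenvalue (cplx k) x"
      by (rule similar_mat_eigenvalue[OF similar_mat_sym[OF similar_mat_cplx[OF sim]] that])
    then show ?thesis
      using parabolic_eigenvalue[OF k] isotropy_eigenvalue_cmod[OF lSp Z fixed]
        Sp_Z_conjugate_corners[OF uSp u_int g k_def k] by fastforce
  qed
  then have "unipotent_mat u" by (rule Gamma_level_unipotent[OF N u])
  then have "unipotent_mat k" by (rule unipotent_mat_similar[OF similar_mat_wit_sym[OF sim]])
  note unipotent = parabolic_unipotent[OF k this]
  show levi: "levi_proj (Suc q) k = 1\<^sub>m (2*q)"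
    by (rule isotropy_unipotent_eq_one[OF lSp Z fixed unipotent(1)])
  have M: "parabolic q (k - 1\<^sub>m ?n)" by (rule parabolic_minus[OF k parabolic_one])
  have "levi_proj (Suc q) (k - 1\<^sub>m ?n) = 0\<^sub>m (2*q) (2*q)"
    unfolding levi_proj_minus[OF k parabolic_one] levi levi_proj_one by (intro eq_matI) auto
  then have "cube_unipotent ?n k"
    unfolding cube_unipotent_def
    by (intro conjI kd(1) parabolic_nilpotent_cube[OF M]) (use unipotent(2,3) kd in auto)
  then show "cube_unipotent ?n u" by (rule cube_unipotent_similar[OF sim])
qed

subsection \<open>Fixed points near the boundary\<close>

text \<open>The element \<open>h\<close> with \<open>\<gamma>g = \<tau>(g)h\<close>: it turns the equation \<open>\<gamma>g\<iota>(Z) = \<tau>(g\<iota>(Z))\<close> into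
  \<open>h\<iota>(Z) = \<tau>(\<iota>(Z))\<close>.\<close>

definition boundary_transition :: "nat \<Rightarrow> real mat \<Rightarrow> real mat \<Rightarrow> real mat" where
  "boundary_transition n g \<gamma> = sp_adj n (tau_g n g) * \<gamma> * g"

lemma is_Sp_boundary_transition:
  "is_Sp n g \<Longrightarrow> is_Sp n \<gamma> \<Longrightarrow> is_Sp n (boundary_transition n g \<gamma>)"
  unfolding boundary_transition_def by (intro is_Sp_mult is_Sp_sp_adj is_Sp_tau_g)

lemma bc_fixed_iff:
  assumes "is_Sp (Suc q) g" "is_Sp (Suc q) \<gamma>"
  shows "Z \<in> bc_fixed (Suc q) g \<gamma> \<longleftrightarrow> siegel q Z \<and> parabolic q (boundary_transition (Suc q) g \<gamma>)
    \<and> sp_act q (levi_proj (Suc q) (boundary_transition (Suc q) g \<gamma>)) Z = tau_pt Z"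
proof -
  have "minv (tau_g (Suc q) g) * (\<gamma> * g) = boundary_transition (Suc q) g \<gamma>"
    unfolding minv_eq_sp_adj[OF is_Sp_tau_g[OF assms(1)]] boundary_transition_def
    using is_SpD[OF assms(1)] is_SpD[OF assms(2)] by (simp add: assoc_mult_mat_dim)
  then show ?thesis
    unfolding bc_fixed_def bpt_eq_def Let_def
    using Sp_stab_parabolic(1)[OF is_Sp_boundary_transition[OF assms]] stab_bc_if_parabolic by auto
qed

lemma tau_g_mult_boundary_transition:
  assumes g: "is_Sp n g" and \<gamma>: "is_Sp n \<gamma>"
  shows "tau_g n g * boundary_transition n g \<gamma> = \<gamma> * g"
  unfolding boundary_transition_def using is_SpD[OF g] is_SpD[OF \<gamma>]
  by (simp add: assoc_mult_mat_dim is_Sp_sp_adj_cancel[OF is_Sp_tau_g[OF g]])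

lemma tau_boundary_transition_cocycle:
  assumes g: "is_Sp n g" and \<gamma>: "is_Sp n \<gamma>"
  shows "tau_g n (boundary_transition n g \<gamma>) * boundary_transition n g \<gamma>
    = sp_adj n g * (tau_g n \<gamma> * \<gamma>) * g"
proof -
  note gd = is_SpD[OF g] and \<gamma>d = is_SpD[OF \<gamma>]
  have "tau_g n (boundary_transition n g \<gamma>) = sp_adj n g * tau_g n \<gamma> * tau_g n g"
    unfolding boundary_transition_def sp_adj_tau_g[OF gd(1)]
    using gd \<gamma>d by (simp add: tau_g_mult tau_g_tau_g mult_carrier_mat[of _ "2*n" "2*n"])
  then show ?thesis
    using gd \<gamma>d tau_g_mult_boundary_transition[OF g \<gamma>] is_SpD[OF is_Sp_boundary_transition[OF g \<gamma>]]
    by (simp add: assoc_mult_mat_dim)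
qed

lemma levi_proj_inv_sqrt_unipotent:
  assumes k: "parabolic q k"
  shows "parabolic q (inv_sqrt_unipotent k)"
    "levi_proj (Suc q) k = 1\<^sub>m (2*q) \<Longrightarrow> levi_proj (Suc q) (inv_sqrt_unipotent k) = 1\<^sub>m (2*q)"
proof -
  define M where "M = k - 1\<^sub>m (2 * Suc q)"
  have M: "parabolic q M" unfolding M_def by (rule parabolic_minus[OF k parabolic_one])
  note MM = parabolic_mult[OF M M]
  have r: "inv_sqrt_unipotent k = 1\<^sub>m (2 * Suc q) + (-1/2) \<cdot>\<^sub>m M + (3/8) \<cdot>\<^sub>m (M * M)"
    unfolding inv_sqrt_unipotent_def quadratic_mat_def M_def parabolicD(2)[OF k] ..
  show "parabolic q (inv_sqrt_unipotent k)"
    unfolding r by (intro parabolic_add parabolic_smult parabolic_one M MM(1))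
  assume "levi_proj (Suc q) k = 1\<^sub>m (2*q)"
  then have "levi_proj (Suc q) M = 0\<^sub>m (2*q) (2*q)"
    unfolding M_def levi_proj_minus[OF k parabolic_one] levi_proj_one by (auto intro!: eq_matI)
  then show "levi_proj (Suc q) (inv_sqrt_unipotent k) = 1\<^sub>m (2*q)"
    unfolding r using M MM(1,2)
    by (simp add: levi_proj_add levi_proj_smult parabolic_add parabolic_smult parabolic_one
        levi_proj_one zero_mult_mat_dim del: mult_Suc_right)
qed

lemma bc_fixed_cocycle_unipotent:
  assumes N: "even N" "N \<ge> 2" and g: "is_Sp_Q (Suc q) g" and \<gamma>: "Gamma_level (Suc q) N \<gamma>"
    and Z: "Z \<in> bc_fixed (Suc q) g \<gamma>"
  defines "u \<equiv> tau_g (Suc q) \<gamma> * \<gamma>"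
  shows "Gamma_level (Suc q) (2 * N) u" "cube_unipotent (2 * Suc q) u"
    "parabolic q (sp_adj (Suc q) g * u * g)"
    "levi_proj (Suc q) (sp_adj (Suc q) g * u * g) = 1\<^sub>m (2*q)"
proof -
  let ?n = "Suc q"
  have gSp: "is_Sp ?n g" and \<gamma>Sp: "is_Sp ?n \<gamma>"
    using g \<gamma> unfolding is_Sp_Q_def Gamma_level_iff by auto
  define h where "h = boundary_transition ?n g \<gamma>"
  have siegel: "siegel q Z" and h: "parabolic q h" and hZ: "sp_act q (levi_proj ?n h) Z = tau_pt Z"
    using Z unfolding bc_fixed_iff[OF gSp \<gamma>Sp] h_def by auto
  have lSp: "is_Sp q (levi_proj ?n h)"
    by (rule levi_proj_Sp[OF _ h]) (simp add: h_def is_Sp_boundary_transition gSp \<gamma>Sp)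
  define k where "k = sp_adj ?n g * u * g"
  have k_eq: "k = tau_g ?n h * h"
    unfolding k_def h_def u_def by (rule tau_boundary_transition_cocycle[OF gSp \<gamma>Sp, symmetric])
  have k: "parabolic q k" "levi_proj ?n k = tau_g q (levi_proj ?n h) * levi_proj ?n h"
    unfolding k_eq using parabolic_mult(1,2)[OF parabolic_tau_g(1)[OF h] h] parabolic_tau_g(2)[OF h]
    by auto
  have fixed: "sp_act q (levi_proj ?n k) Z = Z"
    unfolding k(2) sp_act_mult[OF is_Sp_tau_g[OF lSp] lSp siegel] hZ sp_act_tau[OF lSp siegel]
    by simp
  show u: "Gamma_level ?n (2 * N) u" unfolding u_def by (rule tau_cocycle_level[OF N(1) \<gamma>])
  show "parabolic q (sp_adj ?n g * u * g)" using k(1) unfolding k_def .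
  show "levi_proj ?n (sp_adj ?n g * u * g) = 1\<^sub>m (2*q)" "cube_unipotent (2 * ?n) u"
    using boundary_isotropy_unipotent[OF _ u g k_def k(1) siegel fixed] N(2) unfolding k_def by auto
qed

lemma bc_fixed_involution:
  assumes N: "even N" "N \<ge> 2" and g: "is_Sp_Q (Suc q) g" and \<gamma>: "Gamma_level (Suc q) N \<gamma>"
    and Z: "Z \<in> bc_fixed (Suc q) g \<gamma>"
  obtains \<gamma>' where "Gamma_level (Suc q) N \<gamma>'" "tau_g (Suc q) \<gamma>' * \<gamma>' = 1\<^sub>m (2 * Suc q)"
    "Z \<in> bc_fixed (Suc q) g \<gamma>'"
proof -
  let ?n = "Suc q"
  have gSp: "is_Sp ?n g" and \<gamma>Sp: "is_Sp ?n \<gamma>"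
    using g \<gamma> unfolding is_Sp_Q_def Gamma_level_iff by auto
  define u where "u = tau_g ?n \<gamma> * \<gamma>"
  define k where "k = sp_adj ?n g * u * g"
  define h where "h = boundary_transition ?n g \<gamma>"
  note cocycle = bc_fixed_cocycle_unipotent[OF N g \<gamma> Z, folded u_def, folded k_def]
  have h: "parabolic q h" and Z_h: "siegel q Z" "sp_act q (levi_proj ?n h) Z = tau_pt Z"
    using Z unfolding bc_fixed_iff[OF gSp \<gamma>Sp] h_def by auto
  define \<gamma>' \<rho> where "\<gamma>' = \<gamma> * inv_sqrt_unipotent u" and "\<rho> = inv_sqrt_unipotent k"
  have level: "Gamma_level ?n N \<gamma>'"
    unfolding \<gamma>'_def
    by (rule Gamma_level_mult[OF \<gamma> inv_sqrt_unipotent_level[OF N(1) cocycle(1,2)]])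
  then have \<gamma>'Sp: "is_Sp ?n \<gamma>'" unfolding Gamma_level_iff by simp
  have \<rho>: "parabolic q \<rho>" "levi_proj ?n \<rho> = 1\<^sub>m (2*q)"
    unfolding \<rho>_def using levi_proj_inv_sqrt_unipotent[OF cocycle(3)] cocycle(4) by auto
  have uSp: "is_Sp ?n u" using cocycle(1) unfolding Gamma_level_iff by simp
  have "inv_sqrt_unipotent u * g = g * \<rho>"
    unfolding \<rho>_def k_def
    by (rule inv_sqrt_unipotent_intertwine[OF parabolicD(1)[OF cocycle(3), unfolded k_def]
          is_SpD(1)[OF uSp] is_SpD(1)[OF gSp] is_Sp_conjugate_intertwine[OF gSp is_SpD(1)[OF uSp]]])
  then have "boundary_transition ?n g \<gamma>' = h * \<rho>"
    unfolding boundary_transition_def \<gamma>'_def h_def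
    using is_SpD[OF uSp] is_SpD[OF gSp] is_SpD[OF \<gamma>Sp] parabolicD(2,3)[OF \<rho>(1)]
    by (simp add: assoc_mult_mat_dim)
  then have fixed: "Z \<in> bc_fixed ?n g \<gamma>'"
    unfolding bc_fixed_iff[OF gSp \<gamma>'Sp] using parabolic_mult(1,2)[OF h \<rho>(1)] Z_h
    by (simp add: \<rho>(2) one_mult_mat_dim)
  have "tau_g ?n \<gamma>' * \<gamma>' = 1\<^sub>m (2 * ?n)"
    unfolding \<gamma>'_def
    by (rule tau_inv_sqrt_unipotent_cocycle[OF is_SpD(1)[OF \<gamma>Sp] u_def cocycle(2)])
  then show ?thesis using that level fixed by blast
qed

lemma in_satake_closure_involution:
  assumes g: "is_Sp (Suc q) g" and \<gamma>: "is_Sp (Suc q) \<gamma>"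
    and inv: "tau_g (Suc q) \<gamma> * \<gamma> = 1\<^sub>m (2 * Suc q)"
    and Z: "Z \<in> bc_fixed (Suc q) g \<gamma>"
  shows "in_satake_closure (Suc q) (fixed_set (Suc q) \<gamma>) g Z"
  unfolding in_satake_closure_def
proof (intro allI impI)
  fix \<epsilon> t :: real assume \<epsilon>: "\<epsilon> > 0"
  let ?n = "Suc q"
  define h where "h = boundary_transition ?n g \<gamma>"
  have siegel: "siegel q Z" and h: "parabolic q h" and hZ: "sp_act q (levi_proj ?n h) Z = tau_pt Z"
    using Z unfolding bc_fixed_iff[OF g \<gamma>] h_def by auto
  have hSp: "is_Sp ?n h" unfolding h_def by (rule is_Sp_boundary_transition[OF g \<gamma>])
  have "tau_g ?n h * h = 1\<^sub>m (2 * ?n)"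
    unfolding h_def tau_boundary_transition_cocycle[OF g \<gamma>] inv
    using is_Sp_sp_adj_mult(1)[OF g] by (simp add: one_mult_mat_dim)
  then obtain w c where w: "w \<in> carrier_vec q" and W: "siegel ?n (bordered Z w c)"
    and height: "height ?n (bordered Z w c) > t"
    and fixed: "sp_act ?n h (bordered Z w c) = tau_pt (bordered Z w c)"
    using parabolic_involution_fixed_point[OF hSp h _ siegel hZ] by metis
  let ?W = "bordered Z w c"
  have "sp_act ?n \<gamma> (sp_act ?n g ?W) = sp_act ?n (tau_g ?n g * h) ?W"
    unfolding h_def tau_g_mult_boundary_transition[OF g \<gamma>]
    by (rule sp_act_mult[OF \<gamma> g W, symmetric])
  also have "\<dots> = tau_pt (sp_act ?n g ?W)"
    unfolding sp_act_mult[OF is_Sp_tau_g[OF g] hSp W] fixed by (rule sp_act_tau[OF g W])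
  finally have "sp_act ?n g ?W \<in> fixed_set ?n \<gamma>"
    unfolding fixed_set_def using siegel_sp_act[OF g W] by simp
  moreover have "\<forall>i<?n - 1. \<forall>j<?n - 1. cmod (?W $$ (i, j) - Z $$ (i, j)) < \<epsilon>"
    using w \<epsilon> by simp
  ultimately show "\<exists>W. siegel ?n W \<and> (\<forall>i<?n - 1. \<forall>j<?n - 1. cmod (W $$ (i, j) - Z $$ (i, j)) < \<epsilon>)
      \<and> height ?n W > t \<and> sp_act ?n g W \<in> fixed_set ?n \<gamma>"
    using W height by blast
qed

lemma in_satake_closure_mono: "in_satake_closure n S g Z \<Longrightarrow> S \<subseteq> S' \<Longrightarrow> in_satake_closure n S' g Z"
  unfolding in_satake_closure_def by (meson subsetD)

lemma bc_fixed_subset_satake_closure: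
  assumes N: "even N" "N \<ge> 2" and n: "n \<ge> 1" and g: "is_Sp_Q n g" and \<gamma>: "Gamma_level n N \<gamma>"
    and Z: "Z \<in> bc_fixed n g \<gamma>"
  shows "in_satake_closure n (\<Union>\<gamma>'\<in>{\<gamma>'. Gamma_level n N \<gamma>'}. fixed_set n \<gamma>') g Z"
proof -
  obtain q where q: "n = Suc q" using n by (cases n) auto
  obtain \<gamma>' where \<gamma>': "Gamma_level n N \<gamma>'" "tau_g n \<gamma>' * \<gamma>' = 1\<^sub>m (2 * n)" "Z \<in> bc_fixed n g \<gamma>'"
    using bc_fixed_involution[OF N g[unfolded q] \<gamma>[unfolded q] Z[unfolded q]] unfolding q by blast
  have "is_Sp n g" "is_Sp n \<gamma>'" using g \<gamma>'(1) unfolding is_Sp_Q_def Gamma_level_iff by auto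
  with \<gamma>' have "in_satake_closure n (fixed_set n \<gamma>') g Z"
    unfolding q by (intro in_satake_closure_involution)
  then show ?thesis by (rule in_satake_closure_mono) (use \<gamma>'(1) in blast)
qed

theorem theorem9p2:
  fixes n m :: nat and g \<gamma> :: "real mat"
  assumes n: "n \<ge> 2" and m: "m \<ge> 1"
    and g: "is_Sp_Q n g"
    and \<gamma>: "Gamma_level n (4*m) \<gamma>"
    and nonempty: "bc_fixed n g \<gamma> \<noteq> {}"
  shows "\<forall>Z \<in> bc_fixed n g \<gamma>.
           in_satake_closure n (\<Union>\<gamma>'\<in>{\<gamma>'. Gamma_level n (4*m) \<gamma>'}. fixed_set n \<gamma>') g Z"
  using bc_fixed_subset_satake_closure[OF _ _ _ g \<gamma>] n m by simp

end
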